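(* Let $d\in\mathbb{N}$ and let $T,\tilde T:[-1,1]^d\to[-1,1]^d$ be bijective, monotone, and triangular. Define $S:=T^{-1}$ and $\tilde S:=\tilde T^{-1}$ and assume that $T,S\in W^{2,\infty}([-1,1]^d)$ and $\tilde T,\tilde S\in W^{1,\infty}([-1,1]^d)$. Let $\rho$ be a probability measure on $[-1,1]^d$ such that $f_\rho:=\frac{d\rho}{d\mu}:[-1,1]^d\to(0,\infty)$ is strictly positive and Lipschitz continuous. Suppose that $\tau_0>0$ is such that $\|d\tilde S\|_{L^\infty([-1,1]^d)}<\frac1{\tau_0}$ and $\tilde S_{\min}\ge\tau_0$. Then there exists $C$ depending on $\tau_0$ but not on $\tilde T$ (it may depend on $T$, $\rho$, $d$) such that for $\mathrm{dist}\in\{\mathrm{H},\mathrm{TV}\}$ $$\mathrm{dist}(T_\sharp\rho,\tilde T_\sharp\rho)\le C\,\|T-\tilde T\|_{W^{1,\infty}([-1,1]^d)}$$ and $$\mathrm{KL}(T_\sharp\rho\,\|\,\tilde T_\sharp\rho)\le C\Big(\|T-\tilde T\|_{W^{1,\infty}([-1,1]^d)}+\|T-\tilde T\|_{W^{1,\infty}([-1,1]^d)}^2\Big).$$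
   Context: $\mu$ is the product measure $\bigotimes_{j=1}^d\lambda/2$ on $[-1,1]^d$ ($\lambda$ Lebesgue measure on $[-1,1]$). A map $(T_j)_{j=1}^d$ on $[-1,1]^d$ is triangular if each $T_j$ depends only on $\boldsymbol x_{[j]}=(x_1,\dots,x_j)$, and monotone if $x_j\mapsto T_j(\boldsymbol x_{[j-1]},x_j)$ is monotonically increasing for all $\boldsymbol x_{[j-1]}$ and all $j$. $T_\sharp\rho(A)=\rho(T^{-1}(A))$. $\tilde S_{\min}:=\min_{j=1,\dots,d}\operatorname{ess\,inf}_{\boldsymbol x\in[-1,1]^j}\partial_{x_j}\tilde S_j(\boldsymbol x)$. $\|f\|_{W^{m,\infty}([-1,1]^d)}=\sum_{j=0}^m\operatorname{ess\,sup}\|d^jf\|$ (weak derivatives, Euclidean norm); for vector-valued maps the norm is the sum over components. $d\tilde S$ is the weak Jacobian matrix and $\|d\tilde S\|_{L^\infty}$ is the essential supremum of its spectral norm. For probability measures $\nu_1,\nu_2\ll\mu$: $\mathrm{H}(\nu_1,\nu_2)=\big(\frac12\int(\sqrt{d\nu_1/d\mu}-\sqrt{d\nu_2/d\mu})^2d\mu\big)^{1/2}$; $\mathrm{TV}(\nu_1,\nu_2)=\sup_A|\nu_1(A)-\nu_2(A)|=\frac12\int|d\nu_1/d\mu-d\nu_2/d\mu|\,d\mu$; $\mathrm{KL}(\nu_1\|\nu_2)=\int\log(d\nu_1/d\nu_2)\,d\nu_1$ if $\nu_1\ll\nu_2$ and $\infty$ otherwise. *)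

theory Defs
  imports "HOL-Probability.Probability"
begin

text \<open>The space \<open>\<real>\<^sup>d\<close> is \<open>real ^ 'n\<close>, where the coordinates are indexed by an arbitrary finite linear
  order \<open>'n\<close> (so \<open>d = CARD('n)\<close>, and the order of \<open>'n\<close> is the order \<open>1 < \<dots> < d\<close> of the
  coordinates). Functions on the cube are total functions whose values outside the cube are
  irrelevant. The vector \<open>1\<close> is \<open>(1, \<dots>, 1)\<close>.\<close>

abbreviation cube :: "(real ^ 'n) set" where
  "cube \<equiv> cbox (- 1) 1"

abbreviation lborel_cube :: "(real ^ 'n) measure" where
  "lborel_cube \<equiv> restrict_space lborel cube"

text \<open>The product measure of \<open>d\<close> copies of \<open>\<lambda>/2\<close>, transported from functions to vectors.\<close>

definition mu :: "(real ^ 'n) measure" where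
  "mu = distr (\<Pi>\<^sub>M j\<in>UNIV. scale_measure (1 / 2) (restrict_space lborel {-1..1::real}))
          (restrict_space borel cube) vec_lambda"

definition triangular :: "(real ^ 'n::{finite,linorder} \<Rightarrow> real ^ 'n::{finite,linorder}) \<Rightarrow> bool" where
  "triangular T \<longleftrightarrow>
     (\<forall>j. \<forall>x\<in>cube. \<forall>y\<in>cube. (\<forall>k\<le>j. x $ k = y $ k) \<longrightarrow> T x $ j = T y $ j)"

definition coord_monotone :: "(real ^ 'n::{finite,linorder} \<Rightarrow> real ^ 'n::{finite,linorder}) \<Rightarrow> bool" where
  "coord_monotone T \<longleftrightarrow>
     (\<forall>j. \<forall>x\<in>cube. mono_on {-1..1} (\<lambda>t. T (\<chi> k. if k = j then t else x $ k) $ j))"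

definition partial_deriv :: "'n \<Rightarrow> (real ^ 'n \<Rightarrow> real) \<Rightarrow> real ^ 'n \<Rightarrow> real" where
  "partial_deriv i f x = frechet_derivative f (at x) (axis i 1)"

text \<open>For a list \<open>\<alpha> = [i\<^sub>1, \<dots>, i\<^sub>k]\<close> of coordinates this is \<open>\<partial>\<^bsub>i\<^sub>1\<^esub> \<dots> \<partial>\<^bsub>i\<^sub>k\<^esub> f\<close>.\<close>

definition iter_partial :: "'n list \<Rightarrow> (real ^ 'n \<Rightarrow> real) \<Rightarrow> real ^ 'n \<Rightarrow> real" where
  "iter_partial \<alpha> f = foldr partial_deriv \<alpha> f"

text \<open>Smooth functions with compact support in the open cube. All iterated partial derivatives
  being (Frechet) differentiable makes them continuous, hence this is \<open>C\<^sup>\<infinity>\<close>; the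
  support is bounded, hence compact.\<close>

definition test_function :: "(real ^ 'n \<Rightarrow> real) \<Rightarrow> bool" where
  "test_function \<phi> \<longleftrightarrow>
     (\<forall>\<alpha> x. iter_partial \<alpha> \<phi> differentiable (at x)) \<and> closure {x. \<phi> x \<noteq> 0} \<subseteq> box (- 1) 1"

definition locally_integrable :: "(real ^ 'n \<Rightarrow> real) \<Rightarrow> bool" where
  "locally_integrable f \<longleftrightarrow>
     f \<in> borel_measurable lborel_cube \<and>
     (\<forall>K. compact K \<and> K \<subseteq> box (- 1) 1 \<longrightarrow> set_integrable lborel K f)"

definition has_weak_deriv ::
  "(real ^ 'n \<Rightarrow> real) \<Rightarrow> 'n list \<Rightarrow> (real ^ 'n \<Rightarrow> real) \<Rightarrow> bool" where
  "has_weak_deriv f \<alpha> g \<longleftrightarrow>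
     locally_integrable f \<and> locally_integrable g \<and>
     (\<forall>\<phi>. test_function \<phi> \<longrightarrow>
        (\<integral>x. f x * iter_partial \<alpha> \<phi> x \<partial>lborel_cube)
          = (- 1) ^ length \<alpha> * (\<integral>x. g x * \<phi> x \<partial>lborel_cube))"

text \<open>The weak derivative is unique up to null sets, so any choice is as good as another.\<close>

definition weak_deriv :: "'n list \<Rightarrow> (real ^ 'n \<Rightarrow> real) \<Rightarrow> real ^ 'n \<Rightarrow> real" where
  "weak_deriv \<alpha> f = (SOME g. has_weak_deriv f \<alpha> g)"

definition weak_jacobian :: "(real ^ 'n \<Rightarrow> real ^ 'n) \<Rightarrow> real ^ 'n \<Rightarrow> real ^ 'n ^ 'n" where
  "weak_jacobian T x = (\<chi> i j. weak_deriv [j] (\<lambda>x. T x $ i) x)"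

text \<open>Membership refers to Borel functions defined pointwise on the cube; \<open>\<alpha> = []\<close> gives
  essential boundedness of the function itself.\<close>

definition sobolev_inf :: "nat \<Rightarrow> (real ^ 'n \<Rightarrow> real) \<Rightarrow> bool" where
  "sobolev_inf m f \<longleftrightarrow>
     f \<in> borel_measurable lborel_cube \<and>
     (\<forall>\<alpha>. length \<alpha> \<le> m \<longrightarrow>
        (\<exists>g. has_weak_deriv f \<alpha> g \<and> (\<exists>B. AE x in lborel_cube. \<bar>g x\<bar> \<le> B)))"

definition sobolev_inf_map :: "nat \<Rightarrow> (real ^ 'n \<Rightarrow> real ^ 'n) \<Rightarrow> bool" where
  "sobolev_inf_map m T \<longleftrightarrow> (\<forall>i. sobolev_inf m (\<lambda>x. T x $ i))"

text \<open>The \<open>j\<close>-th derivative is the tensor of all \<open>d\<^sup>j\<close> partial derivatives of order \<open>j\<close>, whence the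
  sum over all lists (not multi-indices) of length \<open>j\<close> in its Euclidean norm.\<close>

definition sobolev_norm :: "nat \<Rightarrow> (real ^ 'n \<Rightarrow> real) \<Rightarrow> ereal" where
  "sobolev_norm m f =
     (\<Sum>j\<le>m. esssup lborel_cube
        (\<lambda>x. ereal (sqrt (\<Sum>\<alpha> | length \<alpha> = j. (weak_deriv \<alpha> f x)\<^sup>2))))"

definition sobolev_norm_map :: "nat \<Rightarrow> (real ^ 'n \<Rightarrow> real ^ 'n) \<Rightarrow> ereal" where
  "sobolev_norm_map m T = (\<Sum>i\<in>UNIV. sobolev_norm m (\<lambda>x. T x $ i))"

definition jacobian_sup_norm :: "(real ^ 'n \<Rightarrow> real ^ 'n) \<Rightarrow> ereal" where
  "jacobian_sup_norm T = esssup lborel_cube (\<lambda>x. ereal (onorm ((*v) (weak_jacobian T x))))"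

definition essinf_cube :: "(real ^ 'n \<Rightarrow> real) \<Rightarrow> ereal" where
  "essinf_cube f = - esssup lborel_cube (\<lambda>x. - ereal (f x))"

text \<open>As components of maps on the cube, the functions \<open>S\<^sub>j\<close> of \<open>(x\<^sub>1, \<dots>, x\<^sub>j)\<close> are considered as
  functions on the whole cube that do not depend on the remaining variables.\<close>

definition diag_min :: "(real ^ 'n \<Rightarrow> real ^ 'n) \<Rightarrow> ereal" where
  "diag_min S = (MIN j. essinf_cube (weak_deriv [j] (\<lambda>x. S x $ j)))"

abbreviation push :: "(real ^ 'n \<Rightarrow> real ^ 'n) \<Rightarrow> (real ^ 'n) measure \<Rightarrow> (real ^ 'n) measure" where
  "push T \<rho> \<equiv> distr \<rho> (restrict_space borel cube) T"

text \<open>The value \<open>\<infinity>\<close> outside the domain of definition prevents bounds on the Hellinger distance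
  from holding for measures that have no density with respect to \<open>mu\<close>.\<close>

definition hellinger :: "(real ^ 'n) measure \<Rightarrow> (real ^ 'n) measure \<Rightarrow> ereal" where
  "hellinger \<nu>1 \<nu>2 =
     (if absolutely_continuous mu \<nu>1 \<and> absolutely_continuous mu \<nu>2
      then ereal (sqrt (1 / 2 * (\<integral>x. (sqrt (enn2real (RN_deriv mu \<nu>1 x))
                                     - sqrt (enn2real (RN_deriv mu \<nu>2 x)))\<^sup>2 \<partial>mu)))
      else \<infinity>)"

definition total_var :: "'a measure \<Rightarrow> 'a measure \<Rightarrow> real" where
  "total_var \<nu>1 \<nu>2 = (SUP A\<in>sets \<nu>1. \<bar>measure \<nu>1 A - measure \<nu>2 A\<bar>)"

text \<open>The library's \<open>KL_divergence b M N\<close> is real-valued and corresponds to \<open>KL(N || M)\<close>. For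
  probability measures the negative part of the logarithm is always integrable with respect
  to \<open>\<nu>1\<close>, so non-integrability means that the integral is \<open>\<infinity>\<close>.\<close>

definition kl_div :: "'a measure \<Rightarrow> 'a measure \<Rightarrow> ereal" where
  "kl_div \<nu>1 \<nu>2 =
     (if absolutely_continuous \<nu>2 \<nu>1 \<and> integrable \<nu>1 (entropy_density (exp 1) \<nu>2 \<nu>1)
      then ereal (KL_divergence (exp 1) \<nu>2 \<nu>1) else \<infinity>)"

end

(*
  Let f be the density of rho. The density of the push-forward of rho under T is F = f(S) det dS, which is
  Lipschitz because S has two bounded weak derivatives, and F(T) det dT = f; similarly for T' with density F'.
  Hence F(T') / F'(T') = F(T') det dT' / f is within a constant times delta = ||T - T'|| of
  F(T) det dT / f = 1: this uses the Lipschitz bound on F, and f is bounded below. If delta > 1, the lower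
  bound on the diagonal of dS' bounds det dT' and the estimate is trivial. So |F - F'| <= C delta F' almost
  everywhere, which bounds all three distances.

  Sobolev maps are determined only up to null sets. The bulk of the proof shows that the Lipschitz
  representatives of T and S are again triangular, monotone and inverse to each other, and that the change of
  variables formula holds for them. By triangularity the latter reduces, one coordinate at a time, to the
  substitution rule for monotone absolutely continuous functions on an interval, so that neither
  Rademacher's theorem nor the area formula is needed.
*)

theory Submission
  imports Defs "HOL-Computational_Algebra.Polynomial"
begin

section \<open>The uniform distribution on the cube\<close>

text \<open>Everything happens along lines parallel to the axes. Therefore the cube carries the
  probability measure \<open>unif_cube\<close> on all Borel sets of the space: replacing one
  coordinate of a uniform point by an independent uniform number leaves the distribution unchanged,
  so Fubini in direction \<open>j\<close> is a statement about \<open>vec_upd\<close> and can be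
  iterated without splitting the space into factors. The Jacobian determinant only occurs as the
  product of the diagonal weak derivatives, and each factor is known only through increments along
  lines in its own direction. The densities involve the inverse maps, while delta measures the
  distance of \<open>T\<close> and \<open>T'\<close>. Hence the densities are compared at the points
  \<open>T' x\<close>, where the Jacobian of \<open>S'\<close> becomes the reciprocal of the
  Jacobian of \<open>T'\<close>. To return to almost every point of the cube, preimages of null sets
  must be null; this comes from the two Jacobians having product 1 almost everywhere, which is read
  off by changing variables twice, without a chain rule.\<close>

definition unif_interval :: "real measure" where
  "unif_interval = uniform_measure lborel {-1..1}"

definition unif_cube :: "(real ^ 'n) measure" where
  "unif_cube = uniform_measure lborel cube"

definition vec_upd :: "real ^ 'n \<Rightarrow> 'n \<Rightarrow> real \<Rightarrow> real ^ 'n" where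
  "vec_upd x j t = (\<chi> k. if k = j then t else x $ k)"

lemma vec_upd_nth [simp]: "vec_upd x j t $ k = (if k = j then t else x $ k)"
  by (simp add: vec_upd_def)

lemma vec_upd_self [simp]: "vec_upd x j (x $ j) = x"
  by (simp add: vec_eq_iff)

lemma vec_upd_upd [simp]: "vec_upd (vec_upd x j s) j t = vec_upd x j t"
  by (simp add: vec_eq_iff)

lemma vec_upd_commute: "j \<noteq> k \<Longrightarrow> vec_upd (vec_upd x j s) k t = vec_upd (vec_upd x k t) j s"
  by (simp add: vec_eq_iff)

lemma mem_cube_iff: "x \<in> cube \<longleftrightarrow> (\<forall>i. x $ i \<in> {-1..1})" for x :: "real ^ 'n"
  by (auto simp: mem_box_cart)

lemma vec_upd_in_cube: "x \<in> cube \<Longrightarrow> t \<in> {-1..1} \<Longrightarrow> vec_upd x j t \<in> cube"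
  by (auto simp: mem_cube_iff)

lemma borel_measurable_vec:
  fixes f :: "'a \<Rightarrow> real ^ 'n"
  assumes "\<And>i. (\<lambda>x. f x $ i) \<in> borel_measurable M"
  shows "f \<in> borel_measurable M"
  by (subst borel_measurable_euclidean_space)
    (auto simp: Basis_vec_def inner_axis intro: assms)

lemma borel_measurable_vec_nth' [measurable]:
  fixes i :: "'n::finite"
  shows "(\<lambda>x :: real ^ 'n. x $ i) \<in> borel_measurable borel"
  by (intro borel_measurable_continuous_onI continuous_intros)

lemma measurable_vec_upd [measurable (raw)]:
  fixes f :: "'a \<Rightarrow> real ^ 'n"
  assumes [measurable]: "f \<in> borel_measurable M" "g \<in> borel_measurable M"
  shows "(\<lambda>x. vec_upd (f x) j (g x)) \<in> borel_measurable M"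
  by (intro borel_measurable_vec) simp

lemma sets_unif_interval [simp, measurable_cong]: "sets unif_interval = sets borel"
  and space_unif_interval [simp]: "space unif_interval = UNIV"
  and sets_unif_cube [simp, measurable_cong]: "sets unif_cube = sets borel"
  and space_unif_cube [simp]: "space unif_cube = UNIV"
  by (simp_all add: unif_interval_def unif_cube_def)

interpretation unif_interval: prob_space unif_interval
  unfolding unif_interval_def by (intro prob_space_uniform_measure) auto

lemma emeasure_lborel_cube: "emeasure lborel (cube :: (real ^ 'n) set) = 2 ^ CARD('n)"
proof -
  have "emeasure lborel (cube :: (real ^ 'n) set) = ennreal (\<Prod>b\<in>Basis. (1 - (- 1) :: real ^ 'n) \<bullet> b)"
    by (subst emeasure_lborel_cbox) (auto simp: Basis_vec_def inner_axis)
  also have "(\<Prod>b\<in>Basis. (1 - (- 1) :: real ^ 'n) \<bullet> b) = (\<Prod>b\<in>(Basis :: (real ^ 'n) set). 2)"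
    by (rule prod.cong) (auto simp: Basis_vec_def inner_axis)
  also have "\<dots> = 2 ^ CARD('n)" by simp
  finally show ?thesis by (simp add: ennreal_power[symmetric])
qed

lemma power2_neq_top [simp]: "(2 :: ennreal) ^ n \<noteq> \<top>"
  using ennreal_power[of 2 n] by (metis ennreal_numeral ennreal_neq_top zero_le_numeral)

interpretation unif_cube: prob_space "unif_cube :: (real ^ 'n) measure"
  unfolding unif_cube_def
  by (intro prob_space_uniform_measure) (auto simp: emeasure_lborel_cube)

interpretation unif_pair: pair_sigma_finite "unif_cube :: (real ^ 'n) measure" unif_interval ..

lemma emeasure_unif_interval:
  "A \<in> sets borel \<Longrightarrow> emeasure unif_interval A = emeasure lborel ({-1..1} \<inter> A) / 2"
  by (simp add: unif_interval_def)

lemma emeasure_unif_cube: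
  "A \<in> sets borel \<Longrightarrow> emeasure unif_cube A = emeasure lborel (cube \<inter> A) / 2 ^ CARD('n)"
  for A :: "(real ^ 'n) set"
  by (simp add: unif_cube_def emeasure_lborel_cube)

section \<open>Product structure of Lebesgue measure and of the uniform measure\<close>

lemma vec_lambda_measurable [measurable]:
  assumes "\<And>i. sets (M i) = sets (borel :: real measure)"
  shows "vec_lambda \<in> measurable (PiM (UNIV :: 'n::finite set) M) borel"
proof (rule borel_measurable_vec)
  fix i :: 'n
  have "(\<lambda>x. x i) \<in> measurable (PiM UNIV M) (M i)"
    by (intro measurable_component_singleton) auto
  then show "(\<lambda>x. vec_lambda x $ i) \<in> borel_measurable (PiM UNIV M)"
    using assms by (simp cong: measurable_cong_sets)
qed

lemma vec_nth_measurable [measurable]: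
  assumes "\<And>i. sets (M i) = sets (borel :: real measure)"
  shows "vec_nth \<in> measurable borel (PiM (UNIV :: 'n::finite set) M)"
proof -
  have sp: "space (M i) = UNIV" for i
    using sets_eq_imp_space_eq[OF assms[of i]] by simp
  show ?thesis
    by (intro measurable_PiM_single') (auto simp: sp cong: measurable_cong_sets[OF refl assms])
qed

text \<open>Both measures give a box the product of its side lengths, and these values determine
  Lebesgue measure. The reindexing at the end only matches \<open>Basis\<close> with the coordinate
  vectors \<open>axis i 1\<close>.\<close>

lemma lborel_vec_eq: "(lborel :: (real ^ 'n) measure) = distr (PiM UNIV (\<lambda>_. lborel)) borel vec_lambda"
proof (rule lborel_eqI)
  fix l u :: "real ^ 'n" assume *: "\<And>b. b \<in> Basis \<Longrightarrow> l \<bullet> b \<le> u \<bullet> b"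
  interpret product_sigma_finite "\<lambda>_::'n. lborel :: real measure"
    by unfold_locales
  have le: "l $ i \<le> u $ i" for i
    using *[of "axis i 1"] by (simp add: inner_axis axis_in_Basis_iff)
  have "emeasure (distr (PiM UNIV (\<lambda>_. lborel)) borel vec_lambda) (box l u)
      = emeasure (PiM UNIV (\<lambda>_. lborel)) (PiE UNIV (\<lambda>i. {l $ i <..< u $ i}))"
    by (subst emeasure_distr)
      (auto intro!: arg_cong2[where f=emeasure] simp: mem_box_cart space_PiM PiE_iff)
  also have "\<dots> = (\<Prod>i\<in>UNIV. ennreal (u $ i - l $ i))"
    by (subst emeasure_PiM) (auto simp: le)
  also have "\<dots> = ennreal (\<Prod>i\<in>UNIV. (u - l) $ i)"
    by (simp add: prod_ennreal le)
  also have "(\<Prod>i\<in>UNIV. (u - l) $ i) = (\<Prod>b\<in>Basis. (u - l) \<bullet> b)"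
  proof (rule prod.reindex_bij_witness[where j = "\<lambda>i. axis i 1" and i = "\<lambda>b. SOME i. b = axis i 1"])
    fix i :: 'n
    show "(SOME j. axis i (1::real) = axis j 1) = i"
      by (rule some_equality) (auto simp: axis_eq_axis)
  next
    fix b :: "real ^ 'n" assume "b \<in> Basis"
    then obtain i where "b = axis i 1" by (auto simp: Basis_vec_def)
    then have "b = axis (SOME i. b = axis i 1) 1" by (rule someI)
    then show "axis (SOME i. b = axis i 1) 1 = b" by simp
  qed (auto simp: Basis_vec_def inner_axis)
  finally show "emeasure (distr (PiM UNIV (\<lambda>_. lborel)) borel vec_lambda) (box l u)
      = ennreal (\<Prod>b\<in>Basis. (u - l) \<bullet> b)" .
qed simp

lemma measurable_rectangle [measurable]:
  fixes E :: "'n::finite \<Rightarrow> real set"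
  assumes "\<And>i. E i \<in> sets borel"
  shows "{x :: real ^ 'n. \<forall>i. x $ i \<in> E i} \<in> sets borel"
proof -
  have "{x :: real ^ 'n. \<forall>i. x $ i \<in> E i} = (\<Inter>i. (\<lambda>x. x $ i) -` E i \<inter> space borel)" by auto
  also have "\<dots> \<in> sets borel"
    using measurable_sets[OF borel_measurable_vec_nth' assms]
    by (intro sets.countable_INT') auto
  finally show ?thesis .
qed

lemma emeasure_lborel_rectangle:
  fixes E :: "'n::finite \<Rightarrow> real set"
  assumes "\<And>i. E i \<in> sets borel"
  shows "emeasure lborel {x :: real ^ 'n. \<forall>i. x $ i \<in> E i} = (\<Prod>i\<in>UNIV. emeasure lborel (E i))"
proof -
  interpret product_sigma_finite "\<lambda>_::'n. lborel :: real measure"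
    by unfold_locales
  have "emeasure lborel {x :: real ^ 'n. \<forall>i. x $ i \<in> E i}
      = emeasure (PiM UNIV (\<lambda>_. lborel)) (PiE UNIV E)"
    by (subst lborel_vec_eq, subst emeasure_distr)
      (auto intro!: arg_cong2[where f=emeasure] measurable_rectangle assms simp: space_PiM)
  also have "\<dots> = (\<Prod>i\<in>UNIV. emeasure lborel (E i))"
    by (subst emeasure_PiM) (auto simp: assms)
  finally show ?thesis .
qed

lemma emeasure_unif_cube_rectangle:
  fixes E :: "'n::finite \<Rightarrow> real set"
  assumes "\<And>i. E i \<in> sets borel"
  shows "emeasure unif_cube {x :: real ^ 'n. \<forall>i. x $ i \<in> E i} = (\<Prod>i\<in>UNIV. emeasure unif_interval (E i))"
proof -
  have "cube \<inter> {x :: real ^ 'n. \<forall>i. x $ i \<in> E i} = {x. \<forall>i. x $ i \<in> {-1..1} \<inter> E i}"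
    by (auto simp: mem_box_cart)
  then have "emeasure unif_cube {x :: real ^ 'n. \<forall>i. x $ i \<in> E i}
      = emeasure lborel {x :: real ^ 'n. \<forall>i. x $ i \<in> {-1..1} \<inter> E i} / 2 ^ CARD('n)"
    by (subst emeasure_unif_cube) (auto simp only: assms intro!: measurable_rectangle)
  also have "emeasure lborel {x :: real ^ 'n. \<forall>i. x $ i \<in> {-1..1} \<inter> E i}
      = (\<Prod>i\<in>UNIV. emeasure lborel ({-1..1} \<inter> E i))"
    by (rule emeasure_lborel_rectangle) (auto intro!: sets.Int assms)

  \<comment> \<open>One factor 1/2 is handed to each of the \<open>CARD('n)\<close>
    coordinates.\<close>
  also have "(\<Prod>i\<in>UNIV. emeasure lborel ({-1..1} \<inter> E i)) / 2 ^ CARD('n)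
      = (\<Prod>i\<in>(UNIV :: 'n set). emeasure lborel ({-1..1} \<inter> E i) / 2)"
    by (simp add: divide_ennreal_def prod.distrib ennreal_inverse_power)
  finally show ?thesis using assms by (simp add: emeasure_unif_interval)
qed

text \<open>Rectangles determine a product measure. The inner claim identifies any measure with the
  right values on rectangles as the image of the product measure under \<open>vec_lambda\<close>;
  applying it to \<open>N\<close> and to \<open>unif_cube\<close> gives the equality.\<close>

lemma unif_cube_eqI:
  fixes N :: "(real ^ 'n) measure"
  assumes sets: "sets N = sets borel"
    and eq: "\<And>E. (\<And>i. E i \<in> sets borel) \<Longrightarrow>
      emeasure N {x. \<forall>i. x $ i \<in> E i} = (\<Prod>i\<in>UNIV. emeasure unif_interval (E i))"
  shows "N = unif_cube"
proof -
  interpret product_prob_space "\<lambda>_::'n. unif_interval" UNIV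
    by unfold_locales
  have *: "N = distr (PiM UNIV (\<lambda>_. unif_interval)) borel vec_lambda"
    if sets: "sets N = sets borel" and eq: "\<And>E. (\<And>i. E i \<in> sets borel) \<Longrightarrow>
      emeasure N {x. \<forall>i. x $ i \<in> E i} = (\<Prod>i\<in>UNIV. emeasure unif_interval (E i))" for N :: "(real ^ 'n) measure"
  proof -
    have sp: "space N = UNIV" using sets_eq_imp_space_eq[OF sets] by simp
    have m: "vec_nth \<in> measurable N (PiM UNIV (\<lambda>_::'n. unif_interval))"
      using vec_nth_measurable[of "\<lambda>_. unif_interval"] sets by (simp cong: measurable_cong_sets)
    have "distr N (PiM UNIV (\<lambda>_. unif_interval)) vec_nth = PiM UNIV (\<lambda>_. unif_interval)"
    proof (rule PiM_eqI)
      fix A :: "'n \<Rightarrow> real set" assume A: "\<And>i. i \<in> UNIV \<Longrightarrow> A i \<in> sets unif_interval"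
      have "emeasure (distr N (PiM UNIV (\<lambda>_. unif_interval)) vec_nth) (PiE UNIV A)
          = emeasure N {x. \<forall>i. x $ i \<in> A i}"
        using A by (subst emeasure_distr[OF m]) (auto intro!: arg_cong2[where f=emeasure] sets_PiM_I_finite simp: sp)
      then show "emeasure (distr N (PiM UNIV (\<lambda>_. unif_interval)) vec_nth) (PiE UNIV A)
          = (\<Prod>i\<in>UNIV. emeasure unif_interval (A i))"
        using eq A by simp
    qed auto
    then have "distr (PiM UNIV (\<lambda>_. unif_interval)) borel vec_lambda
        = distr (distr N (PiM UNIV (\<lambda>_. unif_interval)) vec_nth) borel vec_lambda" by simp
    also have "\<dots> = distr N borel (\<lambda>x. x)"
      by (subst distr_distr[OF vec_lambda_measurable m]) (auto simp: comp_def)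
    also have "\<dots> = N"
      using sets by (intro distr_id2) auto
    finally show ?thesis by simp
  qed
  show ?thesis
    using *[OF sets eq] *[OF sets_unif_cube emeasure_unif_cube_rectangle] by simp
qed

text \<open>In a rectangle, the condition on coordinate \<open>j\<close> falls on the fresh number
  \<open>t\<close>, while the old coordinate \<open>j\<close> is free and contributes the total mass
  1. This invariance takes the place of Fubini's theorem for a splitting of the space.\<close>

lemma distr_vec_upd:
  "distr (unif_cube \<Otimes>\<^sub>M unif_interval) borel (\<lambda>(x, t). vec_upd x j t) = (unif_cube :: (real ^ 'n) measure)"
proof (rule unif_cube_eqI)
  fix E :: "'n \<Rightarrow> real set" assume E: "\<And>i. E i \<in> sets borel"
  define E' where "E' = E(j := UNIV)"
  have E': "E' i \<in> sets borel" for i using E by (auto simp: E'_def)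
  have "emeasure (distr (unif_cube \<Otimes>\<^sub>M unif_interval) borel (\<lambda>(x, t). vec_upd x j t)) {x. \<forall>i. x $ i \<in> E i}
      = emeasure (unif_cube \<Otimes>\<^sub>M unif_interval) ({x. \<forall>i. x $ i \<in> E' i} \<times> E j)"
    by (subst emeasure_distr)
      (auto intro!: arg_cong2[where f=emeasure] measurable_rectangle E
        simp: E'_def space_pair_measure split: if_splits)
  also have "\<dots> = (\<Prod>i\<in>UNIV. emeasure unif_interval (E' i)) * emeasure unif_interval (E j)"
    using E' E by (subst unif_interval.emeasure_pair_measure_Times)
      (auto intro!: measurable_rectangle simp: emeasure_unif_cube_rectangle)
  also have "(\<Prod>i\<in>UNIV. emeasure unif_interval (E' i)) = (\<Prod>i\<in>UNIV - {j}. emeasure unif_interval (E i))"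
    using unif_interval.emeasure_space_1
    by (subst prod.remove[of _ j]) (auto simp: E'_def intro!: prod.cong)
  finally show "emeasure (distr (unif_cube \<Otimes>\<^sub>M unif_interval) borel (\<lambda>(x, t). vec_upd x j t)) {x. \<forall>i. x $ i \<in> E i}
      = (\<Prod>i\<in>UNIV. emeasure unif_interval (E i))"
    by (simp add: prod.remove[of UNIV j] mult.commute)
qed simp

lemma nn_integral_vec_upd:
  fixes u :: "real ^ 'n \<Rightarrow> ennreal"
  assumes [measurable]: "u \<in> borel_measurable borel"
  shows "(\<integral>\<^sup>+x. u x \<partial>unif_cube) = (\<integral>\<^sup>+x. \<integral>\<^sup>+t. u (vec_upd x j t) \<partial>unif_interval \<partial>unif_cube)"
proof -
  have "(\<integral>\<^sup>+x. u x \<partial>unif_cube)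
      = (\<integral>\<^sup>+x. u x \<partial>(distr (unif_cube \<Otimes>\<^sub>M unif_interval) borel (\<lambda>(x, t). vec_upd x j t)))"
    by (simp add: distr_vec_upd)
  also have "\<dots> = (\<integral>\<^sup>+z. u (case z of (x, t) \<Rightarrow> vec_upd x j t) \<partial>(unif_cube \<Otimes>\<^sub>M unif_interval))"
    by (subst nn_integral_distr) auto
  also have "\<dots> = (\<integral>\<^sup>+x. \<integral>\<^sup>+t. u (vec_upd x j t) \<partial>unif_interval \<partial>unif_cube)"
    by (subst unif_interval.nn_integral_fst[symmetric]) auto
  finally show ?thesis .
qed

lemma AE_vec_upd_iff:
  fixes P :: "real ^ 'n \<Rightarrow> bool"
  assumes [measurable]: "Measurable.pred borel P"
  shows "(AE x in unif_cube. AE t in unif_interval. P (vec_upd x j t)) \<longleftrightarrow> (AE x in unif_cube. P x)"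
proof -
  have "(AE x in unif_cube. P x)
      \<longleftrightarrow> (AE x in distr (unif_cube \<Otimes>\<^sub>M unif_interval) borel (\<lambda>(x, t). vec_upd x j t). P x)"
    unfolding distr_vec_upd ..
  also have "\<dots> \<longleftrightarrow> (AE z in unif_cube \<Otimes>\<^sub>M unif_interval. P (case z of (x, t) \<Rightarrow> vec_upd x j t))"
    by (subst AE_distr_iff) auto
  also have "\<dots> \<longleftrightarrow> (AE x in unif_cube. AE t in unif_interval. P (vec_upd x j t))"
    by (subst unif_pair.AE_pair_iff, intro predE, measurable) (simp add: split_beta')
  finally show ?thesis by simp
qed

text \<open>Covers predicates that are not known to be measurable: the exceptional set is enlarged
  to a Borel null set, to which \<open>AE_vec_upd_iff\<close> applies.\<close>

lemma AE_vec_updD: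
  fixes P :: "real ^ 'n \<Rightarrow> bool"
  assumes "AE x in unif_cube. P x"
  shows "AE x in unif_cube. AE t in unif_interval. P (vec_upd x j t)"
proof -
  obtain N where N: "N \<in> null_sets unif_cube" "{x \<in> space unif_cube. \<not> P x} \<subseteq> N"
    using assms by (auto simp: eventually_ae_filter)
  then have [measurable]: "N \<in> sets borel" by auto
  have "AE x in unif_cube. x \<notin> N" using N(1) by (rule AE_not_in)
  then have "AE x in unif_cube. AE t in unif_interval. vec_upd x j t \<notin> N"
    by (subst AE_vec_upd_iff) auto
  then show ?thesis using N(2) by (auto elim!: eventually_mono)
qed

lemma AE_unif_interval_iff:
  "(AE t in unif_interval. P t) \<longleftrightarrow> (AE t in lborel. t \<in> {-1..1} \<longrightarrow> P t)"
  unfolding unif_interval_def by (subst AE_uniform_measure) auto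

lemma AE_unif_cube_iff:
  "(AE x in unif_cube. P x) \<longleftrightarrow> (AE x in lborel. x \<in> cube \<longrightarrow> P x)" for P :: "real ^ 'n \<Rightarrow> bool"
  unfolding unif_cube_def
  by (subst AE_uniform_measure) (auto simp: emeasure_lborel_cube less_top[symmetric])

lemma AE_lborel_cube_iff:
  "(AE x in lborel_cube. P x) \<longleftrightarrow> (AE x in unif_cube. P x)" for P :: "real ^ 'n \<Rightarrow> bool"
  by (simp add: AE_unif_cube_iff AE_restrict_space_iff)

lemma AE_in_cube: "AE x in unif_cube. x \<in> (cube :: (real ^ 'n) set)"
  by (simp add: AE_unif_cube_iff)

text \<open>Links the measure of the theorem to \<open>unif_cube\<close>. Both \<open>mu\<close> and
  the restriction of \<open>unif_cube\<close> correspond under \<open>vec_nth\<close> and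
  \<open>vec_lambda\<close> to the product of the normalised one-dimensional measures, because they
  agree on rectangles inside the cube.\<close>

lemma mu_eq: "(mu :: (real ^ 'n) measure) = restrict_space unif_cube cube"
proof -
  let ?S = "scale_measure (1 / 2) (restrict_space lborel {-1..1::real})"
  let ?P = "PiM (UNIV :: 'n set) (\<lambda>_. ?S)"
  let ?R = "restrict_space unif_cube cube :: (real ^ 'n) measure"
  have S: "emeasure ?S A = emeasure unif_interval A" if "A \<in> sets ?S" for A
  proof -
    have "A \<in> sets borel" "A \<subseteq> {-1..1}"
      using that by (auto simp: sets_restrict_space_iff)
    then show ?thesis
      by (simp add: emeasure_unif_interval emeasure_restrict_space divide_ennreal_def inf.absorb2 mult.commute)
  qed
  have "prob_space ?S"
    by (intro prob_spaceI, subst S[OF sets.top])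
      (simp add: space_scale_measure space_restrict_space emeasure_unif_interval)
  then interpret product_prob_space "\<lambda>_::'n. ?S" UNIV
    by (intro product_prob_spaceI)
  have sets_R: "sets ?R = sets (restrict_space borel cube)"
    by (simp cong: sets_restrict_space_cong)
  have nth: "vec_nth \<in> measurable ?R ?P"
  proof (rule measurable_PiM_single')
    fix i :: 'n
    have "(\<lambda>x. x $ i) \<in> measurable (restrict_space unif_cube (cube :: (real ^ 'n) set)) (restrict_space lborel {-1..1})"
      by (rule measurable_restrict_space3) (auto simp: mem_box_cart)
    then show "(\<lambda>x. x $ i) \<in> measurable ?R ?S"
      by (simp cong: measurable_cong_sets)
  qed (auto simp: space_restrict_space mem_box_cart space_scale_measure)
  have lam: "vec_lambda \<in> measurable ?P (restrict_space borel cube)"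
  proof (rule measurable_restrict_space2)
    show "vec_lambda \<in> space ?P \<rightarrow> cube"
      by (auto simp: space_PiM space_scale_measure mem_box_cart PiE_iff)
    show "vec_lambda \<in> borel_measurable ?P"
    proof (rule borel_measurable_vec)
      fix i :: 'n
      have "(\<lambda>x. x i) \<in> measurable ?P ?S" by (intro measurable_component_singleton) auto
      then have "(\<lambda>x. x i) \<in> measurable ?P (restrict_space lborel {-1..1})"
        by (simp cong: measurable_cong_sets)
      then have "(\<lambda>x. x i) \<in> measurable ?P lborel" by (simp add: measurable_restrict_space2_iff)
      then show "(\<lambda>x. vec_lambda x $ i) \<in> borel_measurable ?P" by simp
    qed
  qed
  have "distr ?R ?P vec_nth = ?P"
  proof (rule PiM_eqI)
    fix A :: "'n \<Rightarrow> real set" assume A: "\<And>i. i \<in> UNIV \<Longrightarrow> A i \<in> sets ?S"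
    then have A': "A i \<in> sets borel" "A i \<subseteq> {-1..1}" for i
      by (auto simp: sets_restrict_space_iff)
    have sub: "{x. \<forall>i. x $ i \<in> A i} \<subseteq> (cube :: (real ^ 'n) set)"
      using A'(2) by (force simp: mem_cube_iff)
    have "emeasure (distr ?R ?P vec_nth) (PiE UNIV A) = emeasure ?R {x. \<forall>i. x $ i \<in> A i}"
      using A sub by (subst emeasure_distr[OF nth]) (auto intro!: arg_cong2[where f=emeasure] sets_PiM_I_finite
          simp: space_restrict_space)
    also have "\<dots> = emeasure unif_cube {x :: real ^ 'n. \<forall>i. x $ i \<in> A i}"
      using sub by (intro emeasure_restrict_space) auto
    also have "\<dots> = (\<Prod>i\<in>UNIV. emeasure ?S (A i))"
      using A A' by (subst emeasure_unif_cube_rectangle) (auto simp: S[symmetric] simp del: emeasure_scale_measure)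
    finally show "emeasure (distr ?R ?P vec_nth) (PiE UNIV A) = (\<Prod>i\<in>UNIV. emeasure ?S (A i))" .
  qed auto
  then have "mu = distr (distr ?R ?P vec_nth) (restrict_space borel cube) vec_lambda"
    by (simp add: mu_def)
  also have "\<dots> = distr ?R (restrict_space borel cube) (\<lambda>x. x)"
    by (subst distr_distr[OF lam nth]) (auto simp: comp_def)
  also have "\<dots> = ?R"
    using sets_R by (intro distr_id2) auto
  finally show ?thesis .
qed

section \<open>Products of one-dimensional bumps\<close>

primrec times_diff :: "nat \<Rightarrow> (real \<Rightarrow> real) \<Rightarrow> bool" where
  "times_diff 0 f \<longleftrightarrow> True"
| "times_diff (Suc n) f \<longleftrightarrow> (\<exists>f'. (\<forall>x. (f has_real_derivative f' x) (at x)) \<and> times_diff n f')"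

definition smooth :: "(real \<Rightarrow> real) \<Rightarrow> bool" where
  "smooth f \<longleftrightarrow> (\<forall>n. times_diff n f)"

lemma times_diff_SucD: "times_diff (Suc n) f \<Longrightarrow> times_diff n f"
proof (induction n arbitrary: f)
  case (Suc n)
  then obtain f' where "\<forall>x. (f has_real_derivative f' x) (at x)" "times_diff (Suc n) f'"
    by (auto simp del: times_diff.simps(2) simp: times_diff.simps(2)[of "Suc n" f])
  with Suc.IH show ?case by auto
qed simp

lemma times_diff_add: "times_diff n f \<Longrightarrow> times_diff n g \<Longrightarrow> times_diff n (\<lambda>x. f x + g x)"
proof (induction n arbitrary: f g)
  case (Suc n)
  then obtain f' g' where "\<forall>x. (f has_real_derivative f' x) (at x)" "times_diff n f'"
    "\<forall>x. (g has_real_derivative g' x) (at x)" "times_diff n g'" by auto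
  with Suc.IH[of f' g'] show ?case
    by (auto intro!: exI[of _ "\<lambda>x. f' x + g' x"] derivative_intros)
qed simp

lemma times_diff_mult: "times_diff n f \<Longrightarrow> times_diff n g \<Longrightarrow> times_diff n (\<lambda>x. f x * g x)"
proof (induction n arbitrary: f g)
  case (Suc n)
  then obtain f' g' where *: "\<forall>x. (f has_real_derivative f' x) (at x)" "times_diff n f'"
    "\<forall>x. (g has_real_derivative g' x) (at x)" "times_diff n g'" by auto
  have "times_diff n f" "times_diff n g" using Suc.prems times_diff_SucD by blast+
  then have "times_diff n (\<lambda>x. f' x * g x + g' x * f x)"
    using * by (intro times_diff_add Suc.IH)
  moreover have "\<forall>x. ((\<lambda>x. f x * g x) has_real_derivative f' x * g x + g' x * f x) (at x)"
    using * by (auto intro!: DERIV_mult)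
  ultimately show ?case by auto
qed simp

lemma times_diff_const: "times_diff n (\<lambda>x. c)"
proof (induction n arbitrary: c)
  case (Suc n)
  then show ?case by (auto intro!: exI[of _ "\<lambda>_. 0"])
qed simp

lemma times_diff_affine: "times_diff n f \<Longrightarrow> times_diff n (\<lambda>x. f (a * x + b))"
proof (induction n arbitrary: f)
  case (Suc n)
  then obtain f' where *: "\<forall>x. (f has_real_derivative f' x) (at x)" "times_diff n f'" by auto
  have "((\<lambda>x. f (a * x + b)) has_real_derivative f' (a * x + b) * a) (at x)" for x
    using * by (auto intro!: derivative_eq_intros DERIV_chain2[where f = f and g = "\<lambda>x. a * x + b"])
  moreover have "times_diff n (\<lambda>x. f' (a * x + b) * a)"
    using * Suc.IH by (intro times_diff_mult times_diff_const) auto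
  ultimately show ?case by (auto intro!: exI[of _ "\<lambda>x. f' (a * x + b) * a"])
qed simp

lemma smooth_mult: "smooth f \<Longrightarrow> smooth g \<Longrightarrow> smooth (\<lambda>x. f x * g x)"
  and smooth_add: "smooth f \<Longrightarrow> smooth g \<Longrightarrow> smooth (\<lambda>x. f x + g x)"
  and smooth_const: "smooth (\<lambda>x. c)"
  and smooth_affine: "smooth f \<Longrightarrow> smooth (\<lambda>x. f (a * x + b))"
  by (auto simp: smooth_def times_diff_mult times_diff_add times_diff_const times_diff_affine)

lemma smooth_cmult: "smooth f \<Longrightarrow> smooth (\<lambda>x. c * f x)"
  by (intro smooth_mult smooth_const)

lemma smoothI_deriv:
  assumes "\<And>x. (f has_real_derivative f' x) (at x)" "smooth f'"
  shows "smooth f"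
  unfolding smooth_def
proof
  fix n show "times_diff n f" using assms by (cases n) (auto simp: smooth_def)
qed

lemma smooth_DERIV: "smooth f \<Longrightarrow> (f has_real_derivative deriv f x) (at x)"
proof -
  assume "smooth f"
  then have "times_diff (Suc 0) f" by (simp only: smooth_def)
  then obtain f' where "\<forall>x. (f has_real_derivative f' x) (at x)" by auto
  then show ?thesis using DERIV_imp_deriv by metis
qed

lemma smooth_deriv: "smooth f \<Longrightarrow> smooth (deriv f)"
  unfolding smooth_def
proof
  fix n assume "\<forall>n. times_diff n f"
  then have "times_diff (Suc n) f" by blast
  then obtain f' where *: "\<forall>x. (f has_real_derivative f' x) (at x)" "times_diff n f'" by auto
  then have "deriv f = f'" by (auto intro: DERIV_imp_deriv)
  with * show "times_diff n (deriv f)" by simp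
qed

lemma smooth_continuous: "smooth f \<Longrightarrow> continuous_on S f"
  by (meson DERIV_continuous_on has_field_derivative_at_within smooth_DERIV)

text \<open>The classical function exp(-1/x), continued by 0. The polynomial factor in 1/x makes the
  family closed under differentiation, so that smoothness follows by a single induction.\<close>

definition flat_exp :: "real poly \<Rightarrow> real \<Rightarrow> real" where
  "flat_exp p x = (if x > 0 then poly p (1 / x) * exp (- 1 / x) else 0)"

lemma tendsto_poly_exp_minus: "((\<lambda>y::real. poly p y * exp (- y)) \<longlongrightarrow> 0) at_top"
proof -
  have "((\<lambda>y::real. \<Sum>i\<le>degree p. coeff p i * (y ^ i / exp y)) \<longlongrightarrow> (\<Sum>i\<le>degree p. coeff p i * 0)) at_top"
    by (intro tendsto_intros tendsto_power_div_exp_0)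
  then show ?thesis
    by (simp add: poly_altdef sum_distrib_right exp_minus field_simps sum_divide_distrib)
qed

lemma flat_exp_tendsto_0: "((\<lambda>x. flat_exp p x) \<longlongrightarrow> 0) (at 0)"
proof -
  have "((\<lambda>x::real. poly p (inverse x) * exp (- inverse x)) \<longlongrightarrow> 0) (at_right 0)"
    by (rule filterlim_compose[OF tendsto_poly_exp_minus filterlim_inverse_at_top_right])
  then have "((\<lambda>x. flat_exp p x) \<longlongrightarrow> 0) (at_right 0)"
    by (rule Lim_transform_eventually)
      (auto simp: flat_exp_def eventually_at_right_field field_simps intro!: exI[of _ 1])
  moreover have "((\<lambda>x. flat_exp p x) \<longlongrightarrow> 0) (at_left 0)"
    by (rule Lim_transform_eventually[OF tendsto_const])
      (auto simp: flat_exp_def eventually_at_left_field intro!: exI[of _ "-1"])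
  ultimately show ?thesis by (simp add: filterlim_at_split)
qed

text \<open>For positive x the derivative of p(1/x) exp(-1/x) is (p - p')(1/x) / x^2 times
  exp(-1/x), which explains the factor \<open>monom 1 2 * (p - pderiv p)\<close>. At 0 the limit
  vanishes because the exponential beats every polynomial.\<close>

lemma flat_exp_DERIV:
  "(flat_exp p has_real_derivative flat_exp (monom 1 2 * (p - pderiv p)) x) (at x)"
proof -
  consider "x > 0" | "x = 0" | "x < 0" by linarith
  then show ?thesis
  proof cases
    case 1
    have "((\<lambda>x. poly p (1 / x) * exp (- 1 / x)) has_real_derivative
        flat_exp (monom 1 2 * (p - pderiv p)) x) (at x)"
      using 1 by (auto intro!: derivative_eq_intros DERIV_chain2[OF poly_DERIV]
          simp: flat_exp_def poly_monom field_simps power2_eq_square)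
    then show ?thesis
      by (rule has_field_derivative_transform_within_open[where S = "{0<..}"])
        (use 1 in \<open>auto simp: flat_exp_def\<close>)
  next
    case 2
    \<comment> \<open>Dividing by \<open>h\<close> multiplies the polynomial in 1/h by its variable,
      so the difference quotient at 0 is again a member of the family.\<close>
    have "((\<lambda>h. flat_exp (monom 1 1 * p) h) \<longlongrightarrow> 0) (at 0)" by (rule flat_exp_tendsto_0)
    then have "((\<lambda>h. (flat_exp p (0 + h) - flat_exp p 0) / h) \<longlongrightarrow> 0) (at 0)"
      by (rule Lim_transform_eventually) (auto simp: flat_exp_def poly_monom eventually_at_filter)
    then show ?thesis using 2 by (simp add: DERIV_def flat_exp_def)
  next
    case 3
    have "((\<lambda>x. 0) has_real_derivative flat_exp (monom 1 2 * (p - pderiv p)) x) (at x)"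
      using 3 by (auto simp: flat_exp_def)
    then show ?thesis
      by (rule has_field_derivative_transform_within_open[where S = "{..<0}"])
        (use 3 in \<open>auto simp: flat_exp_def\<close>)
  qed
qed

lemma smooth_flat_exp: "smooth (flat_exp p)"
proof -
  have "times_diff n (flat_exp p)" for n
    by (induction n arbitrary: p) (auto intro: flat_exp_DERIV)
  then show ?thesis by (simp add: smooth_def)
qed

text \<open>Positive exactly on the open interval from \<open>a\<close> to \<open>b\<close>. As the
  factor \<open>Suc n\<close> grows, both exponentials tend to 1 there, so the bumps converge to the
  indicator of the interval while staying between 0 and 1.\<close>

definition bump :: "real \<Rightarrow> real \<Rightarrow> nat \<Rightarrow> real \<Rightarrow> real" where
  "bump a b n x = flat_exp 1 (real (Suc n) * x + - real (Suc n) * a) * flat_exp 1 (- real (Suc n) * x + real (Suc n) * b)"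

lemma smooth_bump: "smooth (bump a b n)"
  unfolding bump_def[abs_def] by (intro smooth_mult smooth_affine smooth_flat_exp)

lemma flat_exp_one: "0 \<le> flat_exp 1 x" "flat_exp 1 x \<le> 1" "x \<le> 0 \<Longrightarrow> flat_exp 1 x = 0" "x > 0 \<Longrightarrow> flat_exp 1 x = exp (- 1 / x)"
  by (auto simp: flat_exp_def)

lemma bump_bounds: "0 \<le> bump a b n x" "bump a b n x \<le> 1"
  by (auto simp: bump_def flat_exp_one intro!: mult_nonneg_nonneg mult_le_one)

lemma bump_eq_0: "x \<notin> {a<..<b} \<Longrightarrow> bump a b n x = 0"
proof -
  assume "x \<notin> {a<..<b}"
  then consider "x \<le> a" | "b \<le> x" by force
  then show ?thesis
  proof cases
    case 1
    then have "real (Suc n) * x \<le> real (Suc n) * a" by (intro mult_left_mono) auto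
    then have "flat_exp 1 (real (Suc n) * x + - real (Suc n) * a) = 0"
      by (intro flat_exp_one) linarith
    then show ?thesis by (simp only: bump_def mult_zero_left)
  next
    case 2
    then have "real (Suc n) * b \<le> real (Suc n) * x" by (intro mult_left_mono) auto
    then have "flat_exp 1 (- real (Suc n) * x + real (Suc n) * b) = 0"
      by (intro flat_exp_one) linarith
    then show ?thesis by (simp only: bump_def mult_zero_right)
  qed
qed

lemma bump_eq_exp:
  assumes "x \<in> {a<..<b}"
  shows "bump a b n x = exp (- (1 / (x - a)) * inverse (real (Suc n))) * exp (- (1 / (b - x)) * inverse (real (Suc n)))"
proof -
  define m where "m = real (Suc n)"
  have m: "m > 0" by (simp add: m_def)
  have eq: "m * x + - m * a = m * (x - a)" "- m * x + m * b = m * (b - x)"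
    by (simp_all add: algebra_simps)
  have pos: "m * (x - a) > 0" "m * (b - x) > 0" using assms m by auto
  have "bump a b n x = flat_exp 1 (m * (x - a)) * flat_exp 1 (m * (b - x))"
    unfolding bump_def m_def[symmetric] eq ..
  also have "\<dots> = exp (- 1 / (m * (x - a))) * exp (- 1 / (m * (b - x)))"
    using pos by (simp add: flat_exp_one(4))
  also have "- 1 / (m * (x - a)) = - (1 / (x - a)) * inverse m"
    by (simp add: divide_inverse)
  also have "- 1 / (m * (b - x)) = - (1 / (b - x)) * inverse m"
    by (simp add: divide_inverse)
  finally show ?thesis by (simp only: m_def)
qed

lemma bump_tendsto: "(\<lambda>n. bump a b n x) \<longlonglongrightarrow> indicator {a<..<b} x"
proof (cases "x \<in> {a<..<b}")
  case True
  have "(\<lambda>n. exp (- (1 / (x - a)) * inverse (real (Suc n))) * exp (- (1 / (b - x)) * inverse (real (Suc n))))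
      \<longlonglongrightarrow> exp (- (1 / (x - a)) * 0) * exp (- (1 / (b - x)) * 0)"
    by (intro tendsto_intros LIMSEQ_inverse_real_of_nat)
  then show ?thesis using True by (simp add: bump_eq_exp)
qed (simp add: bump_eq_0)

text \<open>The one-dimensional factors of test functions. The support stays away from -1 and 1, so
  a product of such factors has compact support in the open cube; the class is also closed under
  \<open>deriv\<close>.\<close>

definition bump_like :: "(real \<Rightarrow> real) \<Rightarrow> bool" where
  "bump_like u \<longleftrightarrow> smooth u \<and> (\<exists>a b. - 1 < a \<and> b < 1 \<and> (\<forall>x. u x \<noteq> 0 \<longrightarrow> a \<le> x \<and> x \<le> b))"

lemma bump_like_bump: "- 1 < a \<Longrightarrow> b < 1 \<Longrightarrow> bump_like (bump a b n)"
proof -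
  assume ab: "- 1 < a" "b < 1"
  have "a \<le> x \<and> x \<le> b" if "bump a b n x \<noteq> 0" for x
    using that bump_eq_0[of x a b n] by (cases "x \<in> {a<..<b}") auto
  then show ?thesis unfolding bump_like_def using ab smooth_bump by blast
qed

section \<open>Product test functions\<close>

definition prod_fun :: "('n::finite \<Rightarrow> real \<Rightarrow> real) \<Rightarrow> real ^ 'n \<Rightarrow> real" where
  "prod_fun u x = (\<Prod>i\<in>UNIV. u i (x $ i))"

lemma prod_fun_has_derivative:
  fixes u :: "'n::finite \<Rightarrow> real \<Rightarrow> real"
  assumes "\<And>i. smooth (u i)"
  shows "(prod_fun u has_derivative
    (\<lambda>y. \<Sum>i\<in>UNIV. (deriv (u i) (x $ i) * (y $ i)) * (\<Prod>j\<in>UNIV - {i}. u j (x $ j)))) (at x)"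
proof -
  have *: "((\<lambda>x. u i (x $ i)) has_derivative (\<lambda>y. deriv (u i) (x $ i) * (y $ i))) (at x)" for i
  proof -
    have "(u i has_derivative (\<lambda>h. deriv (u i) (x $ i) * h)) (at (x $ i))"
      using smooth_DERIV[OF assms] by (simp add: has_field_derivative_def)
    moreover have "((\<lambda>x. x $ i) has_derivative (\<lambda>y. y $ i)) (at x)"
      by (rule bounded_linear_imp_has_derivative[OF bounded_linear_vec_nth])
    ultimately show ?thesis
      using has_derivative_compose[of "\<lambda>x. x $ i" "\<lambda>y. y $ i" x UNIV "u i"] by simp
  qed
  have "((\<lambda>x. \<Prod>i\<in>UNIV. u i (x $ i)) has_derivative
    (\<lambda>y. \<Sum>i\<in>UNIV. (deriv (u i) (x $ i) * (y $ i)) * (\<Prod>j\<in>UNIV - {i}. u j (x $ j)))) (at x)"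
    by (rule has_derivative_prod) (rule *)
  then show ?thesis by (simp only: prod_fun_def[abs_def])
qed

lemma partial_deriv_prod_fun:
  assumes "\<And>i. smooth (u i)"
  shows "partial_deriv k (prod_fun u) = prod_fun (u(k := deriv (u k)))"
proof
  fix x
  have "partial_deriv k (prod_fun u) x
      = (\<Sum>i\<in>UNIV. (deriv (u i) (x $ i) * (axis k 1 $ i)) * (\<Prod>j\<in>UNIV - {i}. u j (x $ j)))"
    unfolding partial_deriv_def frechet_derivative_at[OF prod_fun_has_derivative[OF assms], symmetric] ..
  also have "\<dots> = (\<Sum>i\<in>{k}. (deriv (u i) (x $ i) * (axis k 1 $ i)) * (\<Prod>j\<in>UNIV - {i}. u j (x $ j)))"
    by (rule sum.mono_neutral_right) (auto simp: axis_def)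
  also have "\<dots> = prod_fun (u(k := deriv (u k))) x"
    by (simp add: prod_fun_def prod.remove[of UNIV k])
  finally show "partial_deriv k (prod_fun u) x = prod_fun (u(k := deriv (u k))) x" .
qed

text \<open>A partial derivative of a product of one-variable functions is again such a product,
  with one factor differentiated. Differentiability of all iterated partial derivatives follows from
  this by induction.\<close>

lemma iter_partial_prod_fun:
  assumes "\<And>i. smooth (u i)"
  shows "\<exists>v. (\<forall>i. smooth (v i)) \<and> iter_partial \<alpha> (prod_fun u) = prod_fun v"
proof (induction \<alpha>)
  case Nil
  show ?case by (rule exI[of _ u]) (simp add: assms iter_partial_def)
next
  case (Cons k \<alpha>)
  then obtain v where "(\<forall>i. smooth (v i)) \<and> iter_partial \<alpha> (prod_fun u) = prod_fun v"
    by (rule exE)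
  then have v: "\<forall>i. smooth (v i)" and eq: "iter_partial \<alpha> (prod_fun u) = prod_fun v" by simp_all
  have "iter_partial (k # \<alpha>) (prod_fun u) = partial_deriv k (iter_partial \<alpha> (prod_fun u))"
    by (simp add: iter_partial_def)
  also have "\<dots> = prod_fun (v(k := deriv (v k)))"
    unfolding eq by (rule partial_deriv_prod_fun) (simp add: v)
  finally have "iter_partial (k # \<alpha>) (prod_fun u) = prod_fun (v(k := deriv (v k)))" .
  moreover have "\<forall>i. smooth ((v(k := deriv (v k))) i)" using v by (simp add: smooth_deriv)
  ultimately show ?case by (intro exI[of _ "v(k := deriv (v k))"] conjI)
qed

lemma test_function_prod_fun:
  assumes u: "\<And>i. bump_like (u i)"
  shows "test_function (prod_fun u)"
  unfolding test_function_def
proof (intro conjI allI)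
  fix \<alpha> x
  have sm: "smooth (u i)" for i using u by (simp add: bump_like_def)
  from iter_partial_prod_fun[where u = u and \<alpha> = \<alpha>, OF sm] obtain v
    where "(\<forall>i. smooth (v i)) \<and> iter_partial \<alpha> (prod_fun u) = prod_fun v" by (rule exE)
  then show "iter_partial \<alpha> (prod_fun u) differentiable at x"
    using differentiableI[OF prod_fun_has_derivative[where u = v and x = x]] by simp
next
  have "\<forall>i. \<exists>a b. - 1 < a \<and> b < 1 \<and> (\<forall>x. u i x \<noteq> 0 \<longrightarrow> a \<le> x \<and> x \<le> b)"
    using u by (simp add: bump_like_def)
  from choice[OF this] obtain a where
    "\<forall>i. \<exists>b. - 1 < a i \<and> b < 1 \<and> (\<forall>x. u i x \<noteq> 0 \<longrightarrow> a i \<le> x \<and> x \<le> b)" by (rule exE)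
  from choice[OF this] obtain b where
    ab: "\<forall>i. - 1 < a i \<and> b i < 1 \<and> (\<forall>x. u i x \<noteq> 0 \<longrightarrow> a i \<le> x \<and> x \<le> b i)" by (rule exE)
  have "{x. prod_fun u x \<noteq> 0} \<subseteq> cbox (vec_lambda a) (vec_lambda b)"
  proof
    fix x assume "x \<in> {x. prod_fun u x \<noteq> 0}"
    then have nz: "u i (x $ i) \<noteq> 0" for i by (simp add: prod_fun_def)
    have "a i \<le> x $ i \<and> x $ i \<le> b i" for i using spec[OF ab, of i] nz[of i] by blast
    then show "x \<in> cbox (vec_lambda a) (vec_lambda b)" by (simp add: mem_box_cart)
  qed
  then have "closure {x. prod_fun u x \<noteq> 0} \<subseteq> cbox (vec_lambda a) (vec_lambda b)"
    by (intro closure_minimal) auto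
  also have "\<dots> \<subseteq> box (- 1) 1"
  proof
    fix x assume x: "x \<in> cbox (vec_lambda a) (vec_lambda b)"
    have "- 1 < x $ i \<and> x $ i < 1" for i
    proof -
      have "a i \<le> x $ i" "x $ i \<le> b i" using x by (auto simp: mem_box_cart)
      then show ?thesis using spec[OF ab, of i] by linarith
    qed
    then show "x \<in> box (- 1) 1" by (simp add: mem_box_cart)
  qed
  finally show "closure {x. prod_fun u x \<noteq> 0} \<subseteq> box (- 1) 1" .
qed

lemma continuous_prod_fun: "(\<And>i. smooth (u i)) \<Longrightarrow> continuous_on S (prod_fun u)"
  using has_derivative_continuous_on[OF has_derivative_at_withinI[OF prod_fun_has_derivative]] .

lemma measurable_prod_fun [measurable]:
  "(\<And>i. smooth (u i)) \<Longrightarrow> prod_fun u \<in> borel_measurable borel"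
  by (intro borel_measurable_continuous_onI continuous_prod_fun)

section \<open>The fundamental lemma of the calculus of variations\<close>

lemma measurable_on_cube:
  fixes f :: "real ^ 'n \<Rightarrow> real"
  shows "f \<in> borel_measurable lborel_cube \<longleftrightarrow> (\<lambda>x. indicator cube x * f x) \<in> borel_measurable borel"
  by (subst borel_measurable_restrict_space_iff) simp_all

text \<open>After truncation to the box, the positive and the negative part of \<open>f\<close> are
  densities of two finite measures. They agree on all boxes, an intersection-stable generator, hence
  everywhere, and so their densities agree almost everywhere.\<close>

lemma AE_zero_on_box:
  fixes f :: "real ^ 'n \<Rightarrow> real"
  assumes int: "set_integrable lborel (box a b) f"
    and zero: "\<And>c d. box c d \<subseteq> box a b \<Longrightarrow> (\<integral>x. indicator (box c d) x * f x \<partial>lborel) = 0"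
  shows "AE x in lborel. x \<in> box a b \<longrightarrow> f x = 0"
proof -
  define g where "g x = indicator (box a b) x * f x" for x
  have g: "integrable lborel g" using int by (simp add: set_integrable_def g_def[abs_def])
  from borel_measurable_integrable[OF this] have [measurable]: "g \<in> borel_measurable borel" by simp
  have "density lborel (\<lambda>x. ennreal (g x)) = density lborel (\<lambda>x. ennreal (- g x))"
  proof (rule measure_eqI_generator_eq[where E = "range (\<lambda>(c, d). box c d)" and \<Omega> = UNIV
        and A = "\<lambda>n. box (- (real n *\<^sub>R One)) (real n *\<^sub>R One)"])
    show "Int_stable (range (\<lambda>(c, d). box c d :: (real ^ 'n) set))"
      by (auto simp: Int_stable_def box_Int_box)
    show "sets (density lborel (\<lambda>x. ennreal (g x))) = sigma_sets UNIV (range (\<lambda>(c, d). box c d))"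
      "sets (density lborel (\<lambda>x. ennreal (- g x))) = sigma_sets UNIV (range (\<lambda>(c, d). box c d))"
      by (simp_all add: borel_eq_box)
    show "(\<Union>n. box (- (real n *\<^sub>R One)) (real n *\<^sub>R One)) = (UNIV :: (real ^ 'n) set)"
      by (rule UN_box_eq_UNIV)
  next
    fix X :: "(real ^ 'n) set" assume "X \<in> range (\<lambda>(c, d). box c d)"
    then obtain c d where X: "X = box c d" by auto
    have "\<exists>c' d'. box a b \<inter> X = box c' d'"
      unfolding X box_Int_box by (intro exI) (rule refl)
    then obtain c' d' where X': "box a b \<inter> X = box c' d'" by blast
    have int': "integrable lborel (\<lambda>x. indicator X x * g x)"
      using integrable_mult_indicator[of X lborel g] g X by simp
    have "(\<integral>x. indicator X x * g x \<partial>lborel) = (\<integral>x. indicator (box c' d') x * f x \<partial>lborel)"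
      unfolding X'[symmetric] g_def by (intro Bochner_Integration.integral_cong) (auto simp: indicator_def)
    also have "\<dots> = 0" using X' by (intro zero) auto
    finally have "0 = (\<integral>x. indicator X x * g x \<partial>lborel)" by simp
    also have "\<dots> = (\<integral>x. max 0 (indicator X x * g x) - max 0 (- (indicator X x * g x)) \<partial>lborel)"
      by (intro Bochner_Integration.integral_cong) (auto simp: max_def)
    also have "\<dots> = (\<integral>x. max 0 (indicator X x * g x) \<partial>lborel) - (\<integral>x. max 0 (- (indicator X x * g x)) \<partial>lborel)"
      by (intro Bochner_Integration.integral_diff integrable_max integrable_zero
          Bochner_Integration.integrable_minus int')
    finally have "ennreal (\<integral>x. max 0 (indicator X x * g x) \<partial>lborel) = ennreal (\<integral>x. max 0 (- (indicator X x * g x)) \<partial>lborel)"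
      by simp
    moreover have "(\<integral>\<^sup>+x. ennreal (max 0 (indicator X x * g x)) \<partial>lborel) = ennreal (\<integral>x. max 0 (indicator X x * g x) \<partial>lborel)"
      by (intro nn_integral_eq_integral integrable_max integrable_zero int') simp
    moreover have "(\<integral>\<^sup>+x. ennreal (max 0 (- (indicator X x * g x))) \<partial>lborel) = ennreal (\<integral>x. max 0 (- (indicator X x * g x)) \<partial>lborel)"
      by (intro nn_integral_eq_integral integrable_max integrable_zero Bochner_Integration.integrable_minus int') simp
    moreover have "ennreal (max 0 (indicator X x * g x)) = ennreal (g x) * indicator X x"
      "ennreal (max 0 (- (indicator X x * g x))) = ennreal (- g x) * indicator X x" for x
      by (auto simp: indicator_def max_def ennreal_neg)
    ultimately show "emeasure (density lborel (\<lambda>x. ennreal (g x))) X = emeasure (density lborel (\<lambda>x. ennreal (- g x))) X"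
      using X by (simp add: emeasure_density)
  next
    fix n
    have "emeasure (density lborel (\<lambda>x. ennreal (g x))) (box (- (real n *\<^sub>R One)) (real n *\<^sub>R One))
        \<le> (\<integral>\<^sup>+x. ennreal (norm (g x)) \<partial>lborel)"
      by (subst emeasure_density) (auto intro!: nn_integral_mono simp: indicator_def ennreal_leI)
    also have "\<dots> < \<infinity>" using g by (simp add: integrable_iff_bounded)
    finally show "emeasure (density lborel (\<lambda>x. ennreal (g x))) (box (- (real n *\<^sub>R One)) (real n *\<^sub>R One)) \<noteq> \<infinity>"
      by auto
  qed auto
  then have "AE x in lborel. ennreal (g x) = ennreal (- g x)"
    by (intro sigma_finite_measure.density_unique sigma_finite_lborel) auto
  then show ?thesis
  proof (rule eventually_mono, intro impI)
    fix x assume *: "ennreal (g x) = ennreal (- g x)" and x: "x \<in> box a b"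
    have "g x = 0"
      using * by (cases "g x \<ge> 0") (auto simp: ennreal_neg ennreal_eq_0_iff)
    then show "f x = 0" using x by (simp add: g_def)
  qed
qed

text \<open>Products of bumps converge boundedly to the indicator of a box, so \<open>f\<close> has
  integral 0 over every box whose closure lies in the open cube. Product test functions are thus
  enough to determine a locally integrable function.\<close>

lemma fundamental_lemma:
  fixes f :: "real ^ 'n \<Rightarrow> real"
  assumes f: "locally_integrable f"
    and zero: "\<And>u. (\<And>i. bump_like (u i)) \<Longrightarrow> (\<integral>x. f x * prod_fun u x \<partial>lborel_cube) = 0"
  shows "AE x in unif_cube. f x = 0"
proof -
  have zero': "(\<integral>x. indicator (box c d) x * f x \<partial>lborel) = 0" if cd: "cbox c d \<subseteq> box (- 1) 1" for c d :: "real ^ 'n"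
  proof (cases "box c d = {}")
    case False
    then have le: "c $ i < d $ i" for i by (auto simp: interval_ne_empty_cart)
    then have cd': "- 1 < c $ i" "d $ i < 1" for i
    proof -
      have "c \<in> cbox c d" "d \<in> cbox c d" using le by (auto simp: mem_box_cart less_imp_le)
      then have "c \<in> box (- 1) 1" "d \<in> box (- 1) 1" using cd by auto
      then show "- 1 < c $ i" "d $ i < 1" by (auto simp: mem_box_cart)
    qed
    define \<phi> where "\<phi> n = prod_fun (\<lambda>i. bump (c $ i) (d $ i) n)" for n
    have [measurable]: "\<phi> n \<in> borel_measurable borel" for n
      unfolding \<phi>_def by (intro measurable_prod_fun smooth_bump)
    have K: "set_integrable lborel (cbox c d) f"
      using f cd by (auto simp: locally_integrable_def)
    have sub: "cbox c d \<subseteq> cube" using cd by (meson box_subset_cbox order_trans)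
    have \<phi>0: "\<phi> n x = 0" if x: "x \<notin> box c d" for n x
    proof -
      obtain i where "x $ i \<notin> {c $ i<..<d $ i}" using x by (auto simp: mem_box_cart)
      then show ?thesis unfolding \<phi>_def prod_fun_def
        by (intro prod_zero bexI[of _ i]) (simp_all add: bump_eq_0 del: greaterThanLessThan_iff)
    qed
    have \<phi>1: "0 \<le> \<phi> n x" "\<phi> n x \<le> 1" for n x
      by (auto simp: \<phi>_def prod_fun_def bump_bounds intro!: prod_nonneg prod_le_1)
    have z: "(\<integral>x. indicator (cbox c d) x * f x * \<phi> n x \<partial>lborel) = 0" for n
    proof -
      have "(\<integral>x. f x * \<phi> n x \<partial>lborel_cube) = 0"
        unfolding \<phi>_def using cd' by (intro zero bump_like_bump)
      also have "(\<integral>x. f x * \<phi> n x \<partial>lborel_cube) = (\<integral>x. indicator cube x *\<^sub>R (f x * \<phi> n x) \<partial>lborel)"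
        by (subst integral_restrict_space) auto
      also have "\<dots> = (\<integral>x. indicator (cbox c d) x * f x * \<phi> n x \<partial>lborel)"
        using sub \<phi>0 box_subset_cbox[of c d]
        by (intro Bochner_Integration.integral_cong) (auto simp: indicator_def)
      finally show ?thesis by simp
    qed
    have fm [measurable]: "(\<lambda>x. indicator (cbox c d) x * f x) \<in> borel_measurable borel"
      using K by (auto simp: set_integrable_def)
    have "(\<lambda>n. \<integral>x. indicator (cbox c d) x * f x * \<phi> n x \<partial>lborel)
        \<longlonglongrightarrow> (\<integral>x. indicator (cbox c d) x * f x * indicator (box c d) x \<partial>lborel)"
    proof (rule integral_dominated_convergence[where w = "\<lambda>x. norm (indicator (cbox c d) x * f x)"])
      show "integrable lborel (\<lambda>x. norm (indicator (cbox c d) x * f x))"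
        using K by (intro integrable_norm) (simp add: set_integrable_def)
      show "AE x in lborel. (\<lambda>n. indicator (cbox c d) x * f x * \<phi> n x)
          \<longlonglongrightarrow> indicator (cbox c d) x * f x * indicator (box c d) x"
      proof (rule AE_I2)
        fix x :: "real ^ 'n"
        have "(\<lambda>n. \<phi> n x) \<longlonglongrightarrow> (\<Prod>i\<in>UNIV. indicator {c $ i<..<d $ i} (x $ i))"
          unfolding \<phi>_def prod_fun_def by (intro tendsto_prod bump_tendsto)
        also have "(\<Prod>i\<in>UNIV. indicator {c $ i<..<d $ i} (x $ i)) = (indicator (box c d) x :: real)"
          by (auto simp: indicator_def mem_box_cart)
        finally show "(\<lambda>n. indicator (cbox c d) x * f x * \<phi> n x)
            \<longlonglongrightarrow> indicator (cbox c d) x * f x * indicator (box c d) x"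
          by (rule tendsto_mult[OF tendsto_const])
      qed
      show "AE x in lborel. norm (indicator (cbox c d) x * f x * \<phi> n x) \<le> norm (indicator (cbox c d) x * f x)" for n
        using \<phi>1 by (intro AE_I2) (auto simp: abs_mult intro!: mult_left_le)
    qed simp_all
    then have "(\<integral>x. indicator (cbox c d) x * f x * indicator (box c d) x \<partial>lborel) = 0"
      unfolding z by (simp add: LIMSEQ_const_iff)
    also have "(\<lambda>x. indicator (cbox c d) x * f x * indicator (box c d) x) = (\<lambda>x. indicator (box c d) x * f x)"
      using box_subset_cbox[of c d] by (auto simp: indicator_def fun_eq_iff)
    finally show ?thesis .
  qed simp
  \<comment> \<open>Integrability of \<open>f\<close> is available on compact subsets of the open
    cube only, so the open cube is exhausted by slightly smaller boxes; its boundary is a null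
    set.\<close>
  define W where "W n = (box (\<chi> i. - 1 + 1 / real (Suc n)) (\<chi> i. 1 - 1 / real (Suc n)) :: (real ^ 'n) set)" for n
  have "AE x in lborel. x \<in> W n \<longrightarrow> f x = 0" for n
    unfolding W_def
  proof (rule AE_zero_on_box)
    let ?a = "(\<chi> i. - 1 + 1 / real (Suc n)) :: real ^ 'n" and ?b = "(\<chi> i. 1 - 1 / real (Suc n)) :: real ^ 'n"
    have pos: "1 / real (Suc n) > 0" by simp
    have sub: "cbox ?a ?b \<subseteq> box (- 1) 1"
    proof
      fix x assume x: "x \<in> cbox ?a ?b"
      have "- 1 < x $ i \<and> x $ i < 1" for i
      proof -
        have "- 1 + 1 / real (Suc n) \<le> x $ i" "x $ i \<le> 1 - 1 / real (Suc n)"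
          using x by (auto simp only: mem_box_cart vec_lambda_beta)
        with pos show ?thesis by linarith
      qed
      then show "x \<in> box (- 1) 1" by (simp add: mem_box_cart)
    qed
    then have "set_integrable lborel (cbox ?a ?b) f"
      using f by (auto simp: locally_integrable_def)
    then show "set_integrable lborel (box ?a ?b) f"
      by (rule set_integrable_subset) (auto simp: box_subset_cbox)
    fix c d :: "real ^ 'n" assume cd: "box c d \<subseteq> box ?a ?b"
    show "(\<integral>x. indicator (box c d) x * f x \<partial>lborel) = 0"
    proof (cases "box c d = {}")
      case False
      then have "cbox c d = closure (box c d)" by simp
      also have "\<dots> \<subseteq> cbox ?a ?b" using cd box_subset_cbox[of ?a ?b] by (intro closure_minimal) auto
      finally show ?thesis using sub by (intro zero') auto
    qed simp
  qed
  then have *: "AE x in lborel. \<forall>n. x \<in> W n \<longrightarrow> f x = 0" by (subst AE_all_countable) blast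
  have W: "(\<Union>n. W n) = box (- 1) 1"
  proof safe
    fix x :: "real ^ 'n" assume x: "x \<in> box (- 1) 1"
    have lim: "(\<lambda>n. - 1 + inverse (real (Suc n))) \<longlonglongrightarrow> - 1 + 0" "(\<lambda>n. 1 - inverse (real (Suc n))) \<longlonglongrightarrow> 1 - 0"
      by (intro tendsto_intros LIMSEQ_inverse_real_of_nat)+
    have "\<forall>\<^sub>F n in sequentially. - 1 + inverse (real (Suc n)) < x $ i" for i
      using x by (intro order_tendstoD[OF lim(1)]) (auto simp: mem_box_cart)
    moreover have "\<forall>\<^sub>F n in sequentially. x $ i < 1 - inverse (real (Suc n))" for i
      using x by (intro order_tendstoD[OF lim(2)]) (auto simp: mem_box_cart)
    ultimately have "\<forall>\<^sub>F n in sequentially. \<forall>i. - 1 + inverse (real (Suc n)) < x $ i \<and> x $ i < 1 - inverse (real (Suc n))"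
      by (intro eventually_all_finite eventually_conj)
    then obtain n where "\<forall>i. - 1 + inverse (real (Suc n)) < x $ i \<and> x $ i < 1 - inverse (real (Suc n))"
      by (rule eventually_happens'[OF sequentially_bot, THEN exE])
    then have "x \<in> W n"
      by (simp only: W_def mem_box_cart vec_lambda_beta inverse_eq_divide) blast
    then show "x \<in> (\<Union>n. W n)" by blast
  next
    fix x n assume x: "x \<in> W n"
    have pos: "1 / real (Suc n) > 0" by simp
    have "- 1 < x $ i \<and> x $ i < 1" for i
    proof -
      have "- 1 + 1 / real (Suc n) < x $ i" "x $ i < 1 - 1 / real (Suc n)"
        using x by (auto simp only: W_def mem_box_cart vec_lambda_beta)
      with pos show ?thesis by linarith
    qed
    then show "x \<in> box (- 1) 1" by (simp add: mem_box_cart)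
  qed
  have "AE x in lborel. x \<in> cube \<longrightarrow> x \<in> (box (- 1) 1 :: (real ^ 'n) set)"
  proof -
    have "negligible (cube - box (- 1) (1 :: real ^ 'n))" by (rule negligible_frontier_interval)
    then have "AE x in lebesgue. x \<notin> cube - box (- 1) (1 :: real ^ 'n)"
      by (intro AE_not_in) (simp add: negligible_iff_null_sets)
    then show ?thesis by (simp add: AE_completion_iff)
  qed
  with * have "AE x in lborel. x \<in> cube \<longrightarrow> f x = 0"
  proof eventually_elim
    case (elim x)
    show "x \<in> cube \<longrightarrow> f x = 0"
    proof
      assume "x \<in> cube"
      then have "x \<in> (\<Union>n. W n)" using elim W by blast
      then show "f x = 0" using elim by blast
    qed
  qed
  then show ?thesis by (simp only: AE_unif_cube_iff)
qed

section \<open>Integrals with respect to the normalised measures\<close>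

lemma unif_interval_density: "unif_interval = density lborel (\<lambda>t. ennreal (indicator {-1..1} t / 2))"
  unfolding unif_interval_def uniform_measure_def
  by (intro density_cong)
    (auto intro!: AE_I2 simp: indicator_def divide_ennreal_def divide_ennreal[of 1 2, symmetric] simp del: divide_ennreal)

lemma unif_cube_density:
  "(unif_cube :: (real ^ 'n) measure) = density lborel (\<lambda>x. ennreal (indicator cube x / 2 ^ CARD('n)))"
proof -
  have "(2 :: ennreal) ^ CARD('n) = ennreal (2 ^ CARD('n))"
    by (metis ennreal_numeral ennreal_power zero_le_numeral)
  then show ?thesis
    unfolding unif_cube_def uniform_measure_def emeasure_lborel_cube
    by (intro density_cong) (auto intro!: AE_I2 simp: indicator_def divide_ennreal[of 1 "2 ^ CARD('n)", symmetric] simp del: divide_ennreal)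
qed

lemma integral_unif_interval:
  fixes h :: "real \<Rightarrow> real"
  assumes [measurable]: "h \<in> borel_measurable borel"
  shows "(\<integral>t. h t \<partial>unif_interval) = (\<integral>t. indicator {-1..1} t * h t \<partial>lborel) / 2"
  unfolding unif_interval_density by (subst integral_density) auto

lemma integral_lborel_cube:
  fixes h :: "real ^ 'n \<Rightarrow> real"
  shows "(\<integral>x. h x \<partial>lborel_cube) = (\<integral>x. indicator cube x * h x \<partial>lborel)"
  by (subst integral_restrict_space) auto

lemma integral_unif_cube:
  fixes h :: "real ^ 'n \<Rightarrow> real"
  assumes [measurable]: "h \<in> borel_measurable borel"
  shows "(\<integral>x. h x \<partial>unif_cube) = (\<integral>x. h x \<partial>lborel_cube) / 2 ^ CARD('n)"
  unfolding unif_cube_density integral_lborel_cube by (subst integral_density) auto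

lemma integral_vec_upd:
  fixes h :: "real ^ 'n \<Rightarrow> real"
  assumes [measurable]: "h \<in> borel_measurable borel" and bound: "\<And>x. \<bar>h x\<bar> \<le> B"
  shows "(\<integral>x. h x \<partial>unif_cube) = (\<integral>x. \<integral>t. h (vec_upd x k t) \<partial>unif_interval \<partial>unif_cube)"
proof -
  interpret P: pair_prob_space "unif_cube :: (real ^ 'n) measure" unif_interval ..
  have "(\<integral>x. h x \<partial>unif_cube)
      = (\<integral>x. h x \<partial>(distr (unif_cube \<Otimes>\<^sub>M unif_interval) borel (\<lambda>(x, t). vec_upd x k t)))"
    by (simp only: distr_vec_upd)
  also have "\<dots> = (\<integral>z. h (case z of (x, t) \<Rightarrow> vec_upd x k t) \<partial>(unif_cube \<Otimes>\<^sub>M unif_interval))"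
    by (subst integral_distr) auto
  also have "\<dots> = (\<integral>z. (case z of (x, t) \<Rightarrow> h (vec_upd x k t)) \<partial>(unif_cube \<Otimes>\<^sub>M unif_interval))"
    by (intro Bochner_Integration.integral_cong) auto
  also have "\<dots> = (\<integral>x. \<integral>t. h (vec_upd x k t) \<partial>unif_interval \<partial>unif_cube)"
  proof -
    have "integrable (unif_cube \<Otimes>\<^sub>M unif_interval) (\<lambda>z. h (vec_upd (fst z) k (snd z)))"
      by (rule P.integrable_const_bound[where B = B]) (auto simp: bound intro!: AE_I2)
    from unif_pair.integral_fst'[OF this] show ?thesis by (simp add: split_beta')
  qed
  finally show ?thesis .
qed

section \<open>From almost everywhere to everywhere\<close>

lemma emeasure_lborel_interval_neq_0:
  fixes a b :: real
  assumes "a < b"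
  shows "emeasure lborel {a<..<b} \<noteq> 0" "emeasure lborel {a..b} \<noteq> 0"
  using assms by simp_all

lemma unif_interval_dense:
  assumes "AE t in unif_interval. P t" "t \<in> {-1..1}" "e > 0"
  shows "\<exists>s\<in>{-1..1}. \<bar>s - t\<bar> < e \<and> P s"
proof (rule ccontr)
  assume none: "\<not> ?thesis"
  have "AE s in unif_interval. s \<notin> {t - e<..<t + e}"
    using assms(1) unfolding AE_unif_interval_iff
  proof (rule eventually_mono, intro impI notI)
    fix s assume s: "s \<in> {-1..1} \<longrightarrow> P s" "s \<in> {-1..1}" "s \<in> {t - e<..<t + e}"
    then have "\<bar>s - t\<bar> < e" by (simp add: abs_less_iff)
    with s none show False by blast
  qed
  then have "emeasure unif_interval {t - e<..<t + e} = 0"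
    by (subst (asm) AE_iff_measurable[where N = "{t - e<..<t + e}"]) auto
  then have "emeasure lborel ({-1..1} \<inter> {t - e<..<t + e}) = 0"
    by (simp add: emeasure_unif_interval ennreal_divide_eq_0_iff)
  moreover have "emeasure lborel {max (- 1) (t - e)<..<min 1 (t + e)} \<le> emeasure lborel ({-1..1} \<inter> {t - e<..<t + e})"
    by (intro emeasure_mono) auto
  moreover have "max (- 1) (t - e) < min 1 (t + e)" using assms by auto
  ultimately show False using emeasure_lborel_interval_neq_0(1) by auto
qed

text \<open>A set of full measure is dense in the interval, so its closure is everything. This lemma
  and its analogue \<open>AE_unif_cube_closed\<close> carry order relations and equations over to
  continuous representatives.\<close>

lemma AE_unif_interval_closed:
  assumes "AE t in unif_interval. P t" and "closed {t\<in>{-1..1}. P t}" and "t \<in> {-1..1}"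
  shows "P t"
proof -
  have "t \<in> closure {t\<in>{-1..1}. P t}"
    unfolding closure_approachable using unif_interval_dense[OF assms(1,3)] unfolding dist_real_def by blast
  then show ?thesis using assms(2) by (simp add: closure_closed)
qed

lemma AE_unif_interval_eq:
  fixes p q :: "real \<Rightarrow> real"
  assumes "AE t in unif_interval. p t = q t" "continuous_on {-1..1} p" "continuous_on {-1..1} q" "t \<in> {-1..1}"
  shows "p t = q t"
proof -
  have "closed {t\<in>{-1..1}. p t = q t}"
    using continuous_closed_preimage_constant[OF continuous_on_diff[OF assms(2,3)], of 0] by simp
  from AE_unif_interval_closed[OF assms(1) this assms(4)] show ?thesis .
qed

lemma emeasure_unif_cube_ball_pos:
  fixes x :: "real ^ 'n"
  assumes x: "x \<in> cube" and e: "e > 0"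
  shows "emeasure unif_cube (ball x e) > 0"
proof -
  \<comment> \<open>With this radius the small rectangle around \<open>x\<close> has l1-radius e/2
    and therefore lies in the ball.\<close>
  define r where "r = e / (2 * real CARD('n))"
  have r: "r > 0" using e by (simp add: r_def)
  have "dist x z < e" if z: "\<forall>i. z $ i \<in> {x $ i - r..x $ i + r}" for z
  proof -
    have "norm (x - z) \<le> (\<Sum>i\<in>UNIV. \<bar>(x - z) $ i\<bar>)" by (rule norm_le_l1_cart)
    also have "\<dots> \<le> (\<Sum>i\<in>(UNIV :: 'n set). r)"
    proof (rule sum_mono)
      fix i :: 'n
      have "z $ i \<in> {x $ i - r..x $ i + r}" using z by blast
      then show "\<bar>(x - z) $ i\<bar> \<le> r" by (simp add: abs_le_iff)
    qed
    also have "\<dots> < e" using e by (simp add: r_def)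
    finally show ?thesis by (simp add: dist_norm)
  qed
  then have "{z. \<forall>i. z $ i \<in> {x $ i - r..x $ i + r}} \<subseteq> ball x e" by auto
  then have "emeasure unif_cube {z. \<forall>i. z $ i \<in> {x $ i - r..x $ i + r}} \<le> emeasure unif_cube (ball x e)"
    by (intro emeasure_mono) auto
  moreover have "0 < (\<Prod>i\<in>UNIV. emeasure unif_interval {x $ i - r..x $ i + r})"
  proof -
    have "emeasure unif_interval {x $ i - r..x $ i + r} \<noteq> 0" for i
    proof -
      have "{-1..1} \<inter> {x $ i - r..x $ i + r} = {max (- 1) (x $ i - r)..min 1 (x $ i + r)}" by auto
      moreover have "max (- 1) (x $ i - r) < min 1 (x $ i + r)"
      proof -
        have "- 1 \<le> x $ i" "x $ i \<le> 1" using x by (auto simp: mem_box_cart)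
        with r show ?thesis by linarith
      qed
      ultimately show ?thesis
        using emeasure_lborel_interval_neq_0(2)[of "max (- 1) (x $ i - r)" "min 1 (x $ i + r)"]
        by (simp only: emeasure_unif_interval ennreal_divide_eq_0_iff sets.Int borel_closed closed_atLeastAtMost) simp
    qed
    then show ?thesis by (simp add: zero_less_iff_neq_zero)
  qed
  ultimately show ?thesis by (subst (asm) emeasure_unif_cube_rectangle) auto
qed

lemma unif_cube_dense:
  fixes x :: "real ^ 'n"
  assumes "AE x in unif_cube. P x" "x \<in> cube" "e > 0"
  shows "\<exists>y\<in>cube. dist y x < e \<and> P y"
proof (rule ccontr)
  assume none: "\<not> ?thesis"
  have "AE y in unif_cube. y \<notin> ball x e"
    using assms(1) AE_in_cube
    by eventually_elim (use none in \<open>auto simp: dist_commute\<close>)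
  then have "emeasure unif_cube (ball x e) = 0"
    by (subst (asm) AE_iff_measurable[where N = "ball x e"]) auto
  then show False using emeasure_unif_cube_ball_pos[OF assms(2,3)] by simp
qed

lemma AE_unif_cube_closed:
  fixes x :: "real ^ 'n"
  assumes "AE x in unif_cube. P x" and "closed {x\<in>cube. P x}" and "x \<in> cube"
  shows "P x"
proof -
  have "x \<in> closure {x\<in>cube. P x}"
    unfolding closure_approachable using unif_cube_dense[OF assms(1,3)] by auto
  then show ?thesis using assms(2) by (simp add: closure_closed)
qed

lemma AE_unif_cube_eq:
  fixes p q :: "real ^ 'n \<Rightarrow> real"
  assumes "AE x in unif_cube. p x = q x" "continuous_on cube p" "continuous_on cube q" "x \<in> cube"
  shows "p x = q x"
proof -
  have "closed {x\<in>cube. p x = q x}"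
    using continuous_closed_preimage_constant[OF continuous_on_diff[OF assms(2,3)] closed_cbox, of 0] by simp
  from AE_unif_cube_closed[OF assms(1) this assms(4)] show ?thesis .
qed

section \<open>Primitives of bumps and a bump of mean 1\<close>

lemma bump_like_smooth: "bump_like u \<Longrightarrow> smooth u"
  by (simp add: bump_like_def)

lemma bump_like_measurable [measurable_dest]: "bump_like u \<Longrightarrow> u \<in> borel_measurable borel"
  by (intro borel_measurable_continuous_onI smooth_continuous bump_like_smooth)

lemma bump_like_bounded:
  assumes "bump_like u"
  shows "\<exists>B. \<forall>x. \<bar>u x\<bar> \<le> B"
proof -
  obtain a b where ab: "\<And>x. u x \<noteq> 0 \<Longrightarrow> a \<le> x \<and> x \<le> b"
    using assms by (auto simp: bump_like_def)
  have "continuous_on {a..b} u" using assms by (intro smooth_continuous bump_like_smooth)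
  then have "bounded (u ` {a..b})" by (intro compact_imp_bounded compact_continuous_image) auto
  then obtain B where B: "\<forall>x\<in>{a..b}. \<bar>u x\<bar> \<le> B"
    unfolding bounded_iff by auto
  have "\<bar>u x\<bar> \<le> max B 0" for x
  proof (cases "u x = 0")
    case False
    then have "x \<in> {a..b}" using ab by simp
    then show ?thesis using bspec[OF B] by (simp add: le_max_iff_disj)
  qed simp
  then show ?thesis by blast
qed

lemma prod_fun_bounded:
  assumes "\<And>i. bump_like (u i)"
  shows "\<exists>B. \<forall>x. \<bar>prod_fun u x\<bar> \<le> B"
proof -
  have "\<forall>i. \<exists>B. \<forall>x. \<bar>u i x\<bar> \<le> B" using bump_like_bounded[OF assms] by blast
  from choice[OF this] obtain B where B: "\<forall>i x. \<bar>u i x\<bar> \<le> B i" by (rule exE)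
  have "\<bar>prod_fun u x\<bar> \<le> (\<Prod>i\<in>UNIV. B i)" for x
    unfolding prod_fun_def abs_prod using B by (intro prod_mono) simp
  then show ?thesis by blast
qed

lemma bump_like_deriv:
  assumes "bump_like u"
  shows "bump_like (deriv u)"
proof -
  obtain a b where ab: "- 1 < a" "b < 1" "\<And>x. u x \<noteq> 0 \<Longrightarrow> a \<le> x \<and> x \<le> b"
    using assms by (auto simp: bump_like_def)
  have "a \<le> x \<and> x \<le> b" if nz: "deriv u x \<noteq> 0" for x
  proof (rule ccontr)
    assume x: "\<not> (a \<le> x \<and> x \<le> b)"
    have "(u has_real_derivative 0) (at x)"
    proof (rule has_field_derivative_transform_within_open[where f = "\<lambda>_. 0" and S = "- {a..b}"])
      show "x \<in> - {a..b}" using x by simp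
      fix y assume "y \<in> - {a..b}"
      then show "0 = u y" using ab(3)[of y] by auto
    qed (auto intro: open_Compl)
    then show False using nz by (simp add: DERIV_imp_deriv)
  qed
  then show ?thesis using ab assms smooth_deriv unfolding bump_like_def by blast
qed

text \<open>The primitive from -1 vanishes to the left of the support of \<open>v\<close>, and to
  the right of it because the mean of \<open>v\<close> is 0; so it is again supported in a compact
  part of the open interval.\<close>

lemma bump_like_primitive:
  assumes v: "bump_like v" and zero: "(\<integral>t. v t \<partial>unif_interval) = 0"
  shows "\<exists>\<psi>. bump_like \<psi> \<and> deriv \<psi> = v"
proof -
  obtain a b where ab: "- 1 < a" "b < 1" "\<And>x. v x \<noteq> 0 \<Longrightarrow> a \<le> x \<and> x \<le> b"
    using v by (auto simp: bump_like_def)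
  note [measurable] = bump_like_measurable[OF v]
  have cont: "continuous_on S v" for S using v by (intro smooth_continuous bump_like_smooth)
  have int: "v integrable_on {s..t}" for s t
    using cont by (rule integrable_continuous_interval)
  have tot: "integral {-1..1} v = 0"
  proof -
    have "set_integrable lborel {-1..1} v"
      by (intro borel_integrable_atLeastAtMost' cont)
    then have "integral {-1..1} v = (\<integral>t. indicator {-1..1} t * v t \<partial>lborel)"
      by (subst set_borel_integral_eq_integral(2)[symmetric]) (simp_all add: set_lebesgue_integral_def)
    then show ?thesis using zero by (simp add: integral_unif_interval)
  qed
  define \<psi> where "\<psi> t = (if t \<le> - 1 then 0 else integral {-1..t} v)" for t
  have low: "\<psi> t = 0" if "t < a" for t
  proof -
    have "integral {-1..t} v = integral {-1..t} (\<lambda>_. 0)"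
      using ab(3) that by (intro Henstock_Kurzweil_Integration.integral_cong) force
    then show ?thesis by (simp add: \<psi>_def)
  qed
  have high: "\<psi> t = 0" if t: "b < t" for t
  proof (cases "t \<le> - 1")
    case False
    \<comment> \<open>\<open>t\<close> and 1 both lie to the right of the support, in either order,
      so nothing is integrated between them.\<close>
    have "integral {min t 1..max t 1} v = integral {min t 1..max t 1} (\<lambda>_. 0)"
      using ab(2,3) t by (intro Henstock_Kurzweil_Integration.integral_cong) force
    then have *: "integral {min t 1..max t 1} v = 0" by simp
    have "integral {-1..t} v = integral {-1..1} v"
    proof (cases "t \<le> 1")
      case True
      then show ?thesis
        using Henstock_Kurzweil_Integration.integral_combine[of "-1" t 1 v] False * int by simp
    next
      case 2: False
      then show ?thesis
        using Henstock_Kurzweil_Integration.integral_combine[of "-1" 1 t v] False * int by simp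
    qed
    then show ?thesis using tot False by (simp add: \<psi>_def)
  qed (simp add: \<psi>_def)
  have D: "(\<psi> has_real_derivative v t) (at t)" for t
  proof (cases "t < a")
    case True
    have "((\<lambda>_. 0) has_real_derivative 0) (at t)" by simp
    then have "(\<psi> has_real_derivative 0) (at t)"
      by (rule has_field_derivative_transform_within_open[where S = "{..<a}"]) (use True low in auto)
    moreover have "v t = 0" using ab(3)[of t] True by force
    ultimately show ?thesis by simp
  next
    case False
    then have t: "- 1 < t" using ab by linarith
    have "((\<lambda>u. integral {-1..u} v) has_real_derivative v t) (at t within {-1..t + 1})"
      using t by (intro integral_has_real_derivative cont) auto
    then have "((\<lambda>u. integral {-1..u} v) has_real_derivative v t) (at t)"
      using t by (subst (asm) at_within_interior) auto
    then show ?thesis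
      by (rule has_field_derivative_transform_within_open[where S = "{-1<..}"]) (use t in \<open>auto simp: \<psi>_def\<close>)
  qed
  have "smooth \<psi>" using D bump_like_smooth[OF v] by (rule smoothI_deriv)
  moreover have "a \<le> x \<and> x \<le> b" if "\<psi> x \<noteq> 0" for x
    using that low[of x] high[of x] by linarith
  ultimately have "bump_like \<psi>" using ab unfolding bump_like_def by blast
  moreover have "deriv \<psi> = v" using D by (auto intro: DERIV_imp_deriv)
  ultimately show ?thesis by blast
qed

lemma bump_like_lincomb:
  assumes "bump_like u" "bump_like v"
  shows "bump_like (\<lambda>t. u t + c * v t)"
proof -
  obtain a b where 1: "- 1 < a" "b < 1" "\<And>x. u x \<noteq> 0 \<Longrightarrow> a \<le> x \<and> x \<le> b"
    using assms by (auto simp: bump_like_def)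
  obtain a' b' where 2: "- 1 < a'" "b' < 1" "\<And>x. v x \<noteq> 0 \<Longrightarrow> a' \<le> x \<and> x \<le> b'"
    using assms by (auto simp: bump_like_def)
  have "min a a' \<le> x \<and> x \<le> max b b'" if "u x + c * v x \<noteq> 0" for x
  proof (cases "u x = 0")
    case True
    then have "v x \<noteq> 0" using that by auto
    then show ?thesis using 2 by (simp add: min_le_iff_disj le_max_iff_disj)
  next
    case False
    then show ?thesis using 1 by (simp add: min_le_iff_disj le_max_iff_disj)
  qed
  moreover have "- 1 < min a a'" "max b b' < 1" using 1 2 by auto
  moreover have "smooth (\<lambda>t. u t + c * v t)"
    using assms by (intro smooth_add smooth_cmult bump_like_smooth)
  ultimately show ?thesis unfolding bump_like_def by blast
qed

lemma unit_bump_exists: "\<exists>\<eta>. bump_like \<eta> \<and> (\<integral>t. \<eta> t \<partial>unif_interval) = 1"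
proof -
  define \<beta> where "\<beta> = bump (- 1 / 2) (1 / 2) 0"
  have \<beta>: "bump_like \<beta>" unfolding \<beta>_def by (intro bump_like_bump) auto
  note [measurable] = bump_like_measurable[OF \<beta>]
  have int: "integrable unif_interval \<beta>"
    by (rule unif_interval.integrable_const_bound[where B = 1]) (simp_all, simp add: \<beta>_def bump_bounds)
  have nn: "0 \<le> \<beta> t" for t by (simp add: \<beta>_def bump_bounds)
  have "(\<integral>t. \<beta> t \<partial>unif_interval) \<noteq> 0"
  proof
    assume "(\<integral>t. \<beta> t \<partial>unif_interval) = 0"
    \<comment> \<open>A nonnegative function of integral 0 vanishes almost everywhere, hence by
      continuity everywhere, while the bump is positive at 0.\<close>
    then have "AE t in unif_interval. \<beta> t = 0"
      using int nn by (subst (asm) integral_nonneg_eq_0_iff_AE) auto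
    from AE_unif_interval_eq[OF this smooth_continuous[OF bump_like_smooth[OF \<beta>]] continuous_on_const, of 0]
    have "\<beta> 0 = 0" by simp
    then show False by (simp add: \<beta>_def bump_eq_exp)
  qed
  \<comment> \<open>The zero summand puts the rescaled bump into the shape of
    \<open>bump_like_lincomb\<close>.\<close>
  then have "(\<integral>t. (0 * \<beta> t) + inverse (\<integral>t. \<beta> t \<partial>unif_interval) * \<beta> t \<partial>unif_interval) = 1"
    using int by simp
  moreover have "bump_like (\<lambda>t. (0 * \<beta> t) + inverse (\<integral>t. \<beta> t \<partial>unif_interval) * \<beta> t)"
    using bump_like_lincomb[OF _ \<beta>, of "\<lambda>t. 0 * \<beta> t"] \<beta> by (simp add: bump_like_def smooth_const) blast
  ultimately show ?thesis by blast
qed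

section \<open>Weak derivatives along coordinate lines\<close>

text \<open>Measurability and the bound hold on the whole space, not merely almost everywhere, so
  that every restriction to a line is integrable without exceptions.\<close>

definition bounded_borel :: "('a::topological_space \<Rightarrow> real) \<Rightarrow> bool" where
  "bounded_borel f \<longleftrightarrow> f \<in> borel_measurable borel \<and> (\<exists>B. \<forall>x. \<bar>f x\<bar> \<le> B)"

lemma bounded_borelI: "f \<in> borel_measurable borel \<Longrightarrow> (\<And>x. \<bar>f x\<bar> \<le> B) \<Longrightarrow> bounded_borel f"
  by (auto simp: bounded_borel_def)

lemma bounded_borel_measurable [measurable_dest]: "bounded_borel f \<Longrightarrow> f \<in> borel_measurable borel"
  by (simp add: bounded_borel_def)

lemma bounded_borelE:
  assumes "bounded_borel f"
  obtains B where "B > 0" "\<And>x. \<bar>f x\<bar> \<le> B"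
proof -
  from assms obtain B where B: "\<And>x. \<bar>f x\<bar> \<le> B" by (auto simp: bounded_borel_def)
  have "\<bar>f x\<bar> \<le> max B 1" for x using B[of x] by (simp add: le_max_iff_disj)
  moreover have "max B 1 > 0" by simp
  ultimately show thesis using that by blast
qed

lemma bounded_borel_const: "bounded_borel (\<lambda>x. c)"
  by (rule bounded_borelI[where B = "\<bar>c\<bar>"]) auto

lemma bounded_borel_add:
  assumes "bounded_borel f" "bounded_borel g"
  shows "bounded_borel (\<lambda>x. f x + g x)"
proof -
  note [measurable] = bounded_borel_measurable[OF assms(1)] bounded_borel_measurable[OF assms(2)]
  obtain B where B: "\<And>x. \<bar>f x\<bar> \<le> B" using assms(1) by (rule bounded_borelE) blast
  obtain C where C: "\<And>x. \<bar>g x\<bar> \<le> C" using assms(2) by (rule bounded_borelE) blast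
  show ?thesis
    by (rule bounded_borelI[where B = "B + C"]) (auto intro: order_trans[OF abs_triangle_ineq] add_mono B C)
qed

lemma bounded_borel_mult:
  assumes "bounded_borel f" "bounded_borel g"
  shows "bounded_borel (\<lambda>x. f x * g x)"
proof -
  note [measurable] = bounded_borel_measurable[OF assms(1)] bounded_borel_measurable[OF assms(2)]
  obtain B where B: "B > 0" "\<And>x. \<bar>f x\<bar> \<le> B" using assms(1) by (rule bounded_borelE) blast
  obtain C where C: "\<And>x. \<bar>g x\<bar> \<le> C" using assms(2) by (rule bounded_borelE) blast
  have "\<bar>f x * g x\<bar> \<le> B * C" for x
    unfolding abs_mult using B C[of x] by (intro mult_mono) auto
  then show ?thesis by (intro bounded_borelI[where B = "B * C"]) auto
qed

lemma bounded_borel_cmult: "bounded_borel f \<Longrightarrow> bounded_borel (\<lambda>x. c * f x)"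
  by (intro bounded_borel_mult bounded_borel_const)

lemma bounded_borel_diff: "bounded_borel f \<Longrightarrow> bounded_borel g \<Longrightarrow> bounded_borel (\<lambda>x. f x - g x)"
  using bounded_borel_add[OF _ bounded_borel_cmult[of g "- 1"], of f] by simp

lemma bounded_borel_compose:
  assumes "bounded_borel f" "p \<in> borel_measurable borel"
  shows "bounded_borel (\<lambda>x. f (p x))"
proof -
  note [measurable] = bounded_borel_measurable[OF assms(1)] assms(2)
  obtain B where B: "\<And>x. \<bar>f x\<bar> \<le> B" using assms(1) by (rule bounded_borelE) blast
  show ?thesis by (rule bounded_borelI[where B = B]) (auto simp: B)
qed

lemma bump_like_bounded_borel: "bump_like u \<Longrightarrow> bounded_borel u"
  using bump_like_bounded bump_like_measurable by (auto simp: bounded_borel_def)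

lemma prod_fun_bounded_borel: "(\<And>i. bump_like (u i)) \<Longrightarrow> bounded_borel (prod_fun u)"
  using prod_fun_bounded[of u] measurable_prod_fun[of u] by (auto simp: bounded_borel_def bump_like_smooth)

lemma bounded_borel_integrable_cube:
  assumes "bounded_borel f"
  shows "integrable unif_cube f"
proof -
  note [measurable] = bounded_borel_measurable[OF assms]
  obtain B where B: "\<And>x. \<bar>f x\<bar> \<le> B" using assms by (rule bounded_borelE) blast
  show ?thesis by (rule unif_cube.integrable_const_bound[where B = B]) (simp_all add: B)
qed

lemma bounded_borel_integrable_interval:
  assumes "bounded_borel f"
  shows "integrable unif_interval f"
proof -
  note [measurable] = bounded_borel_measurable[OF assms]
  obtain B where B: "\<And>x. \<bar>f x\<bar> \<le> B" using assms by (rule bounded_borelE) blast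
  show ?thesis by (rule unif_interval.integrable_const_bound[where B = B]) (simp_all add: B)
qed

lemma bounded_borel_vec_upd:
  fixes f :: "real ^ 'n \<Rightarrow> real"
  assumes "bounded_borel f"
  shows "bounded_borel (\<lambda>t. f (vec_upd x k t))"
  by (rule bounded_borel_compose[OF assms]) simp

lemma bounded_borel_integral_vec_upd:
  fixes f :: "real ^ 'n \<Rightarrow> real"
  assumes "bounded_borel f"
  shows "(\<integral>x. f x \<partial>unif_cube) = (\<integral>x. \<integral>t. f (vec_upd x k t) \<partial>unif_interval \<partial>unif_cube)"
  using assms by (rule bounded_borelE) (rule integral_vec_upd[OF bounded_borel_measurable[OF assms]])

lemma bounded_borel_locally_integrable:
  fixes f :: "real ^ 'n \<Rightarrow> real"
  assumes "bounded_borel f"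
  shows "locally_integrable f"
  unfolding locally_integrable_def
proof (intro conjI allI impI)
  note [measurable] = bounded_borel_measurable[OF assms]
  show "f \<in> borel_measurable lborel_cube" by (simp add: measurable_on_cube)
  fix K :: "(real ^ 'n) set" assume K: "compact K \<and> K \<subseteq> box (- 1) 1"
  obtain B where B: "\<And>x. \<bar>f x\<bar> \<le> B" using assms by (rule bounded_borelE) blast
  show "set_integrable lborel K f"
    unfolding set_integrable_def
  proof (rule integrableI_bounded_set[where A = K and B = B])
    have [measurable]: "K \<in> sets borel" using K by (simp add: compact_imp_closed borel_closed)
    show "emeasure lborel K < \<infinity>" using K by (intro emeasure_compact_finite) simp
    show "K \<in> sets lborel" by simp
    show "(\<lambda>x. indicator K x *\<^sub>R f x) \<in> borel_measurable lborel" by simp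
  qed (auto simp: B indicator_def)
qed

text \<open>The primitive of \<open>g\<close> in direction \<open>k\<close> that vanishes on the
  face \<open>x $ k = - 1\<close>; the factor 2 turns the normalised measure back into
  length.\<close>

definition line_integral :: "(real ^ 'n \<Rightarrow> real) \<Rightarrow> 'n \<Rightarrow> real ^ 'n \<Rightarrow> real" where
  "line_integral g k x = 2 * (\<integral>s. (if s \<le> x $ k then g (vec_upd x k s) else 0) \<partial>unif_interval)"

lemma line_integral_upd:
  "line_integral g k (vec_upd x k t) = 2 * (\<integral>s. (if s \<le> t then g (vec_upd x k s) else 0) \<partial>unif_interval)"
  by (simp add: line_integral_def cong: if_cong)

lemma bounded_borel_cut:
  fixes g :: "real \<Rightarrow> real"
  assumes "bounded_borel g"
  shows "bounded_borel (\<lambda>s. if s \<le> t then g s else 0)" "bounded_borel (\<lambda>s. if t \<le> s then g s else 0)"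
    "bounded_borel (\<lambda>s. if a < s \<and> s \<le> t then g s else 0)"
proof -
  note [measurable] = bounded_borel_measurable[OF assms]
  obtain B where B: "B > 0" "\<And>x. \<bar>g x\<bar> \<le> B" using assms by (rule bounded_borelE) blast
  show "bounded_borel (\<lambda>s. if s \<le> t then g s else 0)" "bounded_borel (\<lambda>s. if t \<le> s then g s else 0)"
    "bounded_borel (\<lambda>s. if a < s \<and> s \<le> t then g s else 0)"
    by (rule bounded_borelI[where B = B]; use B in \<open>simp add: less_imp_le\<close>)+
qed

lemma line_integral_bounded_borel:
  fixes g :: "real ^ 'n \<Rightarrow> real"
  assumes "bounded_borel g"
  shows "bounded_borel (line_integral g k)"
proof -
  note [measurable] = bounded_borel_measurable[OF assms]
  obtain B where B: "B > 0" "\<And>x. \<bar>g x\<bar> \<le> B" using assms by (rule bounded_borelE) blast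
  show ?thesis
  proof (rule bounded_borelI[where B = "2 * B"])
    show "line_integral g k \<in> borel_measurable borel"
      unfolding line_integral_def[abs_def] by measurable
    fix x
    have "\<bar>\<integral>s. (if s \<le> x $ k then g (vec_upd x k s) else 0) \<partial>unif_interval\<bar>
        \<le> (\<integral>s. B \<partial>unif_interval)"
      by (rule integral_abs_bound_integral)
        (use B in \<open>auto intro!: bounded_borel_integrable_interval bounded_borel_cut bounded_borel_vec_upd assms
            simp: less_imp_le\<close>)
    then show "\<bar>line_integral g k x\<bar> \<le> 2 * B"
      using unif_interval.prob_space by (simp add: line_integral_def abs_mult)
  qed
qed

lemma integral_if_mult: "(\<integral>s. (if P s then c * f s else 0) \<partial>M) = c * (\<integral>s. (if P s then f s else 0) \<partial>M)"
  for f :: "'a \<Rightarrow> real"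
proof -
  have "(\<lambda>s. if P s then c * f s else 0) = (\<lambda>s. c * (if P s then f s else 0))" by auto
  then show ?thesis by (simp only: integral_mult_right_zero)
qed

text \<open>Integration by parts, done by Fubini so that the primitive of \<open>g\<close> is never
  differentiated: after the exchange, the inner integral of \<open>deriv \<psi>\<close> over [s, 1]
  is \<open>- \<psi> s\<close>, since \<open>\<psi> 1 = 0\<close>. The factor 1/2 is the density of
  \<open>unif_interval\<close>.\<close>

lemma bump_parts:
  fixes g :: "real \<Rightarrow> real"
  assumes g: "bounded_borel g" and \<psi>: "bump_like \<psi>"
  shows "(\<integral>t. (\<integral>s. (if s \<le> t then g s else 0) \<partial>unif_interval) * deriv \<psi> t \<partial>unif_interval)
    = - (1 / 2) * (\<integral>s. g s * \<psi> s \<partial>unif_interval)"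
proof -
  interpret P: pair_prob_space unif_interval unif_interval ..
  have d: "bump_like (deriv \<psi>)" using \<psi> by (rule bump_like_deriv)
  note [measurable] = bounded_borel_measurable[OF g] bump_like_measurable[OF d] bump_like_measurable[OF \<psi>]
  obtain B where B: "B > 0" "\<And>x. \<bar>g x\<bar> \<le> B" using g by (rule bounded_borelE) blast
  obtain C where C: "C > 0" "\<And>x. \<bar>deriv \<psi> x\<bar> \<le> C"
    using bump_like_bounded_borel[OF d] by (rule bounded_borelE) blast
  have tail: "(\<integral>t. (if s \<le> t then deriv \<psi> t else 0) \<partial>unif_interval) = - \<psi> s / 2" if s: "s \<in> {-1..1}" for s
  proof -
    have "(\<integral>t. (if s \<le> t then deriv \<psi> t else 0) \<partial>unif_interval)
        = (\<integral>t. indicator {-1..1} t * (if s \<le> t then deriv \<psi> t else 0) \<partial>lborel) / 2"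
      by (rule integral_unif_interval) measurable
    also have "(\<lambda>t. indicator {-1..1} t * (if s \<le> t then deriv \<psi> t else 0)) = (\<lambda>t. indicator {s..1} t *\<^sub>R deriv \<psi> t)"
      using s by (auto simp: fun_eq_iff indicator_def)
    also have "(\<integral>t. indicator {s..1} t *\<^sub>R deriv \<psi> t \<partial>lborel) = \<psi> 1 - \<psi> s"
      using s by (intro integral_FTC_atLeastAtMost)
        (auto simp: has_real_derivative_iff_has_vector_derivative[symmetric]
          intro!: has_field_derivative_at_within smooth_DERIV bump_like_smooth \<psi> smooth_continuous d)
    also have "\<psi> 1 = 0" using \<psi> unfolding bump_like_def by fastforce
    finally show ?thesis by simp
  qed
  have "(\<integral>t. (\<integral>s. (if s \<le> t then g s else 0) \<partial>unif_interval) * deriv \<psi> t \<partial>unif_interval)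
      = (\<integral>t. (\<integral>s. (if s \<le> t then deriv \<psi> t * g s else 0) \<partial>unif_interval) \<partial>unif_interval)"
    by (intro Bochner_Integration.integral_cong refl) (simp add: integral_if_mult mult.commute)
  also have "\<dots> = (\<integral>s. (\<integral>t. (if s \<le> t then deriv \<psi> t * g s else 0) \<partial>unif_interval) \<partial>unif_interval)"
  proof (rule P.Fubini_integral)
    have "\<bar>if s \<le> t then deriv \<psi> t * g s else 0\<bar> \<le> C * B" for s t
      using B C mult_mono[of "\<bar>deriv \<psi> t\<bar>" C "\<bar>g s\<bar>" B] by (auto simp: abs_mult)
    then show "integrable (unif_interval \<Otimes>\<^sub>M unif_interval) (\<lambda>(x, y). if x \<le> y then deriv \<psi> y * g x else 0)"
      by (intro P.integrable_const_bound[where B = "C * B"]) (auto intro!: AE_I2)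
  qed
  also have "\<dots> = (\<integral>s. - (1 / 2) * (g s * \<psi> s) \<partial>unif_interval)"
  proof (rule integral_cong_AE)
    show "AE s in unif_interval. (\<integral>t. (if s \<le> t then deriv \<psi> t * g s else 0) \<partial>unif_interval) = - (1 / 2) * (g s * \<psi> s)"
      unfolding AE_unif_interval_iff
    proof (intro AE_I2 impI)
      fix s :: real assume s: "s \<in> {-1..1}"
      have "(\<integral>t. (if s \<le> t then deriv \<psi> t * g s else 0) \<partial>unif_interval)
          = g s * (\<integral>t. (if s \<le> t then deriv \<psi> t else 0) \<partial>unif_interval)"
        by (subst integral_if_mult[symmetric]) (simp add: mult.commute cong: if_cong)
      then show "(\<integral>t. (if s \<le> t then deriv \<psi> t * g s else 0) \<partial>unif_interval) = - (1 / 2) * (g s * \<psi> s)"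
        using tail[OF s] by simp
    qed
  qed measurable
  also have "\<dots> = - (1 / 2) * (\<integral>s. g s * \<psi> s \<partial>unif_interval)"
    by (rule integral_mult_right_zero)
  finally show ?thesis .
qed

text \<open>Weak differentiability reduced to what the argument along lines uses: only product test
  functions, with the normalised measure on both sides.\<close>

definition weak_partial :: "(real ^ 'n \<Rightarrow> real) \<Rightarrow> 'n \<Rightarrow> (real ^ 'n \<Rightarrow> real) \<Rightarrow> bool" where
  "weak_partial f k g \<longleftrightarrow> (\<forall>u. (\<forall>i. bump_like (u i)) \<longrightarrow>
    (\<integral>x. f x * prod_fun (u(k := deriv (u k))) x \<partial>unif_cube) = - (\<integral>x. g x * prod_fun u x \<partial>unif_cube))"

lemma prod_fun_split: "prod_fun u x = u k (x $ k) * (\<Prod>i\<in>UNIV - {k}. u i (x $ i))"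
  unfolding prod_fun_def by (subst prod.remove[of _ k]) auto

lemma fundamental_lemma_bounded:
  fixes f :: "real ^ 'n \<Rightarrow> real"
  assumes f: "bounded_borel f"
    and zero: "\<And>u. (\<And>i. bump_like (u i)) \<Longrightarrow> (\<integral>x. f x * prod_fun u x \<partial>unif_cube) = 0"
  shows "AE x in unif_cube. f x = 0"
proof (rule fundamental_lemma)
  show "locally_integrable f" using f by (rule bounded_borel_locally_integrable)
  fix u :: "'n \<Rightarrow> real \<Rightarrow> real" assume u: "\<And>i. bump_like (u i)"
  note [measurable] = bounded_borel_measurable[OF f] bounded_borel_measurable[OF prod_fun_bounded_borel[of u, OF u]]
  show "(\<integral>x. f x * prod_fun u x \<partial>lborel_cube) = 0"
    using zero[of u, OF u] by (subst (asm) integral_unif_cube) auto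
qed

text \<open>The lemma of du Bois-Reymond in one direction. Subtracting the line integral of
  \<open>g\<close> from \<open>f\<close> leaves a function \<open>F\<close> whose weak derivative in
  direction \<open>k\<close> vanishes, and such a function does not depend on the coordinate
  \<open>k\<close> up to a null set.\<close>

lemma weak_partial_line:
  fixes f g :: "real ^ 'n \<Rightarrow> real"
  assumes f: "bounded_borel f" and g: "bounded_borel g" and fg: "weak_partial f k g"
  shows "\<exists>h. (\<forall>x t. h (vec_upd x k t) = h x) \<and> (AE x in unif_cube. f x = h x + line_integral g k x)"
proof -
  obtain \<eta> where \<eta>: "bump_like \<eta>" "(\<integral>t. \<eta> t \<partial>unif_interval) = 1" using unit_bump_exists by blast
  define F where "F x = f x - line_integral g k x" for x
  have F: "bounded_borel F" unfolding F_def[abs_def] by (intro bounded_borel_diff line_integral_bounded_borel f g)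
  \<comment> \<open>The candidate for the part independent of coordinate \<open>k\<close>: the
    average of \<open>F\<close> along the line against a bump of mean 1.\<close>
  define h where "h x = (\<integral>s. F (vec_upd x k s) * \<eta> s \<partial>unif_interval)" for x
  have h_upd: "h (vec_upd x k t) = h x" for x t by (simp add: h_def)
  have F\<eta>: "bounded_borel (\<lambda>x. F x * \<eta> (x $ k))"
    by (intro bounded_borel_mult F bounded_borel_compose[OF bump_like_bounded_borel[OF \<eta>(1)]]) simp
  have h: "bounded_borel h"
  proof -
    note [measurable] = bounded_borel_measurable[OF F] bump_like_measurable[OF \<eta>(1)]
    obtain B where B: "B > 0" "\<And>x. \<bar>F x * \<eta> (x $ k)\<bar> \<le> B" using F\<eta> by (rule bounded_borelE) blast
    show ?thesis
    proof (rule bounded_borelI[where B = B])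
      show "h \<in> borel_measurable borel" unfolding h_def[abs_def] by measurable
      fix x
      have b: "\<bar>F (vec_upd x k s) * \<eta> s\<bar> \<le> B" for s using B(2)[of "vec_upd x k s"] by simp
      have "\<bar>h x\<bar> \<le> (\<integral>s. B \<partial>unif_interval)" unfolding h_def
        by (rule integral_abs_bound_integral)
          (auto simp: b intro!: bounded_borel_integrable_interval bounded_borelI[where B = B])
      then show "\<bar>h x\<bar> \<le> B" using unif_interval.prob_space by simp
    qed
  qed
  have "AE x in unif_cube. F x - h x = 0"
  proof (rule fundamental_lemma_bounded)
    show "bounded_borel (\<lambda>x. F x - h x)" by (intro bounded_borel_diff F h)
    fix u :: "'n \<Rightarrow> real \<Rightarrow> real" assume u: "\<And>i. bump_like (u i)"
    define c where "c = (\<integral>t. u k t \<partial>unif_interval)"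
    \<comment> \<open>Splits the factor \<open>u k\<close> into its mean times \<open>\<eta>\<close>
      and a rest of mean 0. The rest is the derivative of a bump, so the weak identity can be
      applied to it.\<close>
    define v where "v = (\<lambda>t. u k t + (- c) * \<eta> t)"
    have v: "bump_like v" unfolding v_def by (intro bump_like_lincomb u \<eta>)
    have iu: "integrable unif_interval (u k)" and i\<eta>: "integrable unif_interval \<eta>"
      using u \<eta> by (auto intro!: bounded_borel_integrable_interval bump_like_bounded_borel)
    have "(\<integral>t. v t \<partial>unif_interval) = 0"
      unfolding v_def using iu i\<eta> \<eta>(2) by (simp add: c_def)
    from bump_like_primitive[OF v this] obtain \<psi> where \<psi>: "bump_like \<psi>" "deriv \<psi> = v" by blast
    define W where "W x = (\<Prod>i\<in>UNIV - {k}. u i (x $ i))" for x :: "real ^ 'n"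
    have W_upd: "W (vec_upd x k t) = W x" for x t
      unfolding W_def by (intro prod.cong) auto
    have pf: "prod_fun (u(k := w)) x = w (x $ k) * W x" for w x
      by (subst prod_fun_split[of _ _ k]) (auto simp: W_def intro!: prod.cong)
    have pfu: "prod_fun u x = u k (x $ k) * W x" for x
      by (subst prod_fun_split[of _ _ k]) (simp add: W_def)
    have bv: "bounded_borel (prod_fun (u(k := v)))" "bounded_borel (prod_fun (u(k := \<psi>)))" "bounded_borel (prod_fun u)"
      "bounded_borel (prod_fun (u(k := \<eta>)))"
      using u v \<psi> \<eta> by (auto intro!: prod_fun_bounded_borel)
    have weak: "(\<integral>x. f x * prod_fun (u(k := v)) x \<partial>unif_cube) = - (\<integral>x. g x * prod_fun (u(k := \<psi>)) x \<partial>unif_cube)"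
    proof -
      have "\<forall>i. bump_like ((u(k := \<psi>)) i)" using u \<psi> by simp
      then have "(\<integral>x. f x * prod_fun ((u(k := \<psi>))(k := deriv ((u(k := \<psi>)) k))) x \<partial>unif_cube)
          = - (\<integral>x. g x * prod_fun (u(k := \<psi>)) x \<partial>unif_cube)"
        using fg unfolding weak_partial_def by blast
      then show ?thesis using \<psi>(2) by simp
    qed
    \<comment> \<open>The line integral satisfies the same weak identity as \<open>f\<close>, line
      by line by \<open>bump_parts\<close>.\<close>
    have "(\<integral>x. line_integral g k x * prod_fun (u(k := v)) x \<partial>unif_cube)
        = (\<integral>x. \<integral>t. line_integral g k (vec_upd x k t) * prod_fun (u(k := v)) (vec_upd x k t) \<partial>unif_interval \<partial>unif_cube)"
      by (intro bounded_borel_integral_vec_upd bounded_borel_mult line_integral_bounded_borel g bv)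
    also have "\<dots> = (\<integral>x. \<integral>t. - (g (vec_upd x k t) * prod_fun (u(k := \<psi>)) (vec_upd x k t)) \<partial>unif_interval \<partial>unif_cube)"
    proof (rule Bochner_Integration.integral_cong[OF refl])
      fix x :: "real ^ 'n"
      let ?g = "\<lambda>s. g (vec_upd x k s)"
      have "(\<integral>t. line_integral g k (vec_upd x k t) * prod_fun (u(k := v)) (vec_upd x k t) \<partial>unif_interval)
          = (\<integral>t. (2 * W x) * ((\<integral>s. (if s \<le> t then ?g s else 0) \<partial>unif_interval) * deriv \<psi> t) \<partial>unif_interval)"
        by (intro Bochner_Integration.integral_cong refl) (simp add: line_integral_upd pf W_upd \<psi>(2))
      also have "\<dots> = (2 * W x) * (- (1 / 2) * (\<integral>s. ?g s * \<psi> s \<partial>unif_interval))"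
        using bump_parts[OF bounded_borel_vec_upd[OF g] \<psi>(1), of x k] by (simp only: integral_mult_right_zero)
      also have "\<dots> = (\<integral>s. - W x * (?g s * \<psi> s) \<partial>unif_interval)"
        by (simp only: integral_mult_right_zero)
      also have "\<dots> = (\<integral>t. - (?g t * prod_fun (u(k := \<psi>)) (vec_upd x k t)) \<partial>unif_interval)"
        by (intro Bochner_Integration.integral_cong refl) (simp add: pf W_upd)
      finally show "(\<integral>t. line_integral g k (vec_upd x k t) * prod_fun (u(k := v)) (vec_upd x k t) \<partial>unif_interval)
          = (\<integral>t. - (?g t * prod_fun (u(k := \<psi>)) (vec_upd x k t)) \<partial>unif_interval)" .
    qed
    also have "\<dots> = - (\<integral>x. \<integral>t. g (vec_upd x k t) * prod_fun (u(k := \<psi>)) (vec_upd x k t) \<partial>unif_interval \<partial>unif_cube)"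
      by simp
    also have "\<dots> = - (\<integral>x. g x * prod_fun (u(k := \<psi>)) x \<partial>unif_cube)"
      by (subst bounded_borel_integral_vec_upd[symmetric, of "\<lambda>x. g x * prod_fun (u(k := \<psi>)) x" k])
        (auto intro!: bounded_borel_mult g bv)
    also have "\<dots> = (\<integral>x. f x * prod_fun (u(k := v)) x \<partial>unif_cube)" by (simp add: weak)
    finally have "(\<integral>x. f x * prod_fun (u(k := v)) x \<partial>unif_cube) - (\<integral>x. line_integral g k x * prod_fun (u(k := v)) x \<partial>unif_cube) = 0"
      by simp
    then have "(\<integral>x. F x * prod_fun (u(k := v)) x \<partial>unif_cube) = 0"
      unfolding F_def left_diff_distrib
      by (subst Bochner_Integration.integral_diff)
        (auto intro!: bounded_borel_integrable_cube bounded_borel_mult line_integral_bounded_borel f g bv)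
    \<comment> \<open>\<open>F\<close> annihilates the mean-zero part, so only the part along
      \<open>\<eta>\<close> survives, and this is where \<open>h\<close> appears.\<close>
    also have "(\<lambda>x. F x * prod_fun (u(k := v)) x) = (\<lambda>x. F x * prod_fun u x - c * (F x * prod_fun (u(k := \<eta>)) x))"
      by (simp add: fun_eq_iff pf pfu v_def algebra_simps)
    finally have *: "(\<integral>x. F x * prod_fun u x \<partial>unif_cube) = c * (\<integral>x. F x * prod_fun (u(k := \<eta>)) x \<partial>unif_cube)"
      by (subst (asm) Bochner_Integration.integral_diff)
        (auto intro!: bounded_borel_integrable_cube bounded_borel_mult bounded_borel_const F bv)
    have "(\<integral>x. F x * prod_fun (u(k := \<eta>)) x \<partial>unif_cube)
        = (\<integral>x. \<integral>t. F (vec_upd x k t) * prod_fun (u(k := \<eta>)) (vec_upd x k t) \<partial>unif_interval \<partial>unif_cube)"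
      by (intro bounded_borel_integral_vec_upd bounded_borel_mult F bv)
    also have "\<dots> = (\<integral>x. h x * W x \<partial>unif_cube)"
      by (intro Bochner_Integration.integral_cong refl)
        (simp add: pf W_upd h_def mult.assoc[symmetric])
    finally have **: "(\<integral>x. F x * prod_fun (u(k := \<eta>)) x \<partial>unif_cube) = (\<integral>x. h x * W x \<partial>unif_cube)" .
    have "(\<integral>x. h x * prod_fun u x \<partial>unif_cube)
        = (\<integral>x. \<integral>t. h (vec_upd x k t) * prod_fun u (vec_upd x k t) \<partial>unif_interval \<partial>unif_cube)"
      by (intro bounded_borel_integral_vec_upd bounded_borel_mult h bv)
    also have "\<dots> = (\<integral>x. c * (h x * W x) \<partial>unif_cube)"
    proof (rule Bochner_Integration.integral_cong[OF refl])
      fix x :: "real ^ 'n"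
      have "(\<integral>t. h (vec_upd x k t) * prod_fun u (vec_upd x k t) \<partial>unif_interval) = (\<integral>t. (h x * W x) * u k t \<partial>unif_interval)"
        by (intro Bochner_Integration.integral_cong refl) (simp add: pfu W_upd h_upd)
      then show "(\<integral>t. h (vec_upd x k t) * prod_fun u (vec_upd x k t) \<partial>unif_interval) = c * (h x * W x)"
        by (simp add: c_def)
    qed
    also have "\<dots> = c * (\<integral>x. h x * W x \<partial>unif_cube)" by (rule integral_mult_right_zero)
    finally have "(\<integral>x. F x * prod_fun u x \<partial>unif_cube) - (\<integral>x. h x * prod_fun u x \<partial>unif_cube) = 0"
      using * ** by simp
    then show "(\<integral>x. (F x - h x) * prod_fun u x \<partial>unif_cube) = 0"
      unfolding left_diff_distrib
      by (subst Bochner_Integration.integral_diff)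
        (auto intro!: bounded_borel_integrable_cube bounded_borel_mult F h bv)
  qed
  then have "AE x in unif_cube. f x = h x + line_integral g k x"
    by (rule eventually_mono) (simp add: F_def)
  with h_upd show ?thesis by blast
qed

section \<open>Lipschitz representatives\<close>

lemma line_integral_diff:
  fixes g :: "real ^ 'n \<Rightarrow> real"
  assumes g: "bounded_borel g" and "a \<le> b"
  shows "line_integral g k (vec_upd x k b) - line_integral g k (vec_upd x k a)
    = 2 * (\<integral>s. (if a < s \<and> s \<le> b then g (vec_upd x k s) else 0) \<partial>unif_interval)"
proof -
  have *: "integrable unif_interval (\<lambda>s. if s \<le> t then g (vec_upd x k s) else 0)" for t
    by (intro bounded_borel_integrable_interval bounded_borel_cut bounded_borel_vec_upd g)
  have "(\<integral>s. (if s \<le> b then g (vec_upd x k s) else 0) \<partial>unif_interval)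
      - (\<integral>s. (if s \<le> a then g (vec_upd x k s) else 0) \<partial>unif_interval)
      = (\<integral>s. (if a < s \<and> s \<le> b then g (vec_upd x k s) else 0) \<partial>unif_interval)"
    using assms(2) by (subst Bochner_Integration.integral_diff[OF * *, symmetric])
      (auto intro!: Bochner_Integration.integral_cong)
  then show ?thesis by (simp add: line_integral_upd)
qed

lemma measure_unif_interval_Ioc:
  assumes "a \<le> b"
  shows "measure unif_interval {a<..b} \<le> (b - a) / 2"
proof -
  have "emeasure unif_interval {a<..b} \<le> emeasure lborel {a<..b} / 2"
    by (simp add: emeasure_unif_interval divide_right_mono_ennreal emeasure_mono del: emeasure_lborel_Ioc)
  also have "\<dots> = ennreal ((b - a) / 2)"
    using assms by (simp add: divide_ennreal[symmetric])
  finally have "enn2real (emeasure unif_interval {a<..b}) \<le> (b - a) / 2"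
    using assms by (intro enn2real_leI) auto
  then show ?thesis by (simp only: measure_def)
qed

lemma line_integral_lipschitz:
  fixes g :: "real ^ 'n \<Rightarrow> real"
  assumes g: "bounded_borel g" and M: "\<And>x. \<bar>g x\<bar> \<le> M"
  shows "\<bar>line_integral g k (vec_upd x k b) - line_integral g k (vec_upd x k a)\<bar> \<le> M * \<bar>b - a\<bar>"
proof (induction a b rule: linorder_wlog)
  case (le a b)
  have M0: "0 \<le> M" using M[of undefined] by linarith
  have "\<bar>\<integral>s. (if a < s \<and> s \<le> b then g (vec_upd x k s) else 0) \<partial>unif_interval\<bar>
      \<le> (\<integral>s. M * indicator {a<..b} s \<partial>unif_interval)"
  proof (rule integral_abs_bound_integral)
    show "integrable unif_interval (\<lambda>s. if a < s \<and> s \<le> b then g (vec_upd x k s) else 0)"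
      by (intro bounded_borel_integrable_interval bounded_borel_cut bounded_borel_vec_upd g)
    show "integrable unif_interval (\<lambda>s. M * indicator {a<..b} s)"
      by (rule unif_interval.integrable_const_bound[where B = M]) (use M0 in \<open>auto simp: indicator_def\<close>)
  qed (use M M0 in \<open>auto simp: indicator_def\<close>)
  also have "\<dots> = M * measure unif_interval {a<..b}" by simp
  also have "\<dots> \<le> M * ((b - a) / 2)" using M0 le by (intro mult_left_mono measure_unif_interval_Ioc)
  finally show ?case using le by (simp add: line_integral_diff[OF g] abs_mult)
next
  case (sym a b)
  then show ?case by (simp add: abs_minus_commute)
qed

text \<open>Serves twice: as a hybrid between two points that are compared coordinate by coordinate,
  and as the stage of a change of variables at which only the coordinates in \<open>A\<close> have
  been transformed.\<close>

definition mix :: "'n set \<Rightarrow> real ^ 'n \<Rightarrow> real ^ 'n \<Rightarrow> real ^ 'n" where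
  "mix A y x = (\<chi> i. if i \<in> A then y $ i else x $ i)"

lemma mix_nth [simp]: "mix A y x $ i = (if i \<in> A then y $ i else x $ i)"
  by (simp add: mix_def)

lemma mix_empty [simp]: "mix {} y x = x" and mix_UNIV [simp]: "mix UNIV y x = y"
  by (simp_all add: vec_eq_iff)

lemma mix_insert: "mix (insert k A) (vec_upd y k t) x = vec_upd (mix A y x) k t"
  by (auto simp: vec_eq_iff)

lemma measurable_mix [measurable (raw)]:
  fixes f g :: "'a \<Rightarrow> real ^ 'n"
  assumes [measurable]: "f \<in> borel_measurable M" "g \<in> borel_measurable M"
  shows "(\<lambda>x. mix A (f x) (g x)) \<in> borel_measurable M"
  by (intro borel_measurable_vec) simp

text \<open>The condition says that the integral of the indicator of the exceptional set vanishes,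
  and this integral is measurable in the parameter. It allows the quantifier \<open>AE t\<close>
  inside measurable predicates, on which the inductions over coordinates rely.\<close>

lemma measurable_AE_unif_interval:
  assumes [measurable]: "Measurable.pred (M \<Otimes>\<^sub>M borel) (\<lambda>z. P (fst z) (snd z))"
  shows "Measurable.pred M (\<lambda>x. AE t in unif_interval. P x t)"
proof -
  have "(AE t in unif_interval. P x t) \<longleftrightarrow> (\<integral>\<^sup>+t. (if P x t then 0 else 1) \<partial>unif_interval) = 0"
    if x: "x \<in> space M" for x
  proof -
    have [measurable]: "Measurable.pred borel (P x)"
      using measurable_compose[OF measurable_Pair1'[OF x] assms] by simp
    have "(\<integral>\<^sup>+t. (if P x t then 0 else 1) \<partial>unif_interval) = 0
        \<longleftrightarrow> (AE t in unif_interval. (if P x t then 0 else 1) = (0 :: ennreal))"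
      by (intro nn_integral_0_iff_AE) measurable
    also have "\<dots> \<longleftrightarrow> (AE t in unif_interval. P x t)" by (intro AE_cong) auto
    finally show ?thesis by simp
  qed
  then have "Measurable.pred M (\<lambda>x. AE t in unif_interval. P x t)
      \<longleftrightarrow> Measurable.pred M (\<lambda>x. (\<integral>\<^sup>+t. (if P x t then 0 else 1) \<partial>unif_interval) = (0 :: ennreal))"
    by (intro measurable_cong) auto
  also have "\<dots>"
  proof -
    have [measurable]: "(\<lambda>(x, t). if P x t then 0 else (1 :: ennreal)) \<in> borel_measurable (M \<Otimes>\<^sub>M borel)"
      unfolding split_beta' by measurable
    have "(\<lambda>x. \<integral>\<^sup>+t. (if P x t then 0 else (1 :: ennreal)) \<partial>unif_interval) \<in> borel_measurable M"
      by (rule unif_interval.borel_measurable_nn_integral) simp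
    then show ?thesis by measurable
  qed
  finally show ?thesis .
qed

text \<open>For independent uniform \<open>x\<close> and \<open>y\<close> every hybrid is again
  uniform. In the induction the new coordinate is first a fresh number \<open>t\<close>, kept inside
  the predicate, and is merged into \<open>y\<close> afterwards.\<close>

lemma AE_mix:
  fixes P :: "real ^ 'n \<Rightarrow> bool"
  assumes "Measurable.pred borel P" "AE x in unif_cube. P x"
  shows "AE x in unif_cube. AE y in unif_cube. P (mix A y x)"
proof -
  have "finite A" by simp
  then show ?thesis using assms
  proof (induction A arbitrary: P)
    case (insert k A)
    note [measurable] = insert.prems(1)
    have "AE x in unif_cube. AE t in unif_interval. P (vec_upd x k t)"
      using insert.prems(2) by (rule AE_vec_updD)
    moreover have "Measurable.pred borel (\<lambda>x. AE t in unif_interval. P (vec_upd x k t))"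
      by (rule measurable_AE_unif_interval) measurable
    ultimately have "AE x in unif_cube. AE y in unif_cube. AE t in unif_interval. P (vec_upd (mix A y x) k t)"
      using insert.IH[of "\<lambda>x. AE t in unif_interval. P (vec_upd x k t)"] by blast
    then show ?case
    proof (rule eventually_mono)
      fix x :: "real ^ 'n"
      assume "AE y in unif_cube. AE t in unif_interval. P (vec_upd (mix A y x) k t)"
      then have "AE y in unif_cube. AE t in unif_interval. P (mix (insert k A) (vec_upd y k t) x)"
        by (simp only: mix_insert)
      then show "AE y in unif_cube. P (mix (insert k A) y x)"
        by (subst (asm) AE_vec_upd_iff) auto
    qed
  qed simp
qed

text \<open>Telescoping from \<open>x\<close> to \<open>y\<close> through hybrids that change one
  coordinate at a time. By \<open>AE_mix\<close> almost every hybrid is a point at which the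
  estimate along the line holds.\<close>

lemma AE_lipschitz_pairs:
  fixes f :: "real ^ 'n \<Rightarrow> real"
  assumes [measurable]: "f \<in> borel_measurable borel"
    and line: "\<And>k. AE x in unif_cube. AE t in unif_interval. \<bar>f x - f (vec_upd x k t)\<bar> \<le> M * \<bar>x $ k - t\<bar>"
  shows "AE x in unif_cube. AE y in unif_cube. \<bar>f x - f y\<bar> \<le> (\<Sum>i\<in>UNIV. M * \<bar>x $ i - y $ i\<bar>)"
proof -
  have "AE x in unif_cube. AE y in unif_cube. \<bar>f x - f (mix A y x)\<bar> \<le> (\<Sum>i\<in>A. M * \<bar>x $ i - y $ i\<bar>)" for A
  proof -
    have "finite A" by simp
    then show ?thesis
    proof (induction A)
      case (insert k A)
      have "AE x in unif_cube. AE y in unif_cube. AE t in unif_interval.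
          \<bar>f (mix A y x) - f (vec_upd (mix A y x) k t)\<bar> \<le> M * \<bar>mix A y x $ k - t\<bar>"
        by (rule AE_mix[OF measurable_AE_unif_interval line]) measurable
      with insert.IH show ?case
      proof eventually_elim
        case (elim x)
        from elim have "AE y in unif_cube. AE t in unif_interval.
            \<bar>f x - f (mix (insert k A) (vec_upd y k t) x)\<bar> \<le> (\<Sum>i\<in>insert k A. M * \<bar>x $ i - vec_upd y k t $ i\<bar>)"
        proof eventually_elim
          case (elim y)
          from elim(2) show ?case
          proof (rule eventually_mono)
            fix t assume t: "\<bar>f (mix A y x) - f (vec_upd (mix A y x) k t)\<bar> \<le> M * \<bar>mix A y x $ k - t\<bar>"
            have "(\<Sum>i\<in>insert k A. M * \<bar>x $ i - vec_upd y k t $ i\<bar>)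
                = M * \<bar>x $ k - t\<bar> + (\<Sum>i\<in>A. M * \<bar>x $ i - y $ i\<bar>)"
              using insert.hyps by (auto intro!: sum.cong)
            moreover have "\<bar>f (mix A y x) - f (vec_upd (mix A y x) k t)\<bar> \<le> M * \<bar>x $ k - t\<bar>"
              using t insert.hyps by simp
            ultimately show "\<bar>f x - f (mix (insert k A) (vec_upd y k t) x)\<bar>
                \<le> (\<Sum>i\<in>insert k A. M * \<bar>x $ i - vec_upd y k t $ i\<bar>)"
              using elim(1) unfolding mix_insert by linarith
          qed
        qed
        then show ?case by (subst (asm) AE_vec_upd_iff) auto
      qed
    qed simp
  qed
  from this[of UNIV] show ?thesis by simp
qed

text \<open>\<open>X\<close> consists of the points that satisfy the estimate with almost every
  partner. Two of them need not be partners of each other, so they are compared through a third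
  point near \<open>x\<close> that is a partner of both. \<open>X\<close> is dense in the cube, and
  \<open>f\<close> extends from it to its closure.\<close>

lemma AE_lipschitz_extend:
  fixes f :: "real ^ 'n \<Rightarrow> real"
  assumes L: "L \<ge> 0" and pairs: "AE x in unif_cube. AE y in unif_cube. \<bar>f x - f y\<bar> \<le> L * dist x y"
  shows "\<exists>g. L-lipschitz_on cube g \<and> (AE x in unif_cube. f x = g x)"
proof -
  define X where "X = {x\<in>cube. AE y in unif_cube. \<bar>f x - f y\<bar> \<le> L * dist x y}"
  have "L-lipschitz_on X f"
  proof (rule lipschitz_onI)
    fix x y assume x: "x \<in> X" and y: "y \<in> X"
    have "\<bar>f x - f y\<bar> \<le> L * dist x y + e" if e: "e > 0" for e
    proof -
      \<comment> \<open>The detour through the third point costs \<open>L * r\<close> twice, and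
        this \<open>r\<close> makes the cost at most \<open>e\<close>; adding 1 avoids division by
        0.\<close>
      define r where "r = e / (2 * L + 1)"
      have r: "r > 0" "2 * L * r \<le> e"
      proof -
        show "r > 0" using e L by (simp add: r_def)
        have "e = (2 * L + 1) * r" using L by (simp add: r_def)
        then show "2 * L * r \<le> e" using \<open>r > 0\<close> by (simp add: algebra_simps)
      qed
      have "AE z in unif_cube. \<bar>f x - f z\<bar> \<le> L * dist x z \<and> \<bar>f y - f z\<bar> \<le> L * dist y z"
        using x y by (auto simp: X_def)
      from unif_cube_dense[OF this, of x r] x r obtain z where
        z: "dist z x < r" "\<bar>f x - f z\<bar> \<le> L * dist x z" "\<bar>f y - f z\<bar> \<le> L * dist y z"
        by (auto simp: X_def)
      have "dist y z \<le> dist x y + r" using dist_triangle[of y z x] z(1) by (simp add: dist_commute)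
      then have "L * dist y z \<le> L * dist x y + L * r"
        using L by (metis distrib_left mult_left_mono)
      moreover have "L * dist x z \<le> L * r" using z(1) L by (intro mult_left_mono) (auto simp: dist_commute)
      ultimately show ?thesis using z r by linarith
    qed
    then show "dist (f x) (f y) \<le> L * dist x y"
      unfolding dist_real_def by (rule field_le_epsilon)
  qed (rule L)
  then obtain g where g: "L-lipschitz_on (closure X) g" "\<And>x. x \<in> X \<Longrightarrow> g x = f x"
    using lipschitz_extend_closure[of L X f] by blast
  have "cube \<subseteq> closure X"
  proof
    fix x :: "real ^ 'n" assume "x \<in> cube"
    then show "x \<in> closure X"
      unfolding closure_approachable using unif_cube_dense[OF pairs] by (auto simp: X_def)
  qed
  then have "L-lipschitz_on cube g" using g(1) by (rule lipschitz_on_subset[rotated])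
  moreover have "AE x in unif_cube. f x = g x"
    using pairs AE_in_cube by eventually_elim (simp add: g(2) X_def)
  ultimately show ?thesis by blast
qed

lemma continuous_on_vec_upd:
  fixes f :: "real ^ 'n \<Rightarrow> 'a::topological_space"
  assumes "continuous_on cube f" "x \<in> cube"
  shows "continuous_on {-1..1} (\<lambda>t. f (vec_upd x k t))"
proof (rule continuous_on_compose2[OF assms(1)])
  show "continuous_on {-1..1} (vec_upd x k)"
    unfolding vec_upd_def[abs_def]
  proof (rule continuous_on_vec_lambda)
    fix i :: 'n
    show "continuous_on {-1..1} (\<lambda>t. if i = k then t else x $ i)"
      by (cases "i = k") (auto intro: continuous_intros)
  qed
  show "vec_upd x k ` {-1..1} \<subseteq> cube" using assms(2) vec_upd_in_cube by blast
qed

text \<open>The factor 2 compensates for the total mass 1 of \<open>unif_interval\<close>.\<close>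

definition line_deriv :: "(real ^ 'n \<Rightarrow> real) \<Rightarrow> 'n \<Rightarrow> (real ^ 'n \<Rightarrow> real) \<Rightarrow> bool" where
  "line_deriv f k g \<longleftrightarrow> bounded_borel g \<and>
    (AE x in unif_cube. \<forall>a\<in>{-1..1}. \<forall>b\<in>{-1..1}. a \<le> b \<longrightarrow>
      f (vec_upd x k b) - f (vec_upd x k a)
        = 2 * (\<integral>s. (if a < s \<and> s \<le> b then g (vec_upd x k s) else 0) \<partial>unif_interval))"

text \<open>On almost every line \<open>f\<close> differs from the line integral of
  \<open>g k\<close> by a constant, up to a null set of the line. This gives a Lipschitz bound in
  each direction and, by telescoping, for almost all pairs. The fundamental theorem along lines then
  passes to the continuous representative.\<close>

lemma lipschitz_representative:
  fixes f :: "real ^ 'n \<Rightarrow> real"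
  assumes f: "bounded_borel f" and g: "\<And>k. bounded_borel (g k)" and fg: "\<And>k. weak_partial f k (g k)"
  shows "\<exists>F L. L-lipschitz_on cube F \<and> (AE x in unif_cube. f x = F x) \<and> (\<forall>k. line_deriv F k (g k))"
proof -
  note [measurable] = bounded_borel_measurable[OF f]
  have "\<forall>k. \<exists>M. \<forall>x. \<bar>g k x\<bar> \<le> M" using g by (auto simp: bounded_borel_def)
  from choice[OF this] obtain m where m: "\<forall>k x. \<bar>g k x\<bar> \<le> m k" by blast
  define M where "M = (\<Sum>k\<in>UNIV. m k)"
  have m0: "0 \<le> m k" for k using m by (meson abs_ge_zero order_trans)
  have M: "\<bar>g k x\<bar> \<le> M" for k x
  proof -
    have "m k \<le> M" unfolding M_def using m0 by (intro member_le_sum) auto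
    then show ?thesis using m by (meson order_trans)
  qed
  have M0: "0 \<le> M" unfolding M_def using m0 by (intro sum_nonneg) auto
  have repr: "\<exists>h. (\<forall>x t. h (vec_upd x k t) = h x) \<and> (AE x in unif_cube. f x = h x + line_integral (g k) k x)" for k
    by (rule weak_partial_line[OF f g fg])
  have line: "AE x in unif_cube. AE t in unif_interval. f x - f (vec_upd x k t)
      = line_integral (g k) k x - line_integral (g k) k (vec_upd x k t)" for k
  proof -
    from repr obtain h where h: "\<And>x t. h (vec_upd x k t) = h x" "AE x in unif_cube. f x = h x + line_integral (g k) k x"
      by blast
    from AE_vec_updD[OF h(2), of k] h(2) show ?thesis
    proof eventually_elim
      case (elim x)
      from elim(1) show ?case by (rule eventually_mono) (simp add: elim(2) h(1))
    qed
  qed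
  \<comment> \<open>One summand \<open>M\<close> per coordinate, as each coordinate difference is at
    most the Euclidean distance.\<close>
  define L where "L = real CARD('n) * M"
  have L0: "L \<ge> 0" using M0 by (simp add: L_def)
  have "AE x in unif_cube. AE t in unif_interval. \<bar>f x - f (vec_upd x k t)\<bar> \<le> M * \<bar>x $ k - t\<bar>" for k
    using line[of k]
  proof eventually_elim
    case (elim x)
    then show ?case
    proof (rule eventually_mono)
      fix t assume "f x - f (vec_upd x k t) = line_integral (g k) k x - line_integral (g k) k (vec_upd x k t)"
      then show "\<bar>f x - f (vec_upd x k t)\<bar> \<le> M * \<bar>x $ k - t\<bar>"
        using line_integral_lipschitz[OF g[of k] M[of k], where k = k and x = x and b = "x $ k" and a = t]
        by simp
    qed
  qed
  from AE_lipschitz_pairs[OF _ this]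
  have "AE x in unif_cube. AE y in unif_cube. \<bar>f x - f y\<bar> \<le> (\<Sum>i\<in>UNIV. M * \<bar>x $ i - y $ i\<bar>)" by simp
  then have "AE x in unif_cube. AE y in unif_cube. \<bar>f x - f y\<bar> \<le> L * dist x y"
  proof eventually_elim
    case (elim x)
    then show ?case
    proof (rule eventually_mono)
      fix y assume "\<bar>f x - f y\<bar> \<le> (\<Sum>i\<in>UNIV. M * \<bar>x $ i - y $ i\<bar>)"
      also have "\<dots> \<le> (\<Sum>i\<in>(UNIV :: 'n set). M * dist x y)"
        using M0 by (intro sum_mono mult_left_mono) (auto simp: dist_norm component_le_norm_cart[of "x - y", simplified])
      also have "\<dots> = L * dist x y" by (simp add: L_def)
      finally show "\<bar>f x - f y\<bar> \<le> L * dist x y" .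
    qed
  qed
  from AE_lipschitz_extend[OF L0 this] obtain F where F: "L-lipschitz_on cube F" "AE x in unif_cube. f x = F x"
    by blast
  have cont: "continuous_on cube F" using F(1) by (rule lipschitz_on_continuous_on)
  have "line_deriv F k (g k)" for k
    unfolding line_deriv_def
  proof (intro conjI g)
    from AE_vec_updD[OF F(2), of k] F(2) line[of k] AE_in_cube
    show "AE x in unif_cube. \<forall>a\<in>{-1..1}. \<forall>b\<in>{-1..1}. a \<le> b \<longrightarrow>
      F (vec_upd x k b) - F (vec_upd x k a)
        = 2 * (\<integral>s. (if a < s \<and> s \<le> b then g k (vec_upd x k s) else 0) \<partial>unif_interval)"
    proof eventually_elim
      case (elim x)
      \<comment> \<open>Both sides are continuous in \<open>t\<close>, so on such a line the
        identity holds for every \<open>t\<close>, not only for almost every one.\<close>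
      have eq: "F (vec_upd x k t) = F x + line_integral (g k) k (vec_upd x k t) - line_integral (g k) k x"
        if t: "t \<in> {-1..1}" for t
      proof (rule AE_unif_interval_eq[OF _ _ _ t])
        from elim(1,3) show "AE t in unif_interval. F (vec_upd x k t)
            = F x + line_integral (g k) k (vec_upd x k t) - line_integral (g k) k x"
          by eventually_elim (use elim(2) in linarith)
        show "continuous_on {-1..1} (\<lambda>t. F (vec_upd x k t))"
          by (rule continuous_on_vec_upd[OF cont elim(4)])
        have "M-lipschitz_on {-1..1} (\<lambda>t. line_integral (g k) k (vec_upd x k t))"
          using M0 by (intro lipschitz_onI) (auto simp: dist_real_def intro: line_integral_lipschitz[OF g M])
        then show "continuous_on {-1..1} (\<lambda>t. F x + line_integral (g k) k (vec_upd x k t) - line_integral (g k) k x)"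
          by (intro continuous_intros lipschitz_on_continuous_on)
      qed
      show ?case
      proof (intro ballI impI)
        fix a b :: real assume "a \<in> {-1..1}" "b \<in> {-1..1}" "a \<le> b"
        then show "F (vec_upd x k b) - F (vec_upd x k a)
            = 2 * (\<integral>s. (if a < s \<and> s \<le> b then g k (vec_upd x k s) else 0) \<partial>unif_interval)"
          using eq[of a] eq[of b] line_integral_diff[OF g[of k], where a = a and b = b and x = x and k = k] by simp
      qed
    qed
  qed
  with F show ?thesis by blast
qed

section \<open>Change of variables for triangular maps\<close>

lemma finite_measure_eqI_Ioc:
  fixes M N :: "real measure"
  assumes sets: "sets M = sets borel" "sets N = sets borel"
    and fin: "emeasure M UNIV \<noteq> \<infinity>"
    and eq: "\<And>a b. a \<le> b \<Longrightarrow> emeasure M {a<..b} = emeasure N {a<..b}"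
  shows "M = N"
proof (rule measure_eqI_generator_eq[where \<Omega> = UNIV and E = "range (\<lambda>(a, b). {a<..b::real})"
      and A = "\<lambda>n. {- real n<..real n}"])
  show "Int_stable (range (\<lambda>(a, b). {a<..b::real}))"
    by (auto simp: Int_stable_def)
  show "sets M = sigma_sets UNIV (range (\<lambda>(a, b). {a<..b}))" "sets N = sigma_sets UNIV (range (\<lambda>(a, b). {a<..b}))"
    using sets by (simp_all add: borel_sigma_sets_Ioc)
  show "(\<Union>n. {- real n<..real n}) = UNIV"
  proof (intro equalityI subsetI UNIV_I)
    fix x :: real
    obtain n where "\<bar>x\<bar> < real n" using reals_Archimedean2 by blast
    then show "x \<in> (\<Union>n. {- real n<..real n})" by (intro UN_I[of n]) auto
  qed
next
  fix X assume "X \<in> range (\<lambda>(a, b). {a<..b::real})"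
  then obtain a b where X: "X = {a<..b}" by auto
  show "emeasure M X = emeasure N X"
    unfolding X by (cases "a \<le> b") (auto simp: eq)
next
  fix n
  have "emeasure M {- real n<..real n} \<le> emeasure M UNIV" using sets by (intro emeasure_mono) auto
  then show "emeasure M {- real n<..real n} \<noteq> \<infinity>" using fin by (auto simp: top_unique)
qed auto

text \<open>Extends functions on [-1, 1] to the line by constants, since measures are compared on
  all half-open intervals of the line.\<close>

definition clip :: "real \<Rightarrow> real" where "clip t = max (- 1) (min 1 t)"

lemma clip_in: "clip t \<in> {-1..1}" and clip_id: "t \<in> {-1..1} \<Longrightarrow> clip t = t" and clip_mono: "a \<le> b \<Longrightarrow> clip a \<le> clip b"
  by (auto simp: clip_def)

lemma continuous_on_clip: "continuous_on S clip"
  unfolding clip_def[abs_def] by (intro continuous_intros)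

lemma AE_unif_interval_in: "AE t in unif_interval. t \<in> {-1..1}"
  by (simp add: AE_unif_interval_iff)

lemma AE_unif_interval_neq: "AE t in unif_interval. t \<noteq> c"
  using AE_lborel_singleton[of c] unfolding AE_unif_interval_iff by (auto elim: eventually_mono)

lemma AE_clip_Ioc: "AE t in unif_interval. (a < t \<and> t \<le> b) \<longleftrightarrow> (clip a < t \<and> t \<le> clip b)"
  using AE_unif_interval_in AE_unif_interval_neq[of "- 1"] AE_unif_interval_neq[of 1]
  by eventually_elim (auto simp: clip_def)

lemma integral_clip_Ioc:
  assumes "bounded_borel g"
  shows "(\<integral>s. (if a < s \<and> s \<le> b then g s else 0) \<partial>unif_interval)
    = (\<integral>s. (if clip a < s \<and> s \<le> clip b then g s else 0) \<partial>unif_interval)"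
proof (rule integral_cong_AE)
  note [measurable] = bounded_borel_measurable[OF assms]
  show "(\<lambda>s. if a < s \<and> s \<le> b then g s else 0) \<in> borel_measurable unif_interval"
    "(\<lambda>s. if clip a < s \<and> s \<le> clip b then g s else 0) \<in> borel_measurable unif_interval"
    by measurable
  show "AE s in unif_interval. (if a < s \<and> s \<le> b then g s else 0) = (if clip a < s \<and> s \<le> clip b then g s else 0)"
    using AE_clip_Ioc[of a b] by (rule eventually_mono) simp
qed

lemma emeasure_density_Ioc:
  assumes g: "bounded_borel g" and nn: "\<And>s. 0 \<le> g s"
  shows "emeasure (density unif_interval (\<lambda>s. ennreal (g s))) {a<..b}
    = ennreal (\<integral>s. (if a < s \<and> s \<le> b then g s else 0) \<partial>unif_interval)"
proof -
  note [measurable] = bounded_borel_measurable[OF g]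
  have "emeasure (density unif_interval (\<lambda>s. ennreal (g s))) {a<..b}
      = (\<integral>\<^sup>+s. ennreal (if a < s \<and> s \<le> b then g s else 0) \<partial>unif_interval)"
    by (subst emeasure_density) (auto intro!: nn_integral_cong simp: indicator_def)
  also have "\<dots> = ennreal (\<integral>s. (if a < s \<and> s \<le> b then g s else 0) \<partial>unif_interval)"
    by (intro nn_integral_eq_integral bounded_borel_integrable_interval bounded_borel_cut g) (auto simp: nn)
  finally show ?thesis .
qed

lemma emeasure_density_finite:
  assumes g: "bounded_borel g"
  shows "emeasure (density unif_interval (\<lambda>s. ennreal (g s))) UNIV \<noteq> \<infinity>"
proof -
  note [measurable] = bounded_borel_measurable[OF g]
  obtain B where B: "B > 0" "\<And>x. \<bar>g x\<bar> \<le> B" using g by (rule bounded_borelE) blast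
  have "emeasure (density unif_interval (\<lambda>s. ennreal (g s))) UNIV = (\<integral>\<^sup>+s. ennreal (g s) \<partial>unif_interval)"
    by (subst emeasure_density) auto
  also have "\<dots> \<le> (\<integral>\<^sup>+s. ennreal B \<partial>unif_interval)"
    by (intro nn_integral_mono ennreal_leI order_trans[OF abs_ge_self B(2)])
  also have "\<dots> = ennreal B"
    using unif_interval.emeasure_space_1 by simp
  finally show ?thesis by (auto simp: top_unique)
qed

text \<open>The constant \<open>C\<close> makes both functions nonnegative. They are then densities
  of finite measures that agree on half-open intervals.\<close>

lemma AE_eq_interval:
  assumes g: "bounded_borel g" and g': "bounded_borel g'"
    and eq: "\<And>a b. a \<in> {-1..1} \<Longrightarrow> b \<in> {-1..1} \<Longrightarrow> a \<le> b \<Longrightarrow>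
      (\<integral>s. (if a < s \<and> s \<le> b then g s else 0) \<partial>unif_interval) = (\<integral>s. (if a < s \<and> s \<le> b then g' s else 0) \<partial>unif_interval)"
  shows "AE s in unif_interval. g s = g' s"
proof -
  note [measurable] = bounded_borel_measurable[OF g] bounded_borel_measurable[OF g']
  obtain B where B: "\<And>x. \<bar>g x\<bar> \<le> B" using g by (rule bounded_borelE) blast
  obtain B' where B': "\<And>x. \<bar>g' x\<bar> \<le> B'" using g' by (rule bounded_borelE) blast
  define C where "C = max B B'"
  have nn: "0 \<le> g s + C" "0 \<le> g' s + C" for s
    using B[of s] B'[of s] by (auto simp: C_def max_def abs_le_iff split: if_splits)
  have bb: "bounded_borel (\<lambda>s. g s + C)" "bounded_borel (\<lambda>s. g' s + C)"
    by (intro bounded_borel_add g g' bounded_borel_const)+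
  have split: "(\<integral>s. (if a < s \<and> s \<le> b then f s + C else 0) \<partial>unif_interval)
      = (\<integral>s. (if a < s \<and> s \<le> b then f s else 0) \<partial>unif_interval) + (\<integral>s. (if a < s \<and> s \<le> b then C else 0) \<partial>unif_interval)"
    if f: "bounded_borel f" for f a b
  proof -
    have "(\<lambda>s. if a < s \<and> s \<le> b then f s + C else 0)
        = (\<lambda>s. (if a < s \<and> s \<le> b then f s else 0) + (if a < s \<and> s \<le> b then C else 0))" by auto
    then show ?thesis
      by (simp only:) (intro Bochner_Integration.integral_add bounded_borel_integrable_interval bounded_borel_cut f bounded_borel_const)
  qed
  have "density unif_interval (\<lambda>s. ennreal (g s + C)) = density unif_interval (\<lambda>s. ennreal (g' s + C))"
  proof (rule finite_measure_eqI_Ioc)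
    fix a b :: real assume "a \<le> b"
    then have "(\<integral>s. (if a < s \<and> s \<le> b then g s else 0) \<partial>unif_interval) = (\<integral>s. (if a < s \<and> s \<le> b then g' s else 0) \<partial>unif_interval)"
      using eq[OF clip_in clip_in clip_mono] integral_clip_Ioc[OF g] integral_clip_Ioc[OF g'] by simp
    then show "emeasure (density unif_interval (\<lambda>s. ennreal (g s + C))) {a<..b}
        = emeasure (density unif_interval (\<lambda>s. ennreal (g' s + C))) {a<..b}"
      by (simp only: emeasure_density_Ioc[OF bb(1) nn(1)] emeasure_density_Ioc[OF bb(2) nn(2)] split[OF g] split[OF g'])
  qed (use emeasure_density_finite[OF bb(1)] in auto)
  then have "AE s in unif_interval. ennreal (g s + C) = ennreal (g' s + C)"
    by (intro sigma_finite_measure.density_unique) (auto intro: unif_interval.sigma_finite_measure_axioms)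
  then show ?thesis
    by (rule eventually_mono) (use nn in \<open>simp add: ennreal_inj\<close>)
qed

text \<open>The sum of two measures, by which an identity involving the negative part of a density
  can be stated without subtraction.\<close>

lemma emeasure_add_measure:
  fixes M N :: "'a measure"
  assumes sets: "sets N = sets M"
  shows "emeasure (measure_of (space M) (sets M) (\<lambda>A. emeasure M A + emeasure N A)) A = (if A \<in> sets M then emeasure M A + emeasure N A else 0)"
proof (cases "A \<in> sets M")
  case True
  have "emeasure (measure_of (space M) (sets M) (\<lambda>A. emeasure M A + emeasure N A)) A = emeasure M A + emeasure N A"
  proof (rule emeasure_measure_of_sigma)
    show "sigma_algebra (space M) (sets M)" ..
    show "positive (sets M) (\<lambda>A. emeasure M A + emeasure N A)" by (simp add: positive_def)
    show "countably_additive (sets M) (\<lambda>A. emeasure M A + emeasure N A)"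
      unfolding countably_additive_def
    proof (intro allI impI)
      fix F :: "nat \<Rightarrow> 'a set" assume F: "range F \<subseteq> sets M" "disjoint_family F" "\<Union>(range F) \<in> sets M"
      have "(\<Sum>i. emeasure M (F i) + emeasure N (F i)) = (\<Sum>i. emeasure M (F i)) + (\<Sum>i. emeasure N (F i))"
        by (intro suminf_add[symmetric]) auto
      then show "(\<Sum>i. emeasure M (F i) + emeasure N (F i)) = emeasure M (\<Union>(range F)) + emeasure N (\<Union>(range F))"
        using F sets by (simp add: suminf_emeasure)
    qed
  qed (rule True)
  then show ?thesis using True by simp
next
  case False
  then show ?thesis
    by (subst emeasure_notin_sets) (auto simp: sets.sigma_sets_eq)
qed

text \<open>No differentiation theorem is invoked. With \<open>p\<close> and \<open>n\<close> the
  positive and negative parts of \<open>g\<close>, the measure of density \<open>p\<close> equals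
  the measure of density \<open>n\<close> plus the Stieltjes measure of the increasing function
  \<open>u / 2\<close>, as both agree on half-open intervals. On the set where \<open>g\<close> is
  negative the left side vanishes, hence also the measure of density \<open>n\<close>.\<close>

lemma mono_line_nonneg:
  assumes g: "bounded_borel g" and cont: "continuous_on {-1..1} u" and mono: "mono_on {-1..1} u"
    and ftc: "\<And>a b. a \<in> {-1..1} \<Longrightarrow> b \<in> {-1..1} \<Longrightarrow> a \<le> b \<Longrightarrow>
      u b - u a = 2 * (\<integral>s. (if a < s \<and> s \<le> b then g s else 0) \<partial>unif_interval)"
  shows "AE s in unif_interval. 0 \<le> g s"
proof -
  note [measurable] = bounded_borel_measurable[OF g]
  obtain B where B: "B > 0" "\<And>x. \<bar>g x\<bar> \<le> B" using g by (rule bounded_borelE) blast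
  define p n where "p s = max 0 (g s)" and "n s = max 0 (- g s)" for s
  have [measurable]: "p \<in> borel_measurable borel" "n \<in> borel_measurable borel"
    unfolding p_def[abs_def] n_def[abs_def] by measurable
  have pn: "bounded_borel p" "bounded_borel n" "\<And>s. 0 \<le> p s" "\<And>s. 0 \<le> n s" "\<And>s. g s = p s - n s"
    using B by (auto intro!: bounded_borelI[where B = B]) (auto simp: p_def n_def max_def abs_le_iff)
  \<comment> \<open>Half of \<open>u\<close>, because \<open>unif_interval\<close> gives an interval
    half its length.\<close>
  define F where "F t = u (clip t) / 2" for t
  have F_mono: "F a \<le> F b" if "a \<le> b" for a b
    unfolding F_def using mono_onD[OF mono clip_in clip_in clip_mono[OF that]] by simp
  have "continuous_on UNIV F" unfolding F_def
    by (intro continuous_on_divide continuous_on_compose2[OF cont continuous_on_clip] continuous_on_const) (auto intro: clip_in)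
  then have F_cont: "continuous (at_right a) F" for a
    by (simp add: continuous_on_eq_continuous_at continuous_at_imp_continuous_at_within)
  define M where "M = density unif_interval (\<lambda>s. ennreal (n s))"
  define N where "N = measure_of (space M) (sets M) (\<lambda>A. emeasure M A + emeasure (interval_measure F) A)"
  have sM: "sets M = sets borel" "space M = UNIV" by (simp_all add: M_def)
  have N: "emeasure N A = emeasure M A + emeasure (interval_measure F) A" if "A \<in> sets borel" for A
    unfolding N_def using that by (subst emeasure_add_measure) (auto simp: sM)
  have "density unif_interval (\<lambda>s. ennreal (p s)) = N"
  proof (rule finite_measure_eqI_Ioc)
    show "sets N = sets borel" unfolding N_def by (simp add: sM sets.sigma_sets_eq[of borel, simplified])
    fix a b :: real assume ab: "a \<le> b"
    have "(\<integral>s. (if a < s \<and> s \<le> b then g s else 0) \<partial>unif_interval)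
        = (\<integral>s. (if a < s \<and> s \<le> b then p s else 0) \<partial>unif_interval) - (\<integral>s. (if a < s \<and> s \<le> b then n s else 0) \<partial>unif_interval)"
      by (subst Bochner_Integration.integral_diff[symmetric])
        (auto intro!: bounded_borel_integrable_interval bounded_borel_cut pn Bochner_Integration.integral_cong simp: pn(5))
    moreover have "2 * (\<integral>s. (if a < s \<and> s \<le> b then g s else 0) \<partial>unif_interval) = u (clip b) - u (clip a)"
      using ftc[OF clip_in clip_in clip_mono[OF ab]] integral_clip_Ioc[OF g] by simp
    ultimately have *: "(\<integral>s. (if a < s \<and> s \<le> b then p s else 0) \<partial>unif_interval)
        = (\<integral>s. (if a < s \<and> s \<le> b then n s else 0) \<partial>unif_interval) + (F b - F a)"
      by (simp add: F_def field_simps)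
    have "0 \<le> (\<integral>s. (if a < s \<and> s \<le> b then n s else 0) \<partial>unif_interval)"
      by (intro Bochner_Integration.integral_nonneg) (simp add: pn)
    then show "emeasure (density unif_interval (\<lambda>s. ennreal (p s))) {a<..b} = emeasure N {a<..b}"
      using F_mono[OF ab] unfolding M_def
      by (simp add: N M_def emeasure_density_Ioc pn emeasure_interval_measure_Ioc[OF ab F_mono F_cont] * ennreal_plus)
  qed (use emeasure_density_finite[OF pn(1)] in auto)
  then have "emeasure N {s. g s < 0} = emeasure (density unif_interval (\<lambda>s. ennreal (p s))) {s. g s < 0}" by simp
  also have "\<dots> = (\<integral>\<^sup>+s. ennreal (p s) * indicator {s. g s < 0} s \<partial>unif_interval)"
    by (subst emeasure_density) auto
  also have "(\<lambda>s. ennreal (p s) * indicator {s. g s < 0} s) = (\<lambda>s. 0)"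
    by (auto simp: p_def indicator_def fun_eq_iff ennreal_neg)
  finally have "emeasure M {s. g s < 0} = 0" by (simp add: N)
  then have "(\<integral>\<^sup>+s. ennreal (n s) * indicator {s. g s < 0} s \<partial>unif_interval) = 0"
    unfolding M_def using pn(2) by (subst (asm) emeasure_density) (auto simp: bounded_borel_measurable)
  then have "AE s in unif_interval. ennreal (n s) * indicator {s. g s < 0} s = 0"
    using bounded_borel_measurable[OF pn(2)] by (subst (asm) nn_integral_0_iff_AE) auto
  then show ?thesis
    by (rule eventually_mono) (auto simp: n_def indicator_def ennreal_eq_0_iff split: if_splits)
qed

text \<open>The image under \<open>u\<close> of the measure with density \<open>g\<close> is the
  uniform measure restricted to the range of \<open>u\<close>. Both are compared on rays
  \<open>{c<..}\<close>, whose preimages are intervals by monotonicity. Flat pieces of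
  \<open>u\<close> do no harm, since the increment and hence the mass is zero there.\<close>

lemma mono_line_substitution:
  fixes h :: "real \<Rightarrow> ennreal"
  assumes g: "bounded_borel g" and cont: "continuous_on {-1..1} u" and mono: "mono_on {-1..1} u"
    and ftc: "\<And>a b. a \<in> {-1..1} \<Longrightarrow> b \<in> {-1..1} \<Longrightarrow> a \<le> b \<Longrightarrow>
      u b - u a = 2 * (\<integral>s. (if a < s \<and> s \<le> b then g s else 0) \<partial>unif_interval)"
    and range: "\<And>t. t \<in> {-1..1} \<Longrightarrow> u t \<in> {-1..1}" and h [measurable]: "h \<in> borel_measurable borel"
  shows "(\<integral>\<^sup>+t. h (u t) * ennreal (g t) \<partial>unif_interval) = (\<integral>\<^sup>+y. h y * indicator {u (- 1)..u 1} y \<partial>unif_interval)"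
proof -
  note [measurable] = bounded_borel_measurable[OF g]
  define u' where "u' t = u (clip t)" for t
  have u'_eq: "u' t = u t" if "t \<in> {-1..1}" for t using that by (simp add: u'_def clip_id)
  have "continuous_on UNIV u'" unfolding u'_def
    by (intro continuous_on_compose2[OF cont continuous_on_clip]) (auto intro: clip_in)
  then have [measurable]: "u' \<in> borel_measurable borel" by (rule borel_measurable_continuous_onI)
  define p where "p s = max 0 (g s)" for s
  have [measurable]: "p \<in> borel_measurable borel" unfolding p_def[abs_def] by measurable
  obtain B where B: "B > 0" "\<And>x. \<bar>g x\<bar> \<le> B" using g by (rule bounded_borelE) blast
  have p: "bounded_borel p" "0 \<le> p s" for s
    using B by (auto intro!: bounded_borelI[where B = B]) (auto simp: p_def max_def abs_le_iff)
  note [measurable] = bounded_borel_measurable[OF p(1)]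
  have gp: "AE s in unif_interval. p s = g s"
    using mono_line_nonneg[OF g cont mono ftc] by (rule eventually_mono) (simp_all add: p_def)
  have cut: "(\<integral>s. (if a < s \<and> s \<le> b then p s else 0) \<partial>unif_interval) = (\<integral>s. (if a < s \<and> s \<le> b then g s else 0) \<partial>unif_interval)" for a b
    by (rule integral_cong_AE) (use gp in \<open>auto elim!: eventually_mono\<close>)
  have m: "u (- 1) \<le> u 1" using mono by (auto simp: mono_on_def)
  let ?M = "distr (density unif_interval (\<lambda>s. ennreal (p s))) borel u'"
  let ?N = "density unif_interval (indicator {u (- 1)..u 1})"
  have Neq: "emeasure ?N {c<..} = emeasure lborel ({-1..1} \<inter> ({u (- 1)..u 1} \<inter> {c<..})) / 2" for c
    by (simp add: emeasure_restricted emeasure_unif_interval)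
  have r: "- 1 \<le> u (- 1)" "u 1 \<le> 1" using range[of "- 1"] range[of 1] by auto
  have "?M = ?N"
  proof (rule measure_eqI_lessThan)
    fix c
    have Mc: "emeasure ?M {c<..} = emeasure (density unif_interval (\<lambda>s. ennreal (p s))) {t. c < u' t}"
      by (subst emeasure_distr) (auto intro!: arg_cong2[where f = emeasure])
    have "emeasure ?M {c<..} \<le> emeasure (density unif_interval (\<lambda>s. ennreal (p s))) UNIV"
      unfolding Mc by (intro emeasure_mono) auto
    then show "emeasure ?M {c<..} < \<infinity>"
      using emeasure_density_finite[OF p(1)] by (auto simp: less_top[symmetric] top_unique)
    \<comment> \<open>The point -1 is excluded so that \<open>t0 = - 1\<close> also covers the case
      in which all values of \<open>u\<close> lie above \<open>c\<close>; a single point has no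
      mass.\<close>
    have key: "emeasure (density unif_interval (\<lambda>s. ennreal (p s))) {t. c < u' t} = ennreal ((u 1 - u t0) / 2)"
      if t0: "t0 \<in> {-1..1}" and set: "\<And>t. t \<in> {-1..1} \<Longrightarrow> t \<noteq> -1 \<Longrightarrow> c < u t \<longleftrightarrow> t0 < t" for t0
    proof -
      have "emeasure (density unif_interval (\<lambda>s. ennreal (p s))) {t. c < u' t}
          = (\<integral>\<^sup>+s. ennreal (p s) * indicator {t. c < u' t} s \<partial>unif_interval)"
        by (subst emeasure_density) auto
      also have "\<dots> = (\<integral>\<^sup>+s. ennreal (p s) * indicator {t0<..1} s \<partial>unif_interval)"
      proof (rule nn_integral_cong_AE)
        show "AE s in unif_interval. ennreal (p s) * indicator {t. c < u' t} s = ennreal (p s) * indicator {t0<..1} s"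
          using AE_unif_interval_in AE_unif_interval_neq[of "- 1"]
          by eventually_elim (use set u'_eq in \<open>auto simp: indicator_def\<close>)
      qed
      also have "\<dots> = emeasure (density unif_interval (\<lambda>s. ennreal (p s))) {t0<..1}"
        by (subst emeasure_density) auto
      also have "\<dots> = ennreal ((u 1 - u t0) / 2)"
        using ftc[OF t0, of 1] t0 by (simp add: emeasure_density_Ioc[OF p] cut)
      finally show ?thesis .
    qed
    consider "u 1 \<le> c" | "c < u (- 1)" | "u (- 1) \<le> c" "c < u 1" by linarith
    then show "emeasure ?M {c<..} = emeasure ?N {c<..}"
    proof cases
      case 1
      have "\<not> c < u t" if "t \<in> {-1..1}" for t
        using mono_onD[OF mono, of t 1] that 1 by auto
      then have "emeasure (density unif_interval (\<lambda>s. ennreal (p s))) {t. c < u' t} = ennreal ((u 1 - u 1) / 2)"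
        by (intro key) auto
      moreover have "{-1..1} \<inter> ({u (- 1)..u 1} \<inter> {c<..}) = {}" using 1 by auto
      ultimately show ?thesis unfolding Mc Neq by simp
    next
      case 2
      have "c < u t" if "t \<in> {-1..1}" for t
        using mono_onD[OF mono, of "- 1" t] that 2 by auto
      then have "emeasure (density unif_interval (\<lambda>s. ennreal (p s))) {t. c < u' t} = ennreal ((u 1 - u (- 1)) / 2)"
        by (intro key) auto
      moreover have "{-1..1} \<inter> ({u (- 1)..u 1} \<inter> {c<..}) = {u (- 1)..u 1}" using 2 r by auto
      ultimately show ?thesis unfolding Mc Neq using m by (simp add: divide_ennreal[symmetric])
    next
      case 3
      \<comment> \<open>Its largest element \<open>t0\<close> is the last point at which
        \<open>u\<close> is at most \<open>c\<close>. By the intermediate value theorem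
        \<open>u\<close> equals \<open>c\<close> there, also when \<open>u\<close> is flat at that
        level.\<close>
      define K where "K = {t\<in>{-1..1}. u t \<le> c}"
      have "K = {-1..1} \<inter> u -` {..c}" by (auto simp: K_def)
      then have "closed K"
        using continuous_closed_preimage[OF cont closed_atLeastAtMost closed_atMost] by simp
      moreover have "bounded K" by (rule bounded_subset[of "{-1..1}"]) (auto simp: K_def)
      ultimately have "compact K" by (simp add: compact_eq_bounded_closed)
      moreover have "- 1 \<in> K" using 3 by (simp add: K_def)
      ultimately obtain t0 where t0: "t0 \<in> K" "\<And>t. t \<in> K \<Longrightarrow> t \<le> t0"
        using compact_attains_sup[of K] by blast
      obtain t1 where t1: "- 1 \<le> t1" "t1 \<le> 1" "u t1 = c"
        using IVT'[of u "- 1" c 1] cont 3 by auto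
      then have "t1 \<le> t0" using t0(2)[of t1] by (simp add: K_def)
      then have "c \<le> u t0" using mono_onD[OF mono, of t1 t0] t1 t0(1) by (auto simp: K_def)
      then have ut0: "u t0 = c" using t0(1) by (simp add: K_def)
      have "c < u t \<longleftrightarrow> t0 < t" if t: "t \<in> {-1..1}" for t
      proof
        assume "c < u t"
        show "t0 < t"
        proof (rule ccontr)
          assume "\<not> t0 < t"
          then have "u t \<le> u t0" using mono_onD[OF mono, of t t0] t t0(1) by (auto simp: K_def)
          then show False using ut0 \<open>c < u t\<close> by simp
        qed
      next
        assume "t0 < t"
        then have "t \<notin> K" using t0(2)[of t] by auto
        then show "c < u t" using t by (auto simp: K_def)
      qed
      then have "emeasure (density unif_interval (\<lambda>s. ennreal (p s))) {t. c < u' t} = ennreal ((u 1 - u t0) / 2)"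
        using t0(1) by (intro key) (auto simp: K_def)
      moreover have "{-1..1} \<inter> ({u (- 1)..u 1} \<inter> {c<..}) = {c<..u 1}" using 3 r by auto
      ultimately show ?thesis unfolding Mc Neq using 3 by (simp add: divide_ennreal[symmetric] ut0)
    qed
  qed auto
  then have "(\<integral>\<^sup>+y. h y \<partial>?M) = (\<integral>\<^sup>+y. h y \<partial>?N)" by simp
  moreover have "(\<integral>\<^sup>+y. h y \<partial>?M) = (\<integral>\<^sup>+t. ennreal (p t) * h (u' t) \<partial>unif_interval)"
    by (simp add: nn_integral_distr nn_integral_density)
  moreover have "(\<integral>\<^sup>+t. ennreal (p t) * h (u' t) \<partial>unif_interval) = (\<integral>\<^sup>+t. h (u t) * ennreal (g t) \<partial>unif_interval)"
    using gp AE_unif_interval_in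
    by (intro nn_integral_cong_AE, eventually_elim) (simp add: u'_eq mult.commute)
  moreover have "(\<integral>\<^sup>+y. h y \<partial>?N) = (\<integral>\<^sup>+y. h y * indicator {u (- 1)..u 1} y \<partial>unif_interval)"
    by (subst nn_integral_density) (auto simp: mult.commute)
  ultimately show ?thesis by simp
qed

section \<open>Triangular monotone maps\<close>

lemma coord_monotone_upd:
  "coord_monotone U \<longleftrightarrow> (\<forall>j. \<forall>x\<in>cube. mono_on {-1..1} (\<lambda>t. U (vec_upd x j t) $ j))"
  by (simp add: coord_monotone_def vec_upd_def)

lemma triangularD:
  "triangular U \<Longrightarrow> x \<in> cube \<Longrightarrow> y \<in> cube \<Longrightarrow> (\<And>k. k \<le> j \<Longrightarrow> x $ k = y $ k) \<Longrightarrow> U x $ j = U y $ j"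
  unfolding triangular_def by blast

lemma mix_in_cube: "x \<in> cube \<Longrightarrow> y \<in> cube \<Longrightarrow> mix A y x \<in> cube"
  by (auto simp: mem_cube_iff)

text \<open>The partial Jacobian of a triangular map, restricted to the coordinates in
  \<open>B\<close>; values in \<open>ennreal\<close> allow it to be used as a density.\<close>

definition prod_ind :: "('n \<Rightarrow> real ^ 'n \<Rightarrow> real) \<Rightarrow> 'n::finite set \<Rightarrow> real ^ 'n \<Rightarrow> ennreal" where
  "prod_ind J B x = (\<Prod>k\<in>B. ennreal (J k x))"

text \<open>Differentiability of \<open>U\<close> is expressed only by the fundamental theorem on
  almost all lines. Injectivity is left open, because the change of variables serves to prove it for
  the Lipschitz representatives.\<close>

locale tri_map =
  fixes U :: "(real, 'n::{finite,linorder}) vec \<Rightarrow> (real, 'n) vec"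
    and J :: "'n \<Rightarrow> (real, 'n) vec \<Rightarrow> real"
  assumes U_measurable [measurable]: "U \<in> borel_measurable borel"
    and U_cube: "\<And>x. x \<in> cube \<Longrightarrow> U x \<in> cube"
    and U_cont: "continuous_on cube U"
    and U_tri: "triangular U"
    and U_mono: "coord_monotone U"
    and U_line: "\<And>j. line_deriv (\<lambda>x. U x $ j) j (J j)"
begin

lemma J_bounded_borel: "bounded_borel (J j)"
  using U_line by (simp add: line_deriv_def)

lemma J_measurable [measurable]: "J j \<in> borel_measurable borel"
  by (rule bounded_borel_measurable[OF J_bounded_borel])

lemma prod_ind_measurable [measurable]: "prod_ind J B \<in> borel_measurable borel"
  unfolding prod_ind_def[abs_def] by measurable

lemma ftc: "AE x in unif_cube. \<forall>a\<in>{-1..1}. \<forall>b\<in>{-1..1}. a \<le> b \<longrightarrow>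
    U (vec_upd x j b) $ j - U (vec_upd x j a) $ j
      = 2 * (\<integral>s. (if a < s \<and> s \<le> b then J j (vec_upd x j s) else 0) \<partial>unif_interval)"
  using U_line[of j] by (simp add: line_deriv_def)

lemma line_cont: "x \<in> cube \<Longrightarrow> continuous_on {-1..1} (\<lambda>t. U (vec_upd x j t) $ j)"
  by (rule continuous_on_component[OF continuous_on_vec_upd[OF U_cont]])

lemma line_mono: "x \<in> cube \<Longrightarrow> mono_on {-1..1} (\<lambda>t. U (vec_upd x j t) $ j)"
  using U_mono unfolding coord_monotone_upd by blast

lemma line_range: "x \<in> cube \<Longrightarrow> t \<in> {-1..1} \<Longrightarrow> U (vec_upd x j t) $ i \<in> {-1..1}"
  using U_cube[OF vec_upd_in_cube] unfolding mem_cube_iff by blast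

lemma tri_upd:
  assumes "x \<in> cube" "t \<in> {-1..1}" "i < m"
  shows "U (vec_upd x m t) $ i = U x $ i"
  using assms by (intro triangularD[OF U_tri] vec_upd_in_cube) auto

lemma line_subst:
  fixes h :: "(real, 'n) vec \<Rightarrow> real \<Rightarrow> ennreal"
  assumes h: "\<And>x. h x \<in> borel_measurable borel"
  shows "AE x in unif_cube. (\<integral>\<^sup>+t. h x (U (vec_upd x j t) $ j) * ennreal (J j (vec_upd x j t)) \<partial>unif_interval)
    = (\<integral>\<^sup>+y. h x y * indicator {U (vec_upd x j (- 1)) $ j..U (vec_upd x j 1) $ j} y \<partial>unif_interval)"
  using ftc[of j] AE_in_cube
proof eventually_elim
  case (elim x)
  show ?case
    by (rule mono_line_substitution)
      (use elim h in \<open>auto intro!: bounded_borel_vec_upd J_bounded_borel line_cont line_mono line_range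
        simp del: atLeastAtMost_iff\<close>)
qed

lemma J_nonneg: "AE x in unif_cube. 0 \<le> J j x"
proof -
  have "AE x in unif_cube. AE t in unif_interval. 0 \<le> J j (vec_upd x j t)"
    using ftc[of j] AE_in_cube
  proof eventually_elim
    case (elim x)
    show ?case
      by (rule mono_line_nonneg[where u = "\<lambda>t. U (vec_upd x j t) $ j"])
        (use elim in \<open>auto intro!: bounded_borel_vec_upd J_bounded_borel line_cont line_mono
          simp del: atLeastAtMost_iff\<close>)
  qed
  then show ?thesis by (subst (asm) AE_vec_upd_iff) auto
qed

text \<open>\<open>U x $ i\<close> does not react to the later coordinate \<open>m\<close>, so
  neither do its increments in direction \<open>i\<close>. These are, up to the factor 2, the
  integrals of \<open>J i\<close> over all subintervals, which determine \<open>J i\<close> almost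
  everywhere on the line.\<close>

lemma J_indep:
  assumes "i < m"
  shows "AE x in unif_cube. AE t in unif_interval. J i (vec_upd x m t) = J i x"
proof -
  have "AE x in unif_cube. AE t in unif_interval. AE s in unif_interval.
      J i (vec_upd (vec_upd x m t) i s) = J i (vec_upd x i s)"
    using AE_vec_updD[OF ftc[of i], of m] ftc[of i] AE_in_cube
  proof eventually_elim
    case (elim x)
    from elim(1) AE_unif_interval_in show ?case
    proof eventually_elim
      case (elim t)
      note 1 = elim(1) and 2 = \<open>\<forall>a\<in>{-1..1}. \<forall>b\<in>{-1..1}. a \<le> b \<longrightarrow>
        U (vec_upd x i b) $ i - U (vec_upd x i a) $ i
        = 2 * (\<integral>s. (if a < s \<and> s \<le> b then J i (vec_upd x i s) else 0) \<partial>unif_interval)\<close>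
      show ?case
      proof (rule AE_eq_interval)
        fix a b :: real assume ab: "a \<in> {-1..1}" "b \<in> {-1..1}" "a \<le> b"
        have "U (vec_upd (vec_upd x m t) i c) $ i = U (vec_upd x i c) $ i" if c: "c \<in> {-1..1}" for c
        proof -
          have "vec_upd (vec_upd x m t) i c = vec_upd (vec_upd x i c) m t"
            using assms by (intro vec_upd_commute) auto
          then show ?thesis using c \<open>x \<in> cube\<close> elim(2) assms by (simp add: tri_upd vec_upd_in_cube)
        qed
        with 1 2 ab show "(\<integral>s. (if a < s \<and> s \<le> b then J i (vec_upd (vec_upd x m t) i s) else 0) \<partial>unif_interval)
            = (\<integral>s. (if a < s \<and> s \<le> b then J i (vec_upd x i s) else 0) \<partial>unif_interval)"
          by auto
      qed (intro bounded_borel_vec_upd J_bounded_borel)+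
    qed
  qed
  \<comment> \<open>The two inner quantifiers are exchanged so that the coordinate \<open>i\<close>,
    so far replaced by \<open>s\<close>, can be merged back into \<open>x\<close>.\<close>
  then have "AE x in unif_cube. AE s in unif_interval. AE t in unif_interval.
      J i (vec_upd (vec_upd x i s) m t) = J i (vec_upd x i s)"
  proof (rule eventually_mono)
    interpret P: pair_sigma_finite unif_interval unif_interval ..
    fix x :: "(real, 'n) vec"
    assume "AE t in unif_interval. AE s in unif_interval. J i (vec_upd (vec_upd x m t) i s) = J i (vec_upd x i s)"
    then have "AE s in unif_interval. AE t in unif_interval. J i (vec_upd (vec_upd x m t) i s) = J i (vec_upd x i s)"
      by (subst P.AE_commute, intro predE, measurable)
    then show "AE s in unif_interval. AE t in unif_interval. J i (vec_upd (vec_upd x i s) m t) = J i (vec_upd x i s)"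
      using assms by (simp add: vec_upd_commute[of i m])
  qed
  then show ?thesis
    by (subst (asm) AE_vec_upd_iff[where P = "\<lambda>x. AE t in unif_interval. J i (vec_upd x m t) = J i x"])
      (auto intro!: measurable_AE_unif_interval)
qed

lemma prod_ind_indep:
  assumes "\<And>k. k \<in> B \<Longrightarrow> k < m"
  shows "AE x in unif_cube. AE t in unif_interval. prod_ind J B (vec_upd x m t) = prod_ind J B x"
proof -
  have "AE x in unif_cube. \<forall>k\<in>B. AE t in unif_interval. J k (vec_upd x m t) = J k x"
    using J_indep[OF assms] by (subst AE_finite_all) auto
  then show ?thesis
  proof (rule eventually_mono)
    fix x assume "\<forall>k\<in>B. AE t in unif_interval. J k (vec_upd x m t) = J k x"
    then have "AE t in unif_interval. \<forall>k\<in>B. J k (vec_upd x m t) = J k x"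
      by (subst AE_finite_all) auto
    then show "AE t in unif_interval. prod_ind J B (vec_upd x m t) = prod_ind J B x"
      by (rule eventually_mono) (simp add: prod_ind_def)
  qed
qed

text \<open>Coordinates are substituted one at a time, the largest last, so that on a line in direction \<open>m\<close> the
  coordinates of \<open>U\<close> already substituted are constant.\<close>

lemma cov_step:
  assumes B: "\<And>k. k \<in> B \<Longrightarrow> k < m" and [measurable]: "h \<in> borel_measurable borel"
  shows "(\<integral>\<^sup>+x. h (mix (insert m B) (U x) x) * prod_ind J (insert m B) x \<partial>unif_cube)
    = (\<integral>\<^sup>+x. h (mix B (U x) x) * prod_ind J B x
        * indicator {U (vec_upd x m (- 1)) $ m..U (vec_upd x m 1) $ m} (x $ m) \<partial>unif_cube)"
proof -
  have mB: "m \<notin> B" using B by blast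
  have [measurable]: "(\<lambda>x. indicator {U (vec_upd x m (- 1)) $ m..U (vec_upd x m 1) $ m} (x $ m) :: ennreal) \<in> borel_measurable borel"
  proof -
    have "(\<lambda>x. indicator {U (vec_upd x m (- 1)) $ m..U (vec_upd x m 1) $ m} (x $ m) :: ennreal)
        = (\<lambda>x. if U (vec_upd x m (- 1)) $ m \<le> x $ m \<and> x $ m \<le> U (vec_upd x m 1) $ m then 1 else 0)"
      by (auto simp: fun_eq_iff)
    then show ?thesis by simp
  qed
  have "(\<integral>\<^sup>+x. h (mix (insert m B) (U x) x) * prod_ind J (insert m B) x \<partial>unif_cube)
      = (\<integral>\<^sup>+x. \<integral>\<^sup>+t. h (mix (insert m B) (U (vec_upd x m t)) (vec_upd x m t)) * prod_ind J (insert m B) (vec_upd x m t)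
          \<partial>unif_interval \<partial>unif_cube)"
    by (rule nn_integral_vec_upd) measurable
  also have "\<dots> = (\<integral>\<^sup>+x. \<integral>\<^sup>+t. h (mix B (U (vec_upd x m t)) (vec_upd x m t)) * prod_ind J B (vec_upd x m t)
        * indicator {U (vec_upd (vec_upd x m t) m (- 1)) $ m..U (vec_upd (vec_upd x m t) m 1) $ m} (vec_upd x m t $ m)
          \<partial>unif_interval \<partial>unif_cube)"
  proof (rule nn_integral_cong_AE)
    have "AE x in unif_cube. (\<integral>\<^sup>+t. h (vec_upd (mix B (U x) x) m (U (vec_upd x m t) $ m)) * ennreal (J m (vec_upd x m t)) \<partial>unif_interval)
      = (\<integral>\<^sup>+y. h (vec_upd (mix B (U x) x) m y) * indicator {U (vec_upd x m (- 1)) $ m..U (vec_upd x m 1) $ m} y \<partial>unif_interval)"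
      by (rule line_subst[where h = "\<lambda>x y. h (vec_upd (mix B (U x) x) m y)"]) auto
    moreover have "AE x in unif_cube. AE t in unif_interval. prod_ind J B (vec_upd x m t) = prod_ind J B x"
      using B by (rule prod_ind_indep)
    moreover note AE_in_cube
    ultimately
    show "AE x in unif_cube.
      (\<integral>\<^sup>+t. h (mix (insert m B) (U (vec_upd x m t)) (vec_upd x m t)) * prod_ind J (insert m B) (vec_upd x m t) \<partial>unif_interval)
      = (\<integral>\<^sup>+t. h (mix B (U (vec_upd x m t)) (vec_upd x m t)) * prod_ind J B (vec_upd x m t)
        * indicator {U (vec_upd (vec_upd x m t) m (- 1)) $ m..U (vec_upd (vec_upd x m t) m 1) $ m} (vec_upd x m t $ m)
          \<partial>unif_interval)"
    proof eventually_elim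
      case elim': (elim x)
      note elim = elim'(2,3,1)
      have mixB: "mix B (U (vec_upd x m t)) (vec_upd x m t) = vec_upd (mix B (U x) x) m t"
        "mix (insert m B) (U (vec_upd x m t)) (vec_upd x m t) = vec_upd (mix B (U x) x) m (U (vec_upd x m t) $ m)"
        if t: "t \<in> {-1..1}" for t
        using mB B tri_upd[OF elim(2) t] by (auto simp: vec_eq_iff)
      have "(\<integral>\<^sup>+t. h (mix (insert m B) (U (vec_upd x m t)) (vec_upd x m t)) * prod_ind J (insert m B) (vec_upd x m t) \<partial>unif_interval)
          = (\<integral>\<^sup>+t. prod_ind J B x * (h (vec_upd (mix B (U x) x) m (U (vec_upd x m t) $ m)) * ennreal (J m (vec_upd x m t))) \<partial>unif_interval)"
      proof (rule nn_integral_cong_AE)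
        show "AE t in unif_interval. h (mix (insert m B) (U (vec_upd x m t)) (vec_upd x m t)) * prod_ind J (insert m B) (vec_upd x m t)
          = prod_ind J B x * (h (vec_upd (mix B (U x) x) m (U (vec_upd x m t) $ m)) * ennreal (J m (vec_upd x m t)))"
          using elim(1) AE_unif_interval_in
        proof eventually_elim
          case (elim t)
          have "prod_ind J (insert m B) (vec_upd x m t) = ennreal (J m (vec_upd x m t)) * prod_ind J B (vec_upd x m t)"
            using mB unfolding prod_ind_def by simp
          with elim show ?case by (simp add: mixB mult_ac)
        qed
      qed
      also have "\<dots> = prod_ind J B x * (\<integral>\<^sup>+y. h (vec_upd (mix B (U x) x) m y)
          * indicator {U (vec_upd x m (- 1)) $ m..U (vec_upd x m 1) $ m} y \<partial>unif_interval)"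
        by (subst nn_integral_cmult) (auto simp: elim(3))
      also have "\<dots> = (\<integral>\<^sup>+t. prod_ind J B x * (h (vec_upd (mix B (U x) x) m t)
          * indicator {U (vec_upd x m (- 1)) $ m..U (vec_upd x m 1) $ m} t) \<partial>unif_interval)"
        by (subst nn_integral_cmult) auto
      also have "\<dots> = (\<integral>\<^sup>+t. h (mix B (U (vec_upd x m t)) (vec_upd x m t)) * prod_ind J B (vec_upd x m t)
        * indicator {U (vec_upd (vec_upd x m t) m (- 1)) $ m..U (vec_upd (vec_upd x m t) m 1) $ m} (vec_upd x m t $ m)
          \<partial>unif_interval)"
      proof (rule nn_integral_cong_AE)
        show "AE t in unif_interval. prod_ind J B x * (h (vec_upd (mix B (U x) x) m t)
          * indicator {U (vec_upd x m (- 1)) $ m..U (vec_upd x m 1) $ m} t)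
          = h (mix B (U (vec_upd x m t)) (vec_upd x m t)) * prod_ind J B (vec_upd x m t)
        * indicator {U (vec_upd (vec_upd x m t) m (- 1)) $ m..U (vec_upd (vec_upd x m t) m 1) $ m} (vec_upd x m t $ m)"
          using elim(1) AE_unif_interval_in
          by eventually_elim (simp add: mixB mult_ac)
      qed
      finally show ?case .
    qed
  qed
  also have "\<dots> = (\<integral>\<^sup>+x. h (mix B (U x) x) * prod_ind J B x
        * indicator {U (vec_upd x m (- 1)) $ m..U (vec_upd x m 1) $ m} (x $ m) \<partial>unif_cube)"
    by (rule nn_integral_vec_upd[symmetric]) measurable
  finally show ?thesis .
qed

text \<open>Each substitution loses only the part of the line outside the range of the component, so
  an inequality is available for maps that are not known to be onto.\<close>

lemma cov_le:
  assumes h: "h \<in> borel_measurable borel"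
  shows "(\<integral>\<^sup>+x. h (mix B (U x) x) * prod_ind J B x \<partial>unif_cube) \<le> (\<integral>\<^sup>+x. h x \<partial>unif_cube)"
proof -
  have "finite B" by simp
  then show ?thesis
  proof (induction B rule: finite_linorder_max_induct)
    case empty
    then show ?case by (simp add: prod_ind_def)
  next
    case (insert m B)
    have "(\<integral>\<^sup>+x. h (mix (insert m B) (U x) x) * prod_ind J (insert m B) x \<partial>unif_cube)
        \<le> (\<integral>\<^sup>+x. h (mix B (U x) x) * prod_ind J B x \<partial>unif_cube)"
      using insert.hyps h by (subst cov_step) (auto intro!: nn_integral_mono simp: indicator_def)
    then show ?case using insert.IH by (rule order_trans)
  qed
qed

text \<open>If every component runs over the whole interval on each line in its own direction,
  nothing is lost in any substitution.\<close>

lemma cov_eq: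
  assumes h: "h \<in> borel_measurable borel"
    and ends: "\<And>x j. x \<in> cube \<Longrightarrow> U (vec_upd x j (- 1)) $ j = - 1" "\<And>x j. x \<in> cube \<Longrightarrow> U (vec_upd x j 1) $ j = 1"
  shows "(\<integral>\<^sup>+x. h (U x) * prod_ind J UNIV x \<partial>unif_cube) = (\<integral>\<^sup>+x. h x \<partial>unif_cube)"
proof -
  have "(\<integral>\<^sup>+x. h (mix B (U x) x) * prod_ind J B x \<partial>unif_cube) = (\<integral>\<^sup>+x. h x \<partial>unif_cube)" for B
  proof -
    have "finite B" by simp
    then show ?thesis
    proof (induction B rule: finite_linorder_max_induct)
      case empty
      then show ?case by (simp add: prod_ind_def)
    next
      case (insert m B)
      have "(\<integral>\<^sup>+x. h (mix (insert m B) (U x) x) * prod_ind J (insert m B) x \<partial>unif_cube)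
          = (\<integral>\<^sup>+x. h (mix B (U x) x) * prod_ind J B x
              * indicator {U (vec_upd x m (- 1)) $ m..U (vec_upd x m 1) $ m} (x $ m) \<partial>unif_cube)"
        using insert.hyps h by (intro cov_step) auto
      also have "\<dots> = (\<integral>\<^sup>+x. h (mix B (U x) x) * prod_ind J B x \<partial>unif_cube)"
      proof (rule nn_integral_cong_AE)
        show "AE x in unif_cube. h (mix B (U x) x) * prod_ind J B x
              * indicator {U (vec_upd x m (- 1)) $ m..U (vec_upd x m 1) $ m} (x $ m) = h (mix B (U x) x) * prod_ind J B x"
          using AE_in_cube
        proof eventually_elim
          case (elim x)
          then have "x $ m \<in> {U (vec_upd x m (- 1)) $ m..U (vec_upd x m 1) $ m}"
            unfolding ends[OF elim] by (simp add: mem_box_cart)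
          then show ?case by simp
        qed
      qed
      finally show ?case using insert.IH by simp
    qed
  qed
  from this[of UNIV] show ?thesis by simp
qed

text \<open>The factors of the Jacobian may vanish on sets of positive measure, so they cannot be
  divided out pointwise. They are integrated out instead: \<open>E\<close> is a cylinder in the
  directions of \<open>B\<close>, and the integral of \<open>J m\<close> along a line is the mass of
  the image interval, which is positive by \<open>inc\<close>.\<close>

lemma null_if_prod_ind_null:
  assumes inc: "\<And>k. k \<in> B \<Longrightarrow> AE x in unif_cube. U (vec_upd x k (- 1)) $ k < U (vec_upd x k 1) $ k"
    and [measurable]: "E \<in> sets borel"
    and indep: "\<And>k x t. k \<in> B \<Longrightarrow> x \<in> cube \<Longrightarrow> t \<in> {-1..1} \<Longrightarrow> vec_upd x k t \<in> E \<longleftrightarrow> x \<in> E"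
    and null: "(\<integral>\<^sup>+x. indicator E x * prod_ind J B x \<partial>unif_cube) = 0"
  shows "emeasure unif_cube E = 0"
proof -
  have "finite B" by simp
  then show ?thesis using inc indep null
  proof (induction B rule: finite_linorder_max_induct)
    case empty
    then show ?case by (simp add: prod_ind_def)
  next
    case (insert m B)
    have mB: "m \<notin> B" using insert.hyps by blast
    have ind: "indicator E (vec_upd x m t) = (indicator E x :: ennreal)" if "x \<in> cube" "t \<in> {-1..1}" for x t
      using insert.prems(2)[of m x t] that by (simp add: indicator_def)
    have "0 = (\<integral>\<^sup>+x. indicator E x * prod_ind J (insert m B) x \<partial>unif_cube)" using insert.prems(3) by simp
    also have "\<dots> = (\<integral>\<^sup>+x. \<integral>\<^sup>+t. indicator E (vec_upd x m t) * prod_ind J (insert m B) (vec_upd x m t) \<partial>unif_interval \<partial>unif_cube)"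
      by (rule nn_integral_vec_upd) measurable
    also have "\<dots> = (\<integral>\<^sup>+x. indicator E x * prod_ind J B x * (\<integral>\<^sup>+t. ennreal (J m (vec_upd x m t)) \<partial>unif_interval) \<partial>unif_cube)"
    proof (rule nn_integral_cong_AE)
      have "AE x in unif_cube. AE t in unif_interval. prod_ind J B (vec_upd x m t) = prod_ind J B x"
        using insert.hyps(2) by (intro prod_ind_indep) auto
      with AE_in_cube show "AE x in unif_cube. (\<integral>\<^sup>+t. indicator E (vec_upd x m t) * prod_ind J (insert m B) (vec_upd x m t) \<partial>unif_interval)
          = indicator E x * prod_ind J B x * (\<integral>\<^sup>+t. ennreal (J m (vec_upd x m t)) \<partial>unif_interval)"

      proof eventually_elim
        case (elim x)
        have "(\<integral>\<^sup>+t. indicator E (vec_upd x m t) * prod_ind J (insert m B) (vec_upd x m t) \<partial>unif_interval)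
            = (\<integral>\<^sup>+t. (indicator E x * prod_ind J B x) * ennreal (J m (vec_upd x m t)) \<partial>unif_interval)"
        proof (rule nn_integral_cong_AE)
          note x = elim(1)
          show "AE t in unif_interval. indicator E (vec_upd x m t) * prod_ind J (insert m B) (vec_upd x m t)
              = (indicator E x * prod_ind J B x) * ennreal (J m (vec_upd x m t))"
            using elim(2) AE_unif_interval_in
          proof eventually_elim
            case (elim t)
            have "prod_ind J (insert m B) (vec_upd x m t) = ennreal (J m (vec_upd x m t)) * prod_ind J B (vec_upd x m t)"
              using mB unfolding prod_ind_def by simp
            with elim show ?case by (simp add: ind x mult_ac)
          qed
        qed
        then show ?case by (simp add: nn_integral_cmult)
      qed
    qed
    finally have "AE x in unif_cube. indicator E x * prod_ind J B x * (\<integral>\<^sup>+t. ennreal (J m (vec_upd x m t)) \<partial>unif_interval) = 0"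
      by (subst (asm) eq_commute, subst (asm) nn_integral_0_iff_AE) auto
    moreover have "AE x in unif_cube. (\<integral>\<^sup>+t. ennreal (J m (vec_upd x m t)) \<partial>unif_interval)
        = (\<integral>\<^sup>+y. indicator {U (vec_upd x m (- 1)) $ m..U (vec_upd x m 1) $ m} y \<partial>unif_interval)"
      using line_subst[where h = "\<lambda>x y. 1" and j = m] by simp
    moreover have "AE x in unif_cube. U (vec_upd x m (- 1)) $ m < U (vec_upd x m 1) $ m"
      by (rule insert.prems(1)) simp
    moreover note AE_in_cube
    ultimately have "AE x in unif_cube. indicator E x * prod_ind J B x = 0"
    proof eventually_elim
      case (elim x)
      let ?a = "U (vec_upd x m (- 1)) $ m" and ?b = "U (vec_upd x m 1) $ m"
      have "?a \<in> {-1..1}" "?b \<in> {-1..1}" by (intro line_range elim; simp)+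
      then have "{-1..1} \<inter> {?a..?b} = {?a..?b}" by auto
      then have "emeasure unif_interval {?a..?b} \<noteq> 0"
        using elim(3) emeasure_lborel_interval_neq_0(2)[OF elim(3)]
        by (simp add: emeasure_unif_interval ennreal_divide_eq_0_iff)
      with elim(1,2) show ?case by (simp add: nn_integral_indicator)
    qed
    then have "(\<integral>\<^sup>+x. indicator E x * prod_ind J B x \<partial>unif_cube) = 0"
      by (subst nn_integral_0_iff_AE) auto
    then show ?case using insert.prems(1,2) by (intro insert.IH) auto
  qed
qed

end

section \<open>Lipschitz representatives of a triangular bijection and its inverse\<close>

lemma negligible_if_AE_unif_cube:
  fixes P :: "real ^ 'n \<Rightarrow> bool"
  assumes "AE x in unif_cube. P x"
  shows "negligible {x\<in>cube. \<not> P x}"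
proof -
  have "AE x in lborel. x \<in> cube \<longrightarrow> P x" using assms by (simp only: AE_unif_cube_iff)
  then obtain N where N: "{x \<in> space lborel. \<not> (x \<in> cube \<longrightarrow> P x)} \<subseteq> N" "N \<in> null_sets lborel"
    unfolding eventually_ae_filter by blast
  have "negligible N" using N(2) by (simp add: negligible_iff_null_sets null_sets_completionI)
  then show ?thesis by (rule negligible_subset) (use N(1) in auto)
qed

lemma AE_notin_negligible:
  fixes N :: "(real ^ 'n) set"
  assumes "negligible N"
  shows "AE x in unif_cube. x \<notin> N"
proof -
  have "AE x in lebesgue. x \<notin> N"
    using assms by (intro AE_not_in) (simp add: negligible_iff_null_sets)
  then have "AE x in lborel. x \<notin> N" by (simp add: AE_completion_iff)
  then show ?thesis unfolding AE_unif_cube_iff by (rule eventually_mono) simp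
qed

lemma negligible_lipschitz_image:
  fixes \<Theta> :: "real ^ 'n \<Rightarrow> real ^ 'n"
  assumes "L-lipschitz_on cube \<Theta>" "N \<subseteq> cube" "negligible N"
  shows "negligible (\<Theta> ` N)"
proof (rule negligible_locally_Lipschitz_image)
  fix x assume x: "x \<in> N"
  show "\<exists>T B. open T \<and> x \<in> T \<and> (\<forall>y\<in>N \<inter> T. norm (\<Theta> y - \<Theta> x) \<le> B * norm (y - x))"
    using x assms(2) lipschitz_on_normD[OF assms(1)] by (intro exI[of _ UNIV] exI[of _ L]) auto
qed (use assms(3) in auto)

text \<open>Fubini in direction \<open>j\<close>, since a single point of a line is a null
  set.\<close>

lemma null_if_fibres_single:
  fixes E :: "(real ^ 'n) set"
  assumes [measurable]: "E \<in> sets borel"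
    and single: "\<And>x s t. vec_upd x j s \<in> E \<Longrightarrow> vec_upd x j t \<in> E \<Longrightarrow> s = t"
  shows "emeasure unif_cube E = 0"
proof -
  have "emeasure unif_cube E = (\<integral>\<^sup>+x. indicator E x \<partial>unif_cube)" by simp
  also have "\<dots> = (\<integral>\<^sup>+x. \<integral>\<^sup>+t. indicator E (vec_upd x j t) \<partial>unif_interval \<partial>unif_cube)"
    by (rule nn_integral_vec_upd) measurable
  also have "\<dots> = (\<integral>\<^sup>+x. 0 \<partial>(unif_cube :: (real ^ 'n) measure))"
  proof (rule nn_integral_cong_AE, rule AE_I2)
    fix x :: "real ^ 'n"
    have "AE t in unif_interval. indicator E (vec_upd x j t) = (0 :: ennreal)"
    proof (cases "\<exists>s. vec_upd x j s \<in> E")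
      case True
      then obtain s where s: "vec_upd x j s \<in> E" by blast
      show ?thesis using AE_unif_interval_neq[of s]
        by (rule eventually_mono) (use single[OF s] in \<open>auto simp: indicator_def\<close>)
    qed auto
    then show "(\<integral>\<^sup>+t. indicator E (vec_upd x j t) \<partial>unif_interval) = 0"
      by (subst nn_integral_0_iff_AE) auto
  qed
  finally show ?thesis by simp
qed

text \<open>Points that agree up to coordinate \<open>j\<close> are joined by changing the later
  coordinates one at a time.\<close>

lemma triangular_if_upd:
  fixes U :: "real ^ 'n::{finite,linorder} \<Rightarrow> real ^ 'n::{finite,linorder}"
  assumes "\<And>j k x t. j < k \<Longrightarrow> x \<in> cube \<Longrightarrow> t \<in> {-1..1} \<Longrightarrow> U (vec_upd x k t) $ j = U x $ j"
  shows "triangular U"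
  unfolding triangular_def
proof (intro allI ballI impI)
  fix j :: 'n and x y :: "(real, 'n) vec" assume x: "x \<in> cube" and y: "y \<in> cube" and eq: "\<forall>k\<le>j. x $ k = y $ k"
  have "U (mix A y x) $ j = U x $ j" if "A \<subseteq> {k. j < k}" for A
  proof -
    have "finite A" by simp
    then show ?thesis using that
    proof (induction A)
      case (insert k A)
      have "mix (insert k A) y x = vec_upd (mix A y x) k (y $ k)" by (auto simp: vec_eq_iff)
      then have "U (mix (insert k A) y x) $ j = U (mix A y x) $ j"
        using insert.prems x y by (simp only:) (intro assms mix_in_cube, auto simp: mem_box_cart)
      then show ?case using insert by simp
    qed simp
  qed
  from this[of "{k. j < k}"] have "U (mix {k. j < k} y x) $ j = U x $ j" by simp
  moreover have "mix {k. j < k} y x = y" using eq by (auto simp: vec_eq_iff not_less)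
  ultimately show "U x $ j = U y $ j" by simp
qed

text \<open>The disjunction with \<open>t \<le> s\<close> makes the comparison a closed condition in
  \<open>t\<close> for fixed \<open>s\<close> and in \<open>s\<close> for fixed \<open>t\<close>, so
  it is extended to all points in one variable after the other.\<close>

lemma mono_on_if_AE_eq:
  fixes p q :: "real \<Rightarrow> real"
  assumes eq: "AE t in unif_interval. p t = q t" and p: "continuous_on {-1..1} p" and q: "mono_on {-1..1} q"
  shows "mono_on {-1..1} p"
proof -
  have cl1: "closed {t\<in>{-1..1}. t \<le> s \<or> p s \<le> p t}" for s
  proof -
    have "{t\<in>{-1..1}. t \<le> s \<or> p s \<le> p t} = {-1..1} \<inter> {..s} \<union> {-1..1} \<inter> p -` {p s..}" by auto
    moreover have "closed ({-1..1} \<inter> p -` {p s..})"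
      using p by (rule continuous_closed_preimage) auto
    ultimately show ?thesis
      using closed_Un[OF closed_Int[OF closed_atLeastAtMost closed_atMost]] by simp
  qed
  have cl2: "closed {s\<in>{-1..1}. t \<le> s \<or> p s \<le> p t}" for t
  proof -
    have "{s\<in>{-1..1}. t \<le> s \<or> p s \<le> p t} = {-1..1} \<inter> {t..} \<union> {-1..1} \<inter> p -` {..p t}" by auto
    moreover have "closed ({-1..1} \<inter> p -` {..p t})"
      using p by (rule continuous_closed_preimage) auto
    ultimately show ?thesis
      using closed_Un[OF closed_Int[OF closed_atLeastAtMost closed_atLeast]] by simp
  qed
  have "AE s in unif_interval. \<forall>t\<in>{-1..1}. t \<le> s \<or> p s \<le> p t"
    using eq AE_unif_interval_in
  proof eventually_elim
    case (elim s)
    have ae: "AE t in unif_interval. t \<le> s \<or> p s \<le> p t"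
      using eq AE_unif_interval_in
    proof eventually_elim
      case t: (elim t)
      show ?case using elim t mono_onD[OF q, of s t] by (cases "s \<le> t") auto
    qed
    show ?case
    proof
      fix t :: real assume "t \<in> {-1..1}"
      then show "t \<le> s \<or> p s \<le> p t" by (rule AE_unif_interval_closed[OF ae cl1])
    qed
  qed
  then have ae: "AE s in unif_interval. t \<le> s \<or> p s \<le> p t" if "t \<in> {-1..1}" for t
    by (rule eventually_mono) (use that in auto)
  show ?thesis
  proof (rule mono_onI)
    fix r s :: real assume rs: "r \<in> {-1..1}" "s \<in> {-1..1}" "r \<le> s"
    have "s \<le> r \<or> p r \<le> p s" by (rule AE_unif_interval_closed[OF ae[OF rs(2)] cl2 rs(1)])
    then show "p r \<le> p s" using rs(3) by auto
  qed
qed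

text \<open>The monotone \<open>q\<close> is squeezed between its values at nearby generic points on
  either side, where it equals the continuous \<open>p\<close>. At the ends of the interval one side
  is missing and \<open>q\<close> may jump.\<close>

lemma eq_interior_if_AE_eq:
  fixes p q :: "real \<Rightarrow> real"
  assumes eq: "AE t in unif_interval. p t = q t" and p: "continuous_on {-1..1} p" and q: "mono_on {-1..1} q"
    and t: "t \<in> {-1<..<1}"
  shows "q t = p t"
proof -
  have "\<bar>q t - p t\<bar> \<le> e" if e: "e > 0" for e
  proof -
    have "t \<in> {-1..1}" using t by auto
    then obtain d where d: "d > 0" "\<And>s. s \<in> {-1..1} \<Longrightarrow> dist s t < d \<Longrightarrow> dist (p s) (p t) < e"
      using p e unfolding continuous_on_iff by blast
    \<comment> \<open>Small enough for the windows (t - 2r, t) and (t, t + 2r) to lie in the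
      interval and within distance \<open>d\<close> of \<open>t\<close>.\<close>
    define r where "r = min (d / 2) (min ((t + 1) / 2) ((1 - t) / 2)) / 2"
    have r: "0 < r" "2 * r < d" "- 1 < t - 2 * r" "t + 2 * r < 1"
      using d(1) t by (auto simp: r_def min_def field_simps)
    obtain s1 where s1: "s1 \<in> {-1..1}" "\<bar>s1 - (t - r)\<bar> < r" "p s1 = q s1"
      using unif_interval_dense[OF eq, of "t - r" r] r t by auto
    obtain s2 where s2: "s2 \<in> {-1..1}" "\<bar>s2 - (t + r)\<bar> < r" "p s2 = q s2"
      using unif_interval_dense[OF eq, of "t + r" r] r t by auto
    have "q s1 \<le> q t" "q t \<le> q s2"
      using s1 s2 t by (auto intro!: mono_onD[OF q])
    moreover have "\<bar>p s1 - p t\<bar> < e" "\<bar>p s2 - p t\<bar> < e"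
      using d(2)[of s1] d(2)[of s2] s1 s2 r by (auto simp: dist_real_def)
    ultimately show ?thesis using s1(3) s2(3) by linarith
  qed
  then have "\<bar>q t - p t\<bar> \<le> 0" by (rule field_le_epsilon) simp
  then show ?thesis by simp
qed

text \<open>A local substitute for injectivity: for a triangular \<open>U\<close> it depends only on
  the coordinates of \<open>x\<close> below \<open>i\<close>.\<close>

definition line_inj :: "(real ^ 'n \<Rightarrow> real ^ 'n) \<Rightarrow> 'n \<Rightarrow> real ^ 'n \<Rightarrow> bool" where
  "line_inj U i x \<longleftrightarrow> inj_on (\<lambda>t. U (vec_upd x i t) $ i) {-1..1}"

text \<open>Forward substitution: once the earlier coordinates agree, the component \<open>i\<close>
  is an injective function of coordinate \<open>i\<close>. Injectivity along lines is asked at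
  \<open>x\<close> alone, so \<open>x'\<close> may be an exceptional point.\<close>

lemma line_inj_determines:
  fixes U :: "real ^ 'n::{finite,linorder} \<Rightarrow> real ^ 'n::{finite,linorder}"
  assumes tri: "triangular U" and x: "x \<in> cube" and x': "x' \<in> cube"
    and inj: "\<And>i. i \<in> I \<Longrightarrow> line_inj U i x"
    and down: "\<And>i k. i \<in> I \<Longrightarrow> k < i \<Longrightarrow> k \<in> I"
    and eq: "\<And>i. i \<in> I \<Longrightarrow> U x $ i = U x' $ i"
  shows "i \<in> I \<Longrightarrow> x $ i = x' $ i"
\<comment> \<open>\<open>card {k. k < i}\<close> is the position of \<open>i\<close> in the finite
  order, so the coordinates are treated in increasing order.\<close>
proof (induction i rule: measure_induct_rule[where f = "\<lambda>i. card {k. k < i}"])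
  case (less i)
  have below: "x $ k = x' $ k" if "k < i" for k
  proof (rule less.IH)
    show "card {l. l < k} < card {l. l < i}" using that by (intro psubset_card_mono) auto
    show "k \<in> I" using down[OF less.prems that] .
  qed
  have xi: "x $ i \<in> {-1..1}" "x' $ i \<in> {-1..1}" using x x' unfolding mem_cube_iff by blast+
  have "U (vec_upd x i (x' $ i)) $ i = U x' $ i"
    using below by (intro triangularD[OF tri vec_upd_in_cube[OF x xi(2)] x']) (auto simp: le_less)
  then have "U (vec_upd x i (x' $ i)) $ i = U (vec_upd x i (x $ i)) $ i"
    using eq[OF less.prems] by simp
  then show ?case
    using inj_onD[OF inj[OF less.prems, unfolded line_inj_def], of "x $ i" "x' $ i"] xi by metis
qed

lemma lipschitz_on_vec:
  fixes f :: "real ^ 'n \<Rightarrow> real ^ 'm"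
  assumes "\<And>i. (L i)-lipschitz_on X (\<lambda>x. f x $ i)"
  shows "(\<Sum>i\<in>UNIV. L i)-lipschitz_on X f"
proof (rule lipschitz_onI)
  show "0 \<le> (\<Sum>i\<in>UNIV. L i)" using assms by (intro sum_nonneg lipschitz_on_nonneg) auto
  fix x y assume xy: "x \<in> X" "y \<in> X"
  have "dist (f x) (f y) \<le> (\<Sum>i\<in>UNIV. \<bar>(f x - f y) $ i\<bar>)"
    unfolding dist_norm by (rule norm_le_l1_cart)
  also have "\<dots> \<le> (\<Sum>i\<in>UNIV. L i * dist x y)"
    using lipschitz_onD[OF assms xy] by (intro sum_mono) (simp add: dist_real_def)
  finally show "dist (f x) (f y) \<le> (\<Sum>i\<in>UNIV. L i) * dist x y" by (simp add: sum_distrib_right)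
qed

lemma lipschitz_on_vec_nth:
  fixes f :: "real ^ 'n \<Rightarrow> real ^ 'm"
  assumes "L-lipschitz_on X f"
  shows "L-lipschitz_on X (\<lambda>x. f x $ i)"
proof (rule lipschitz_onI)
  show "0 \<le> L" using assms by (rule lipschitz_on_nonneg)
  fix x y assume "x \<in> X" "y \<in> X"
  have "dist (f x $ i) (f y $ i) \<le> dist (f x) (f y)" by (rule dist_vec_nth_le)
  then show "dist (f x $ i) (f y $ i) \<le> L * dist x y"
    using lipschitz_onD[OF assms \<open>x \<in> X\<close> \<open>y \<in> X\<close>] by linarith
qed

lemma continuous_on_vec_upd_fst:
  fixes f :: "real ^ 'n \<Rightarrow> 'a::topological_space"
  assumes "continuous_on cube f" "t \<in> {-1..1}"
  shows "continuous_on cube (\<lambda>x. f (vec_upd x k t))"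
proof (rule continuous_on_compose2[OF assms(1)])
  show "continuous_on cube (\<lambda>x. vec_upd x k t)"
    unfolding vec_upd_def[abs_def]
  proof (rule continuous_on_vec_lambda)
    fix i :: 'n
    show "continuous_on cube (\<lambda>x. if i = k then t else x $ i)"
      by (cases "i = k") (auto intro: continuous_intros)
  qed
  show "(\<lambda>x. vec_upd x k t) ` cube \<subseteq> cube" using assms(2) vec_upd_in_cube by blast
qed

text \<open>\<open>T\<close> and \<open>S\<close> are mutually inverse pointwise, but their Lipschitz representatives \<open>Th\<close> and \<open>Sh\<close> agree with
  them only almost everywhere; that these are mutually inverse too has to be proved.\<close>

locale triangular_inverse =
  fixes T S Th Sh :: "(real, 'n::{finite,linorder}) vec \<Rightarrow> (real, 'n) vec"
    and J :: "'n \<Rightarrow> (real, 'n) vec \<Rightarrow> real" and L :: real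
  assumes bij: "bij_betw T cube cube" and S_def: "S = inv_into cube T"
    and T_mono: "coord_monotone T" and T_tri: "triangular T"
    and Th_meas: "Th \<in> borel_measurable borel" and Sh_meas: "Sh \<in> borel_measurable borel"
    and Th_lip: "L-lipschitz_on cube Th" and Sh_lip: "L-lipschitz_on cube Sh"
    and T_eq: "AE x in unif_cube. T x = Th x" and S_eq: "AE x in unif_cube. S x = Sh x"
    and Th_line: "\<And>j. line_deriv (\<lambda>x. Th x $ j) j (J j)"
begin

lemma T_cube: "x \<in> cube \<Longrightarrow> T x \<in> cube" and S_cube: "y \<in> cube \<Longrightarrow> S y \<in> cube" and T_S: "y \<in> cube \<Longrightarrow> T (S y) = y"
  using bij unfolding S_def by (auto simp: bij_betw_def inv_into_into f_inv_into_f)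

lemma T_inj: "x \<in> cube \<Longrightarrow> y \<in> cube \<Longrightarrow> T x = T y \<Longrightarrow> x = y"
  using bij by (auto simp: bij_betw_def inj_on_def)

lemma Th_cont: "continuous_on cube Th" and Sh_cont: "continuous_on cube Sh"
  using Th_lip Sh_lip by (auto intro: lipschitz_on_continuous_on)

lemma AE_cube_closed:
  assumes "AE x in unif_cube. f x = g x" "\<And>x. x \<in> cube \<Longrightarrow> f x \<in> cube" "continuous_on cube g" "x \<in> cube"
  shows "g x \<in> (cube :: (real, 'n) vec set)"
proof (rule AE_unif_cube_closed[OF _ _ assms(4)])
  show "AE x in unif_cube. g x \<in> cube"
    using assms(1) AE_in_cube
  proof eventually_elim
    case (elim x)
    then show ?case using assms(2)[of x] by simp
  qed
  have "{x\<in>cube. g x \<in> cube} = cube \<inter> g -` cube" by auto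
  then show "closed {x\<in>cube. g x \<in> cube}"
    using continuous_closed_preimage[OF assms(3) closed_cbox closed_cbox] by simp
qed

lemma Th_cube: "x \<in> cube \<Longrightarrow> Th x \<in> cube"
  by (rule AE_cube_closed[OF T_eq T_cube Th_cont])

lemma Sh_cube: "x \<in> cube \<Longrightarrow> Sh x \<in> cube"
  by (rule AE_cube_closed[OF S_eq S_cube Sh_cont])

lemma T_line_eq: "AE x in unif_cube. AE t in unif_interval. Th (vec_upd x k t) = T (vec_upd x k t)"
  using AE_vec_updD[OF T_eq, of k] by (simp only: eq_commute)

lemma T_interior_eq: "AE x in unif_cube. \<forall>t\<in>{-1<..<1}. T (vec_upd x j t) $ j = Th (vec_upd x j t) $ j"
  using T_line_eq[of j] AE_in_cube
proof eventually_elim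
  case (elim x)
  have "AE t in unif_interval. Th (vec_upd x j t) $ j = T (vec_upd x j t) $ j"
    using elim(1) by (rule eventually_mono) simp
  moreover have "continuous_on {-1..1} (\<lambda>t. Th (vec_upd x j t) $ j)"
    by (intro continuous_on_component continuous_on_vec_upd Th_cont elim)
  moreover have "mono_on {-1..1} (\<lambda>t. T (vec_upd x j t) $ j)"
    using T_mono elim(2) unfolding coord_monotone_upd by blast
  ultimately show ?case
    using eq_interior_if_AE_eq[of "\<lambda>t. Th (vec_upd x j t) $ j" "\<lambda>t. T (vec_upd x j t) $ j"] by blast
qed

text \<open>Monotonicity holds on almost every line by \<open>mono_on_if_AE_eq\<close>. For fixed
  \<open>a\<close> and \<open>b\<close> it is a closed condition on the point through which the line
  passes, hence holds on every line.\<close>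

lemma Th_mono: "coord_monotone Th"
  unfolding coord_monotone_upd
proof (intro allI ballI mono_onI)
  fix j and x :: "(real, 'n) vec" and a b :: real
  assume x: "x \<in> cube" and ab: "a \<in> {-1..1}" "b \<in> {-1..1}" "a \<le> b"
  have "AE x in unif_cube. Th (vec_upd x j a) $ j \<le> Th (vec_upd x j b) $ j"
    using T_line_eq[of j] AE_in_cube
  proof eventually_elim
    case (elim x)
    have "mono_on {-1..1} (\<lambda>t. Th (vec_upd x j t) $ j)"
    proof (rule mono_on_if_AE_eq)
      show "AE t in unif_interval. Th (vec_upd x j t) $ j = T (vec_upd x j t) $ j"
        using elim(1) by (rule eventually_mono) simp
      show "continuous_on {-1..1} (\<lambda>t. Th (vec_upd x j t) $ j)"
        by (intro continuous_on_component continuous_on_vec_upd Th_cont elim)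
      show "mono_on {-1..1} (\<lambda>t. T (vec_upd x j t) $ j)"
        using T_mono elim(2) unfolding coord_monotone_upd by blast
    qed
    then show ?case using ab by (rule mono_onD)
  qed
  moreover have "closed {x\<in>cube. Th (vec_upd x j a) $ j \<le> Th (vec_upd x j b) $ j}"
  proof -
    have "continuous_on cube (\<lambda>x. Th (vec_upd x j b) $ j - Th (vec_upd x j a) $ j)"
      by (intro continuous_on_diff continuous_on_component continuous_on_vec_upd_fst Th_cont ab)
    from continuous_closed_preimage[OF this closed_cbox closed_atLeast, of 0]
    show ?thesis by (simp add: vimage_def Int_def)
  qed
  ultimately show "Th (vec_upd x j a) $ j \<le> Th (vec_upd x j b) $ j"
    using x by (rule AE_unif_cube_closed)
qed

text \<open>Invariance under changing a later coordinate is extended to all \<open>t\<close> on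
  almost every line, and then to all \<open>x\<close>, each time by continuity.\<close>

lemma Th_tri: "triangular Th"
proof (rule triangular_if_upd)
  fix j k :: 'n and x :: "(real, 'n) vec" and t :: real
  assume jk: "j < k" and x: "x \<in> cube" and t: "t \<in> {-1..1}"
  have "AE x in unif_cube. Th (vec_upd x k t) $ j = Th x $ j"
    using T_line_eq[of k] T_eq AE_in_cube
  proof eventually_elim
    case (elim x)
    show ?case
    proof (rule AE_unif_interval_eq[OF _ _ continuous_on_const t])
      show "AE t in unif_interval. Th (vec_upd x k t) $ j = Th x $ j"
        using elim(1) AE_unif_interval_in
      proof eventually_elim
        case t: (elim t)
        have "T (vec_upd x k t) $ j = T x $ j"
          using jk elim t by (intro triangularD[OF T_tri] vec_upd_in_cube) auto
        then show ?case using t elim by simp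
      qed
      show "continuous_on {-1..1} (\<lambda>t. Th (vec_upd x k t) $ j)"
        by (intro continuous_on_component continuous_on_vec_upd Th_cont elim)
    qed
  qed
  then show "Th (vec_upd x k t) $ j = Th x $ j"
    by (rule AE_unif_cube_eq)
      (intro continuous_on_component continuous_on_vec_upd_fst Th_cont t x)+
qed

sublocale tri_map Th J
  by unfold_locales (fact Th_meas Th_cube Th_cont Th_tri Th_mono Th_line)+

text \<open>On the slab \<open>E\<close> the component \<open>Th\<^sub>j\<close> is constant in \<open>x\<^sub>j\<close>. Replacing the coordinates above \<open>j\<close> by those of
  \<open>Th x\<close> therefore maps \<open>E\<close> onto a set which, by injectivity of \<open>T\<close>, meets each line in direction \<open>j\<close>
  at most once. So the image of \<open>E\<close> is null, and by the change of variables so is \<open>E\<close>.\<close>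

lemma flat_null:
  assumes IH: "\<And>k. j < k \<Longrightarrow> AE x in unif_cube. line_inj Th k x"
    and ab: "a \<in> {-1..1}" "b \<in> {-1..1}" "a < b"
  shows "AE x in unif_cube. Th (vec_upd x j a) $ j \<noteq> Th (vec_upd x j b) $ j"
proof -
  note [measurable] = Th_meas
  define B where "B = {k. j < k}"
  define E where "E = {x \<in> cube. a \<le> x $ j \<and> x $ j \<le> b \<and> Th (vec_upd x j a) $ j = Th (vec_upd x j b) $ j}"
  have E_meas [measurable]: "E \<in> sets borel"
  proof -
    have "E = cube \<inter> {x \<in> space borel. a \<le> x $ j \<and> x $ j \<le> b \<and> Th (vec_upd x j a) $ j = Th (vec_upd x j b) $ j}"
      by (auto simp: E_def)
    also have "\<dots> \<in> sets borel" by measurable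
    finally show ?thesis .
  qed
  obtain N where N: "{x \<in> space unif_cube. \<not> (T x = Th x)} \<subseteq> N" "N \<in> null_sets unif_cube"
    using T_eq unfolding eventually_ae_filter by blast
  have [measurable]: "N \<in> sets borel" using N(2) by auto
  \<comment> \<open>The partial Jacobian of the coordinates above \<open>j\<close> as a measure. Its
    total mass is at most 1 by \<open>cov_le\<close>, which makes inner regularity
    available.\<close>
  define D where "D = density unif_cube (prod_ind J B)"
  have sD: "sets D = sets borel" by (simp add: D_def)
  have D_fin: "emeasure D (space D) \<noteq> \<infinity>"
  proof -
    have "emeasure D (space D) = (\<integral>\<^sup>+x. prod_ind J B x \<partial>unif_cube)"
      unfolding D_def by (subst emeasure_density) auto
    also have "\<dots> \<le> (\<integral>\<^sup>+x. 1 \<partial>(unif_cube :: (real, 'n) vec measure))"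
      using cov_le[of "\<lambda>_. 1" B] by simp
    also have "\<dots> = 1" using unif_cube.emeasure_space_1 by simp
    finally show ?thesis by (auto simp: top_unique)
  qed
  have flat_val: "Th x $ j = Th (vec_upd x j a) $ j" if "x \<in> E" for x
  proof -
    have x: "x \<in> cube" "a \<le> x $ j" "x $ j \<le> b" "Th (vec_upd x j a) $ j = Th (vec_upd x j b) $ j" "x $ j \<in> {-1..1}"
      using that by (auto simp: E_def mem_box_cart)
    have "Th (vec_upd x j a) $ j \<le> Th (vec_upd x j (x $ j)) $ j"
      using x ab by (intro mono_onD[OF line_mono[OF x(1)]])
    moreover have "Th (vec_upd x j (x $ j)) $ j \<le> Th (vec_upd x j b) $ j"
      using x ab by (intro mono_onD[OF line_mono[OF x(1)]])
    ultimately show ?thesis using x(4) by simp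
  qed
  \<comment> \<open>Images of Borel sets need not be Borel. For compact sets the image is compact,
    and inner regularity reduces \<open>E - N\<close> to them.\<close>
  have K0: "emeasure D K = 0" if K: "K \<subseteq> E - N" "compact K" for K
  proof -
    define \<Psi> where "\<Psi> x = mix B (Th x) x" for x
    have "continuous_on K \<Psi>"
      unfolding \<Psi>_def mix_def
    proof (rule continuous_on_vec_lambda)
      fix i
      have "continuous_on K Th" using K(1) by (intro continuous_on_subset[OF Th_cont]) (auto simp: E_def)
      then show "continuous_on K (\<lambda>x. if i \<in> B then Th x $ i else x $ i)"
        by (cases "i \<in> B") (auto intro: continuous_intros continuous_on_component)
    qed
    then have cK': "compact (\<Psi> ` K)" using K(2) by (rule compact_continuous_image)
    then have [measurable]: "\<Psi> ` K \<in> sets borel" by (simp add: compact_imp_closed borel_closed)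
    have [measurable]: "K \<in> sets borel" using K(2) by (simp add: compact_imp_closed borel_closed)
    have "emeasure unif_cube (\<Psi> ` K) = 0"
    proof (rule null_if_fibres_single)
      fix w s t assume "vec_upd w j s \<in> \<Psi> ` K" "vec_upd w j t \<in> \<Psi> ` K"
      then obtain x x' where x: "x \<in> K" "vec_upd w j s = \<Psi> x" and x': "x' \<in> K" "vec_upd w j t = \<Psi> x'" by blast
      have E: "x \<in> E" "x' \<in> E" "x \<in> cube" "x' \<in> cube" "T x = Th x" "T x' = Th x'"
        using x(1) x'(1) K(1) N(1) by (auto simp: E_def)
      have c: "x $ k = x' $ k" if "k < j" for k
      proof -
        have "k \<noteq> j" "\<not> j < k" using that by auto
        then show ?thesis
          using arg_cong[OF x(2), of "\<lambda>z. z $ k"] arg_cong[OF x'(2), of "\<lambda>z. z $ k"]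
          by (simp add: \<Psi>_def B_def)
      qed
      have cj: "x $ j = s" "x' $ j = t"
        using arg_cong[OF x(2), of "\<lambda>z. z $ j"] arg_cong[OF x'(2), of "\<lambda>z. z $ j"]
        by (simp_all add: \<Psi>_def B_def)
      have "Th x $ k = Th x' $ k" for k
      proof -
        consider "k < j" | "k = j" | "j < k" by (rule linorder_cases)
        then show ?thesis
        proof cases
          case 1
          then show ?thesis using c by (intro triangularD[OF Th_tri] E) auto
        next
          case 2
          have "Th (vec_upd x j a) $ j = Th (vec_upd x' j a) $ j"
            using c ab by (intro triangularD[OF Th_tri] vec_upd_in_cube E) (auto simp: le_less)
          then show ?thesis using flat_val E 2 by simp
        next
          case 3
          then have "k \<noteq> j" "k \<in> B" by (auto simp: B_def)
          then show ?thesis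
            using arg_cong[OF x(2), of "\<lambda>z. z $ k"] arg_cong[OF x'(2), of "\<lambda>z. z $ k"]
            by (simp add: \<Psi>_def)
        qed
      qed
      \<comment> \<open>Outside \<open>N\<close> the map \<open>T\<close> equals \<open>Th\<close>,
        so injectivity of the original map applies here.\<close>
      then have "T x = T x'" using E by (simp add: vec_eq_iff)
      then have "x = x'" by (rule T_inj[OF E(3,4)])
      then show "s = t" using cj by simp
    qed measurable
    then have 0: "(\<integral>\<^sup>+x. indicator (\<Psi> ` K) x \<partial>unif_cube) = 0" by simp
    have "emeasure D K = (\<integral>\<^sup>+x. prod_ind J B x * indicator K x \<partial>unif_cube)"
      unfolding D_def by (subst emeasure_density) auto
    also have "\<dots> \<le> (\<integral>\<^sup>+x. indicator (\<Psi> ` K) (mix B (Th x) x) * prod_ind J B x \<partial>unif_cube)"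
      by (intro nn_integral_mono) (auto simp: indicator_def \<Psi>_def)
    also have "\<dots> \<le> (\<integral>\<^sup>+x. indicator (\<Psi> ` K) x \<partial>unif_cube)"
      by (rule cov_le) measurable
    finally show ?thesis using 0 by simp
  qed
  have "emeasure D (E - N) = (SUP K\<in>{K. K \<subseteq> E - N \<and> compact K}. emeasure D K)"
    by (rule inner_regular[OF sD D_fin]) measurable
  also have "\<dots> = 0" using K0 by (intro SUP_eq_const) auto
  finally have "emeasure D (E - N) = 0" .
  then have "(\<integral>\<^sup>+x. prod_ind J B x * indicator (E - N) x \<partial>unif_cube) = 0"
    unfolding D_def by (subst (asm) emeasure_density) auto
  moreover have "(\<integral>\<^sup>+x. prod_ind J B x * indicator (E - N) x \<partial>unif_cube) = (\<integral>\<^sup>+x. indicator E x * prod_ind J B x \<partial>unif_cube)"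
  proof (rule nn_integral_cong_AE)
    show "AE x in unif_cube. prod_ind J B x * indicator (E - N) x = indicator E x * prod_ind J B x"
      using AE_not_in[OF N(2)] by (rule eventually_mono) (simp add: indicator_def)
  qed
  ultimately have null: "(\<integral>\<^sup>+x. indicator E x * prod_ind J B x \<partial>unif_cube) = 0" by simp
  have "emeasure unif_cube E = 0"
  proof (rule null_if_prod_ind_null[OF _ E_meas _ null])
    fix k assume k: "k \<in> B"
    then have "AE x in unif_cube. line_inj Th k x" using IH by (simp add: B_def)
    then show "AE x in unif_cube. Th (vec_upd x k (- 1)) $ k < Th (vec_upd x k 1) $ k"
      using AE_in_cube
    proof eventually_elim
      case (elim x)
      have "Th (vec_upd x k (- 1)) $ k \<le> Th (vec_upd x k 1) $ k"
        by (rule mono_onD[OF line_mono[OF elim(2)]]) auto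
      moreover have "Th (vec_upd x k (- 1)) $ k \<noteq> Th (vec_upd x k 1) $ k"
        using inj_onD[OF elim(1)[unfolded line_inj_def], of "- 1" 1] by auto
      ultimately show ?case by simp
    qed
  next
    fix k and x :: "(real, 'n) vec" and t :: real assume k: "k \<in> B" and x: "x \<in> cube" and t: "t \<in> {-1..1}"
    have jk: "j < k" using k by (simp add: B_def)
    have "Th (vec_upd (vec_upd x k t) j c) $ j = Th (vec_upd x j c) $ j" if "c \<in> {-1..1}" for c
      using jk x t that by (intro triangularD[OF Th_tri] vec_upd_in_cube) auto
    then show "vec_upd x k t \<in> E \<longleftrightarrow> x \<in> E"
      using jk x t ab vec_upd_in_cube[OF x t, of k] by (auto simp: E_def)
  qed
  then have "AE x in unif_cube. x \<notin> E" by (intro AE_not_in) auto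
  \<comment> \<open>On almost every line some point strictly between \<open>a\<close> and
    \<open>b\<close> lies outside \<open>E\<close>. As \<open>E\<close> imposes the same flatness
    condition on all points of the segment, that condition fails on the line.\<close>
  from AE_vec_updD[OF this, of j] AE_in_cube show ?thesis
  proof eventually_elim
    case (elim x)
    obtain s where s: "s \<in> {-1..1}" "\<bar>s - (a + b) / 2\<bar> < (b - a) / 2" "vec_upd x j s \<notin> E"
      using unif_interval_dense[OF elim(1), of "(a + b) / 2" "(b - a) / 2"] ab by auto
    have "a \<le> s" "s \<le> b" using s(2) by (auto simp: abs_less_iff field_simps)
    then show ?case using s(1,3) elim(2) vec_upd_in_cube[OF elim(2) s(1), of j] by (auto simp: E_def)
  qed
qed

text \<open>Descending induction over the coordinates, since \<open>flat_null\<close> requires line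
  injectivity for all later ones. A monotone function that takes different values at any two
  rational points is injective, and there are only countably many such pairs.\<close>

lemma AE_line_inj: "AE x in unif_cube. line_inj Th j x"
proof (induction j rule: measure_induct_rule[where f = "\<lambda>j. card {k. j < k}"])
  case (less j)
  have IH: "AE x in unif_cube. line_inj Th k x" if "j < k" for k
    using that by (intro less.IH psubset_card_mono) auto
  have "AE x in unif_cube. \<forall>a\<in>\<rat> \<inter> {-1..1}. \<forall>b\<in>\<rat> \<inter> {-1..1}. a < b \<longrightarrow> Th (vec_upd x j a) $ j \<noteq> Th (vec_upd x j b) $ j"
  proof -
    have c: "countable (\<rat> \<inter> {-1..1} :: real set)" by (intro countable_Int1 countable_rat)
    have "AE x in unif_cube. a < b \<longrightarrow> Th (vec_upd x j a) $ j \<noteq> Th (vec_upd x j b) $ j"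
      if "a \<in> {-1..1}" "b \<in> {-1..1}" for a b
      using flat_null[OF IH that] by (cases "a < b") auto
    then show ?thesis by (simp only: AE_ball_countable[OF c] Int_iff) blast
  qed
  with AE_in_cube show ?case
  proof eventually_elim
    case (elim x)
    have lt: "Th (vec_upd x j s) $ j < Th (vec_upd x j t) $ j" if st: "s \<in> {-1..1}" "t \<in> {-1..1}" "s < t" for s t
    proof -
      obtain a where a: "a \<in> \<rat>" "s < a" "a < t" using Rats_dense_in_real[OF st(3)] by blast
      obtain b where b: "b \<in> \<rat>" "a < b" "b < t" using Rats_dense_in_real[OF a(3)] by blast
      have ab: "a \<in> {-1..1}" "b \<in> {-1..1}" using a b st by auto
      note m = mono_onD[OF line_mono[OF elim(1), of j]]
      have "Th (vec_upd x j s) $ j \<le> Th (vec_upd x j a) $ j" "Th (vec_upd x j a) $ j \<le> Th (vec_upd x j b) $ j"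
        "Th (vec_upd x j b) $ j \<le> Th (vec_upd x j t) $ j"
        using a b st ab by (auto intro!: m simp del: atLeastAtMost_iff)
      moreover have "Th (vec_upd x j a) $ j \<noteq> Th (vec_upd x j b) $ j" using elim(2) a b ab by blast
      ultimately show ?thesis by linarith
    qed
    show ?case unfolding line_inj_def
    proof (rule inj_onI)
      fix s t :: real assume "s \<in> {-1..1}" "t \<in> {-1..1}" "Th (vec_upd x j s) $ j = Th (vec_upd x j t) $ j"
      then show "s = t" using lt[of s t] lt[of t s] by (cases s t rule: linorder_cases) auto
    qed
  qed
qed

text \<open>The almost everywhere information on \<open>Th\<close> cannot be used at \<open>Sh y\<close> directly, since a Lipschitz map may
  pull a null set back to a set of positive measure. Here the exceptional set for the coordinates below
  \<open>j\<close> is carried forward by the Lipschitz map \<open>\<Theta>\<close>, and the exceptional points \<open>Sh y $ j \<in> {-1, 1}\<close>, where a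
  monotone \<open>T\<close> may jump, lie on single points of each line in direction \<open>j\<close>.\<close>

lemma Th_Sh: "y \<in> cube \<Longrightarrow> Th (Sh y) $ j = y $ j"
proof (induction j arbitrary: y rule: measure_induct_rule[where f = "\<lambda>j. card {k. k < j}"])
  case (less j)
  have IH: "Th (Sh y) $ i = y $ i" if "i < j" "y \<in> cube" for i y
    using that by (intro less.IH psubset_card_mono) auto
  note [measurable] = Sh_meas
  \<comment> \<open>What is required of \<open>Sh y\<close> for the argument to work at
    \<open>j\<close>: the coordinates below \<open>j\<close> can be recovered from their images, and
    the component \<open>j\<close> of \<open>T\<close> agrees with that of \<open>Th\<close> in the
    interior of the line in direction \<open>j\<close>.\<close>
  define P where "P x \<longleftrightarrow> (\<forall>i. i < j \<longrightarrow> line_inj Th i x)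
    \<and> (\<forall>t\<in>{-1<..<1}. T (vec_upd x j t) $ j = Th (vec_upd x j t) $ j)" for x
  have AE_P: "AE x in unif_cube. P x"
  proof -
    have "AE x in unif_cube. \<forall>i\<in>{i. i < j}. line_inj Th i x"
      using AE_line_inj by (subst AE_finite_all) auto
    with T_interior_eq[of j] show ?thesis
      by eventually_elim (simp add: P_def)
  qed
  \<comment> \<open>Both requirements concern only the coordinates below \<open>j\<close>, so the
    exceptional set is a cylinder in the remaining directions.\<close>
  have P_cyl: "P x'" if P: "P x" and x: "x \<in> cube" "x' \<in> cube" and eq: "\<And>i. i < j \<Longrightarrow> x $ i = x' $ i" for x x'
  proof -
    have line: "U (vec_upd x' i t) $ i = U (vec_upd x i t) $ i"
      if "triangular U" "i \<le> j" "t \<in> {-1..1}" for U :: "(real, 'n) vec \<Rightarrow> (real, 'n) vec" and i t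
      using that x eq by (intro triangularD[OF that(1)] vec_upd_in_cube) auto
    have "line_inj Th i x'" if "i < j" for i
    proof -
      have "inj_on (\<lambda>t. Th (vec_upd x i t) $ i) {-1..1}" using P that by (simp add: P_def line_inj_def)
      then show ?thesis unfolding line_inj_def
        by (rule inj_on_cong[THEN iffD1, rotated]) (use that in \<open>simp add: line[OF Th_tri]\<close>)
    qed
    moreover have "T (vec_upd x' j t) $ j = Th (vec_upd x' j t) $ j" if t: "t \<in> {-1<..<1}" for t
    proof -
      have "t \<in> {-1..1}" using t by auto
      then show ?thesis using P t by (simp only: line[OF T_tri order_refl] line[OF Th_tri order_refl] P_def)
    qed
    ultimately show ?thesis by (simp add: P_def)
  qed
  define \<Theta> where "\<Theta> x = mix {k. k < j} (Th x) x" for x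
  have "(\<Sum>i\<in>(UNIV :: 'n set). max L 1)-lipschitz_on cube \<Theta>"
  proof (rule lipschitz_on_vec)
    fix i
    have 1: "L-lipschitz_on cube (\<lambda>x. Th x $ i)" using Th_lip by (rule lipschitz_on_vec_nth)
    have 2: "1-lipschitz_on cube (\<lambda>x :: (real, 'n) vec. x $ i)"
      by (rule lipschitz_on_vec_nth[OF lipschitz_on_id])
    show "(max L 1)-lipschitz_on cube (\<lambda>x. \<Theta> x $ i)"
      using lipschitz_on_mono[OF 1 order_refl, of "max L 1"] lipschitz_on_mono[OF 2 order_refl, of "max L 1"]
      by (cases "i < j") (auto simp: \<Theta>_def)
  qed
  then have "negligible (\<Theta> ` {x\<in>cube. \<not> P x})"
    by (rule negligible_lipschitz_image) (use negligible_if_AE_unif_cube[OF AE_P] in auto)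
  then have "AE y in unif_cube. y \<notin> \<Theta> ` {x\<in>cube. \<not> P x}" by (rule AE_notin_negligible)
  with S_eq AE_in_cube have good: "AE y in unif_cube. y \<in> cube \<and> S y = Sh y \<and> P (Sh y)"
  proof eventually_elim
    case (elim y)
    have "P (Sh y)"
    proof (rule ccontr)
      assume nP: "\<not> P (Sh y)"
      \<comment> \<open>Shares the coordinates below \<open>j\<close> with \<open>Sh y\<close>,
        hence is exceptional too, and by the induction hypothesis \<open>\<Theta>\<close> maps it to
        \<open>y\<close>. So \<open>y\<close> lies in the null image of the exceptional set.\<close>
      define x' where "x' = mix {k. k < j} (Sh y) y"
      have x': "x' \<in> cube" unfolding x'_def using elim(2) Sh_cube[OF elim(2)] by (intro mix_in_cube)
      have "\<not> P x'"
      proof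
        assume "P x'"
        then have "P (Sh y)"
          by (rule P_cyl) (use x' Sh_cube[OF elim(2)] in \<open>auto simp: x'_def\<close>)
        with nP show False ..
      qed
      moreover have "\<Theta> x' = y"
      proof -
        have "Th x' $ k = y $ k" if "k < j" for k
        proof -
          have "Th x' $ k = Th (Sh y) $ k"
            using that x' Sh_cube[OF elim(2)] by (intro triangularD[OF Th_tri]) (auto simp: x'_def)
          then show ?thesis using IH[OF that elim(2)] by simp
        qed
        then show ?thesis by (simp add: \<Theta>_def vec_eq_iff) (simp add: x'_def)
      qed
      ultimately show False using elim(3) x' by blast
    qed
    then show ?case using elim by simp
  qed
  then obtain N where N: "{y \<in> space unif_cube. \<not> (y \<in> cube \<and> S y = Sh y \<and> P (Sh y))} \<subseteq> N" "N \<in> null_sets unif_cube"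
    unfolding eventually_ae_filter by blast
  have [measurable]: "N \<in> sets borel" using N(2) by auto
  have goodN: "y \<in> cube" "S y = Sh y" "P (Sh y)" if "y \<notin> N" for y
    using N(1) that by auto
  have ends: "AE y in unif_cube. Sh y $ j \<noteq> c" for c
  proof -
    define E where "E = {y \<in> space borel. Sh y $ j = c} - N"
    have [measurable]: "E \<in> sets borel" unfolding E_def by measurable
    have "emeasure unif_cube E = 0"
    proof (rule null_if_fibres_single)
      fix w s t assume s: "vec_upd w j s \<in> E" and t: "vec_upd w j t \<in> E"
      let ?y = "vec_upd w j s" and ?y' = "vec_upd w j t"
      have y: "?y \<in> cube" "S ?y = Sh ?y" "P (Sh ?y)" and y': "?y' \<in> cube" "S ?y' = Sh ?y'" "P (Sh ?y')"
        using s t goodN by (auto simp: E_def)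
      have eqj: "Sh ?y $ j = Sh ?y' $ j" using s t by (simp add: E_def)
      \<comment> \<open>Points on one line in direction \<open>j\<close> share the earlier
        coordinates. By the induction hypothesis these are the earlier components of
        \<open>Th\<close> at \<open>Sh ?y\<close> and \<open>Sh ?y'\<close>, from which line
        injectivity recovers the earlier coordinates of the two points.\<close>
      have "Sh ?y $ i = Sh ?y' $ i" if "i < j" for i
      proof (rule line_inj_determines[OF Th_tri Sh_cube[OF y(1)] Sh_cube[OF y'(1)], of "{i. i < j}"])
        fix i assume "i \<in> {i. i < j}"
        then show "line_inj Th i (Sh ?y)" "Th (Sh ?y) $ i = Th (Sh ?y') $ i"
          using y(3) IH[OF _ y(1)] IH[OF _ y'(1)] by (auto simp: P_def)
      qed (use that in auto)
      then have "T (Sh ?y) $ j = T (Sh ?y') $ j"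
        using eqj by (intro triangularD[OF T_tri Sh_cube[OF y(1)] Sh_cube[OF y'(1)]]) (auto simp: le_less)
      moreover have "T (Sh ?y) = ?y" "T (Sh ?y') = ?y'"
        using T_S[OF y(1)] T_S[OF y'(1)] y(2) y'(2) by simp_all
      ultimately show "s = t" by simp
    qed measurable
    then have "AE y in unif_cube. y \<notin> E" by (intro AE_not_in) auto
    with AE_not_in[OF N(2)] show ?thesis
      by eventually_elim (auto simp: E_def)
  qed
  have "AE y in unif_cube. Th (Sh y) $ j = y $ j"
    using good ends[of 1] ends[of "- 1"]
  proof eventually_elim
    case (elim y)
    have "Sh y $ j \<in> {-1..1}" using Sh_cube[of y] elim unfolding mem_cube_iff by blast
    then have "Sh y $ j \<in> {-1<..<1}" using elim by auto
    then have "T (vec_upd (Sh y) j (Sh y $ j)) $ j = Th (vec_upd (Sh y) j (Sh y $ j)) $ j"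
      using elim unfolding P_def by blast
    then show ?case using T_S[of y] elim by simp
  qed
  then show ?case
  proof (rule AE_unif_cube_eq)
    show "continuous_on cube (\<lambda>y. Th (Sh y) $ j)"
      by (intro continuous_on_component continuous_on_compose2[OF Th_cont Sh_cont]) (auto intro: Sh_cube)
  qed (auto intro: continuous_intros less.prems)
qed

lemma Th_Sh_eq: "y \<in> cube \<Longrightarrow> Th (Sh y) = y"
  by (simp add: vec_eq_iff Th_Sh)

lemma AE_line_inj_all: "AE x in unif_cube. \<forall>i. line_inj Th i x"
proof -
  have "AE x in unif_cube. \<forall>i\<in>UNIV. line_inj Th i x"
    using AE_line_inj by (subst AE_finite_all) auto
  then show ?thesis by simp
qed

text \<open>\<open>x\<close> and \<open>Sh (Th x)\<close> have the same image under
  \<open>Th\<close>. At almost every \<open>x\<close> injectivity along lines forces them to be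
  equal, and continuity does the rest.\<close>

lemma Sh_Th_eq:
  assumes x: "x \<in> cube"
  shows "Sh (Th x) = x"
proof -
  have "Sh (Th x) $ i = x $ i" for i
  proof (rule AE_unif_cube_eq[OF _ _ _ x])
    show "AE x in unif_cube. Sh (Th x) $ i = x $ i"
      using AE_line_inj_all AE_in_cube
    proof eventually_elim
      case (elim x)
      have c: "Sh (Th x) \<in> cube" by (intro Sh_cube Th_cube elim)
      have "x $ i = Sh (Th x) $ i"
        by (rule line_inj_determines[OF Th_tri elim(2) c, of UNIV])
          (use elim(1) Th_Sh_eq[OF Th_cube[OF elim(2)]] in auto)
      then show ?case by simp
    qed
    show "continuous_on cube (\<lambda>x. Sh (Th x) $ i)"
      by (intro continuous_on_component continuous_on_compose2[OF Sh_cont Th_cont]) (auto intro: Th_cube)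
  qed (auto intro: continuous_intros)
  then show ?thesis by (simp add: vec_eq_iff)
qed

text \<open>The Lipschitz map \<open>Th\<close> sends the points without line injectivity to a null
  set, so for almost every \<open>y\<close> the point \<open>Sh y\<close> is not among them. There
  the components of \<open>Th\<close> up to \<open>j\<close> determine the coordinates up to
  \<open>j\<close>, and these components do not see a change of \<open>y\<close> in direction
  \<open>k\<close>.\<close>

lemma Sh_tri: "triangular Sh"
proof (rule triangular_if_upd)
  fix j k :: 'n and y :: "(real, 'n) vec" and t :: real
  assume jk: "j < k" and y: "y \<in> cube" and t: "t \<in> {-1..1}"
  have "negligible (Th ` {x\<in>cube. \<not> (\<forall>i. line_inj Th i x)})"
    by (rule negligible_lipschitz_image[OF Th_lip _ negligible_if_AE_unif_cube[OF AE_line_inj_all]]) auto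
  then have "AE y in unif_cube. y \<notin> Th ` {x\<in>cube. \<not> (\<forall>i. line_inj Th i x)}" by (rule AE_notin_negligible)
  then have "AE y in unif_cube. Sh (vec_upd y k t) $ j = Sh y $ j"
    using AE_in_cube
  proof eventually_elim
    case (elim y)
    have c: "Sh y \<in> cube" "Sh (vec_upd y k t) \<in> cube" using elim t by (auto intro!: Sh_cube vec_upd_in_cube)
    have inj: "line_inj Th i (Sh y)" for i
      using elim(1) c(1) Th_Sh_eq[OF elim(2)] by (metis (mono_tags, lifting) image_eqI mem_Collect_eq)
    have "Sh y $ j = Sh (vec_upd y k t) $ j"
    proof (rule line_inj_determines[OF Th_tri c, of "{i. i \<le> j}"])
      fix i assume "i \<in> {i. i \<le> j}"
      then have "i \<noteq> k" using jk by auto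
      then show "Th (Sh y) $ i = Th (Sh (vec_upd y k t)) $ i"
        using elim t by (simp add: Th_Sh_eq vec_upd_in_cube)
    qed (use inj in auto)
    then show ?case by simp
  qed
  then show "Sh (vec_upd y k t) $ j = Sh y $ j"
    by (rule AE_unif_cube_eq)
      (intro continuous_on_component continuous_on_vec_upd_fst Sh_cont t y)+
qed

text \<open>If \<open>Sh\<close> decreased along a line, monotonicity of \<open>Th\<close> on the
  line through \<open>Sh ?a\<close> would give \<open>b \<le> a\<close>, hence \<open>a = b\<close>,
  where there is nothing to decrease.\<close>

lemma Sh_mono: "coord_monotone Sh"
  unfolding coord_monotone_upd
proof (intro allI ballI mono_onI)
  fix j and y :: "(real, 'n) vec" and a b :: real
  assume y: "y \<in> cube" and ab: "a \<in> {-1..1}" "b \<in> {-1..1}" "a \<le> b"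
  let ?a = "vec_upd y j a" and ?b = "vec_upd y j b"
  have c: "?a \<in> cube" "?b \<in> cube" using y ab by (auto intro!: vec_upd_in_cube)
  have below: "Sh ?a $ i = Sh ?b $ i" if "i < j" for i
    using that by (intro triangularD[OF Sh_tri c]) auto
  show "Sh ?a $ j \<le> Sh ?b $ j"
  proof (rule ccontr)
    assume lt: "\<not> Sh ?a $ j \<le> Sh ?b $ j"
    have bj: "Sh ?b $ j \<in> {-1..1}" "Sh ?a $ j \<in> {-1..1}" using Sh_cube[OF c(1)] Sh_cube[OF c(2)] unfolding mem_cube_iff by blast+
    have "Th (vec_upd (Sh ?a) j (Sh ?b $ j)) $ j \<le> Th (vec_upd (Sh ?a) j (Sh ?a $ j)) $ j"
      using lt bj by (intro mono_onD[OF line_mono[OF Sh_cube[OF c(1)]]]) auto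
    moreover have "Th (vec_upd (Sh ?a) j (Sh ?b $ j)) $ j = Th (Sh ?b) $ j"
      using below by (intro triangularD[OF Th_tri vec_upd_in_cube[OF Sh_cube[OF c(1)] bj(1)] Sh_cube[OF c(2)]])
        (auto simp: le_less)
    ultimately have "b \<le> a" using c by (simp add: Th_Sh_eq)
    then show False using lt ab by simp
  qed
qed

end

text \<open>On each line the component is onto [-1, 1]: because the inverse is triangular as well,
  changing coordinate \<open>j\<close> of the image leaves the earlier coordinates of the preimage
  alone. A monotone function onto the interval takes the end values at the ends.\<close>

lemma triangular_inverse_ends:
  fixes U V :: "(real, 'n::{finite,linorder}) vec \<Rightarrow> (real, 'n) vec"
  assumes U: "\<And>x. x \<in> cube \<Longrightarrow> U x \<in> cube" and V: "\<And>x. x \<in> cube \<Longrightarrow> V x \<in> cube"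
    and UV: "\<And>x. x \<in> cube \<Longrightarrow> U (V x) = x" and VU: "\<And>x. x \<in> cube \<Longrightarrow> V (U x) = x"
    and tri: "triangular U" "triangular V" and mono: "coord_monotone U" and x: "x \<in> cube"
  shows "U (vec_upd x j (- 1)) $ j = - 1" "U (vec_upd x j 1) $ j = 1"
proof -
  have attained: "\<exists>s\<in>{-1..1}. U (vec_upd x j s) $ j = c" if c: "c \<in> {-1..1}" for c
  proof -
    define y where "y = vec_upd (U x) j c"
    have y: "y \<in> cube" unfolding y_def by (intro vec_upd_in_cube U x c)
    have "V y $ i = V (U x) $ i" if "i < j" for i
      using that by (intro triangularD[OF tri(2) y U[OF x]]) (auto simp: y_def)
    then have below: "V y $ i = x $ i" if "i < j" for i using that VU[OF x] by simp
    have s: "V y $ j \<in> {-1..1}" using V[OF y] unfolding mem_cube_iff by blast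
    have "U (vec_upd x j (V y $ j)) $ j = U (V y) $ j"
      using below by (intro triangularD[OF tri(1) vec_upd_in_cube[OF x s] V[OF y]]) (auto simp: le_less)
    then have "U (vec_upd x j (V y $ j)) $ j = c" using UV[OF y] by (simp add: y_def)
    then show ?thesis using s by blast
  qed
  have range: "U (vec_upd x j s) $ j \<in> {-1..1}" if "s \<in> {-1..1}" for s
    using U[OF vec_upd_in_cube[OF x that]] unfolding mem_cube_iff by blast
  have m: "mono_on {-1..1} (\<lambda>t. U (vec_upd x j t) $ j)" using mono x unfolding coord_monotone_upd by blast
  obtain s where s: "s \<in> {-1..1}" "U (vec_upd x j s) $ j = - 1" using attained[of "- 1"] by auto
  have "U (vec_upd x j (- 1)) $ j \<le> U (vec_upd x j s) $ j" using s by (intro mono_onD[OF m]) auto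
  then show "U (vec_upd x j (- 1)) $ j = - 1" using s(2) range[of "- 1"] by simp
  obtain s where s: "s \<in> {-1..1}" "U (vec_upd x j s) $ j = 1" using attained[of 1] by auto
  have "U (vec_upd x j s) $ j \<le> U (vec_upd x j 1) $ j" using s by (intro mono_onD[OF m]) auto
  then show "U (vec_upd x j 1) $ j = 1" using s(2) range[of 1] by simp
qed

section \<open>Sobolev functions on the cube\<close>

lemma integrable_mult_compact_support:
  fixes g \<psi> :: "real ^ 'n \<Rightarrow> real"
  assumes g: "locally_integrable g" and \<psi>: "continuous_on UNIV \<psi>"
    and K: "compact K" "K \<subseteq> box (- 1) 1" "\<And>x. x \<notin> K \<Longrightarrow> \<psi> x = 0"
  shows "integrable lborel_cube (\<lambda>x. g x * \<psi> x)"
proof -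
  have "continuous_on K \<psi>" using \<psi> by (rule continuous_on_subset) simp
  then have "bounded (\<psi> ` K)" using K(1) by (intro compact_imp_bounded compact_continuous_image)
  then obtain B where B: "\<forall>x\<in>K. \<bar>\<psi> x\<bar> \<le> B" unfolding bounded_iff by auto
  have [measurable]: "\<psi> \<in> borel_measurable borel" using \<psi> by (rule borel_measurable_continuous_onI)
  have int: "integrable lborel (\<lambda>x. indicator K x *\<^sub>R g x)"
    using g K(1,2) by (simp add: locally_integrable_def set_integrable_def)
  have "integrable lborel (\<lambda>x. (indicator K x *\<^sub>R g x) * \<psi> x)"
  proof (rule Bochner_Integration.integrable_bound)
    show "integrable lborel (\<lambda>x. B * (indicator K x *\<^sub>R g x))" using int by (intro integrable_mult_right)
    show "(\<lambda>x. indicator K x *\<^sub>R g x * \<psi> x) \<in> borel_measurable lborel"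
      using borel_measurable_integrable[OF int] by simp
    show "AE x in lborel. norm (indicator K x *\<^sub>R g x * \<psi> x) \<le> norm (B * (indicator K x *\<^sub>R g x))"
    proof (rule AE_I2)
      fix x
      show "norm (indicator K x *\<^sub>R g x * \<psi> x) \<le> norm (B * (indicator K x *\<^sub>R g x))"
      proof (cases "x \<in> K")
        case True
        then have "\<bar>\<psi> x\<bar> \<le> \<bar>B\<bar>" using bspec[OF B True] by linarith
        then have "\<bar>g x\<bar> * \<bar>\<psi> x\<bar> \<le> \<bar>g x\<bar> * \<bar>B\<bar>" by (intro mult_left_mono) auto
        then show ?thesis using True by (simp add: abs_mult mult.commute)
      qed simp
    qed
  qed
  moreover have "(\<lambda>x. indicator K x *\<^sub>R g x * \<psi> x) = (\<lambda>x. indicator cube x *\<^sub>R (g x * \<psi> x))"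
  proof
    fix x
    have "K \<subseteq> cube" using K(2) box_subset_cbox by blast
    then show "indicator K x *\<^sub>R g x * \<psi> x = indicator cube x *\<^sub>R (g x * \<psi> x)"
      using K(3)[of x] by (cases "x \<in> K") auto
  qed
  ultimately show ?thesis by (subst integrable_restrict_space) auto
qed

lemma compact_test_support:
  assumes "test_function \<phi>"
  shows "compact (closure {x. \<phi> x \<noteq> 0})" "closure {x. \<phi> x \<noteq> 0} \<subseteq> box (- 1) 1"
proof -
  show sub: "closure {x. \<phi> x \<noteq> 0} \<subseteq> box (- 1) 1" using assms by (simp add: test_function_def)
  show "compact (closure {x. \<phi> x \<noteq> 0})"
    unfolding compact_eq_bounded_closed using bounded_subset[OF bounded_box sub] by simp
qed

lemma test_function_continuous:
  assumes "test_function \<phi>"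
  shows "continuous_on UNIV (iter_partial \<alpha> \<phi>)"
proof -
  have "iter_partial \<alpha> \<phi> differentiable (at x)" for x using assms by (simp add: test_function_def)
  then have "isCont (iter_partial \<alpha> \<phi>) x" for x by (intro differentiable_imp_continuous_within)
  then show ?thesis by (simp add: continuous_at_imp_continuous_on)
qed

lemma partial_deriv_zero:
  assumes "x \<notin> closure {x. \<phi> x \<noteq> 0}"
  shows "partial_deriv k \<phi> x = 0"
proof -
  have "(\<phi> has_derivative (\<lambda>_. 0)) (at x)"
  proof (rule has_derivative_transform_within_open[where f = "\<lambda>_. 0"])
    show "open (- closure {x. \<phi> x \<noteq> 0})" by (intro open_Compl closed_closure)
    show "x \<in> - closure {x. \<phi> x \<noteq> 0}" using assms by simp
    fix y assume "y \<in> - closure {x. \<phi> x \<noteq> 0}"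
    then have "y \<notin> {x. \<phi> x \<noteq> 0}" using closure_subset[of "{x. \<phi> x \<noteq> 0}"] by blast
    then show "0 = \<phi> y" by simp
  qed simp
  from frechet_derivative_at[OF this] show ?thesis
    unfolding partial_deriv_def by metis
qed

lemma integrable_mult_test:
  assumes "locally_integrable g" "test_function \<phi>"
  shows "integrable lborel_cube (\<lambda>x. g x * \<phi> x)" "integrable lborel_cube (\<lambda>x. g x * iter_partial [k] \<phi> x)"
proof -
  note K = compact_test_support[OF assms(2)]
  have "continuous_on UNIV \<phi>" using test_function_continuous[OF assms(2), of "[]"] by (simp add: iter_partial_def)
  then show "integrable lborel_cube (\<lambda>x. g x * \<phi> x)"
  proof (rule integrable_mult_compact_support[OF assms(1) _ K])
    fix x assume "x \<notin> closure {x. \<phi> x \<noteq> 0}"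
    then have "x \<notin> {x. \<phi> x \<noteq> 0}" using closure_subset[of "{x. \<phi> x \<noteq> 0}"] by blast
    then show "\<phi> x = 0" by simp
  qed
  show "integrable lborel_cube (\<lambda>x. g x * iter_partial [k] \<phi> x)"
    by (rule integrable_mult_compact_support[OF assms(1) test_function_continuous[OF assms(2)] K])
      (simp add: iter_partial_def partial_deriv_zero)
qed

lemma locally_integrable_diff:
  assumes "locally_integrable f" "locally_integrable g"
  shows "locally_integrable (\<lambda>x. f x - g x)"
  using assms unfolding locally_integrable_def
  by (auto intro!: borel_measurable_diff set_integral_diff)

lemma has_weak_derivD:
  "has_weak_deriv f \<alpha> g \<Longrightarrow> test_function \<phi> \<Longrightarrow>
    (\<integral>x. f x * iter_partial \<alpha> \<phi> x \<partial>lborel_cube) = (- 1) ^ length \<alpha> * (\<integral>x. g x * \<phi> x \<partial>lborel_cube)"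
  unfolding has_weak_deriv_def by blast

lemma has_weak_deriv_weak_deriv: "has_weak_deriv f \<alpha> g \<Longrightarrow> has_weak_deriv f \<alpha> (weak_deriv \<alpha> f)"
  unfolding weak_deriv_def by (rule someI[of "has_weak_deriv f \<alpha>"])

text \<open>Makes the arbitrary choice in \<open>weak_deriv\<close> harmless: two weak derivatives
  have the same integrals against product test functions.\<close>

lemma weak_deriv_unique:
  fixes f g g' :: "real ^ 'n \<Rightarrow> real"
  assumes g: "has_weak_deriv f \<alpha> g" and g': "has_weak_deriv f \<alpha> g'"
  shows "AE x in unif_cube. g x = g' x"
proof -
  have li: "locally_integrable g" "locally_integrable g'" using g g' by (auto simp: has_weak_deriv_def)
  have "AE x in unif_cube. g x - g' x = 0"
  proof (rule fundamental_lemma)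
    show "locally_integrable (\<lambda>x. g x - g' x)" using li by (rule locally_integrable_diff)
    fix u :: "'n \<Rightarrow> real \<Rightarrow> real" assume u: "\<And>i. bump_like (u i)"
    have t: "test_function (prod_fun u)" using u by (rule test_function_prod_fun)
    have "(- 1) ^ length \<alpha> * (\<integral>x. g x * prod_fun u x \<partial>lborel_cube) = (- 1) ^ length \<alpha> * (\<integral>x. g' x * prod_fun u x \<partial>lborel_cube)"
      using has_weak_derivD[OF g t] has_weak_derivD[OF g' t] by simp
    then have "(\<integral>x. g x * prod_fun u x \<partial>lborel_cube) - (\<integral>x. g' x * prod_fun u x \<partial>lborel_cube) = 0" by simp
    then show "(\<integral>x. (g x - g' x) * prod_fun u x \<partial>lborel_cube) = 0"
      unfolding left_diff_distrib
      using Bochner_Integration.integral_diff[OF integrable_mult_test(1)[OF li(1) t] integrable_mult_test(1)[OF li(2) t]]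
      by simp
  qed
  then show ?thesis by (rule eventually_mono) simp
qed

lemma has_weak_deriv_Nil: "locally_integrable f \<Longrightarrow> has_weak_deriv f [] f"
  by (simp add: has_weak_deriv_def iter_partial_def)

lemma weak_deriv_Nil_AE:
  assumes "locally_integrable f"
  shows "AE x in unif_cube. weak_deriv [] f x = f x"
proof (rule weak_deriv_unique)
  show "has_weak_deriv f [] (weak_deriv [] f)"
    using has_weak_deriv_Nil[OF assms] by (rule has_weak_deriv_weak_deriv)
qed (rule has_weak_deriv_Nil[OF assms])

lemma has_weak_deriv_diff:
  assumes f: "has_weak_deriv f [k] g" and f': "has_weak_deriv f' [k] g'"
  shows "has_weak_deriv (\<lambda>x. f x - f' x) [k] (\<lambda>x. g x - g' x)"
  unfolding has_weak_deriv_def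
proof (intro conjI allI impI)
  have li: "locally_integrable f" "locally_integrable f'" "locally_integrable g" "locally_integrable g'"
    using f f' by (auto simp: has_weak_deriv_def)
  then show "locally_integrable (\<lambda>x. f x - f' x)" "locally_integrable (\<lambda>x. g x - g' x)"
    by (auto intro: locally_integrable_diff)
  fix \<phi> :: "real ^ 'a \<Rightarrow> real" assume t: "test_function \<phi>"
  have "(\<integral>x. f x * iter_partial [k] \<phi> x \<partial>lborel_cube) = (- 1) ^ length [k] * (\<integral>x. g x * \<phi> x \<partial>lborel_cube)"
    "(\<integral>x. f' x * iter_partial [k] \<phi> x \<partial>lborel_cube) = (- 1) ^ length [k] * (\<integral>x. g' x * \<phi> x \<partial>lborel_cube)"
    using has_weak_derivD[OF f t] has_weak_derivD[OF f' t] .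
  then show "(\<integral>x. (f x - f' x) * iter_partial [k] \<phi> x \<partial>lborel_cube)
      = (- 1) ^ length [k] * (\<integral>x. (g x - g' x) * \<phi> x \<partial>lborel_cube)"
    unfolding left_diff_distrib
    using Bochner_Integration.integral_diff[OF integrable_mult_test(1)[OF li(3) t] integrable_mult_test(1)[OF li(4) t]]
      Bochner_Integration.integral_diff[OF integrable_mult_test(2)[OF li(1) t, of k] integrable_mult_test(2)[OF li(2) t, of k]]
    by simp
qed

lemma sobolev_weak_deriv:
  fixes f :: "real ^ 'n \<Rightarrow> real"
  assumes "sobolev_inf m f" "length \<alpha> \<le> m"
  shows "has_weak_deriv f \<alpha> (weak_deriv \<alpha> f)" "\<exists>B. AE x in unif_cube. \<bar>weak_deriv \<alpha> f x\<bar> \<le> B"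
proof -
  have "\<exists>g. has_weak_deriv f \<alpha> g \<and> (\<exists>B. AE x in lborel_cube. \<bar>g x\<bar> \<le> B)"
    using assms unfolding sobolev_inf_def by blast
  then obtain g B where g: "has_weak_deriv f \<alpha> g" "AE x in lborel_cube. \<bar>g x\<bar> \<le> B" by (elim exE conjE)
  show w: "has_weak_deriv f \<alpha> (weak_deriv \<alpha> f)" using g(1) by (rule has_weak_deriv_weak_deriv)
  have "AE x in unif_cube. \<bar>g x\<bar> \<le> B" using g(2) by (simp only: AE_lborel_cube_iff)
  with weak_deriv_unique[OF w g(1)] have "AE x in unif_cube. \<bar>weak_deriv \<alpha> f x\<bar> \<le> B"
    by eventually_elim simp
  then show "\<exists>B. AE x in unif_cube. \<bar>weak_deriv \<alpha> f x\<bar> \<le> B" by (rule exI)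
qed

lemma sobolev_locally_integrable: "sobolev_inf m f \<Longrightarrow> locally_integrable f"
  using sobolev_weak_deriv(1)[of m f "[]"] by (simp add: has_weak_deriv_def)

lemma sobolev_bounded:
  fixes f :: "real ^ 'n \<Rightarrow> real"
  assumes "sobolev_inf m f"
  shows "\<exists>B. AE x in unif_cube. \<bar>f x\<bar> \<le> B"
proof -
  obtain B where "AE x in unif_cube. \<bar>weak_deriv [] f x\<bar> \<le> B" using sobolev_weak_deriv(2)[OF assms, of "[]"] by auto
  with weak_deriv_Nil_AE[OF sobolev_locally_integrable[OF assms]] have "AE x in unif_cube. \<bar>f x\<bar> \<le> B"
    by eventually_elim simp
  then show ?thesis by (rule exI)
qed

lemma bounded_borel_representative:
  fixes f :: "real ^ 'n \<Rightarrow> real"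
  assumes f: "f \<in> borel_measurable lborel_cube" and B: "\<exists>B. AE x in unif_cube. \<bar>f x\<bar> \<le> B"
  shows "\<exists>f'. bounded_borel f' \<and> (AE x in unif_cube. f x = f' x)"
proof -
  obtain B where B: "AE x in unif_cube. \<bar>f x\<bar> \<le> B" using B by (elim exE)
  have [measurable]: "(\<lambda>x. indicator cube x * f x) \<in> borel_measurable borel" using f by (simp only: measurable_on_cube)
  define f' where "f' x = (if \<bar>indicator cube x * f x\<bar> \<le> B then indicator cube x * f x else 0)" for x
  have "bounded_borel f'"
  proof (rule bounded_borelI[where B = "max B 0"])
    show "f' \<in> borel_measurable borel" unfolding f'_def[abs_def] by measurable
    show "\<bar>f' x\<bar> \<le> max B 0" for x by (auto simp: f'_def)
  qed
  moreover have "AE x in unif_cube. f x = f' x"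
    using B AE_in_cube by eventually_elim (simp add: f'_def)
  ultimately show ?thesis by blast
qed

text \<open>Passes from functions that matter on the cube only to bounded Borel representatives on
  the whole space; the factor \<open>2 ^ CARD('n)\<close> between the two measures occurs on both
  sides.\<close>

lemma weak_partial_of_integrals:
  fixes f f' g g' :: "real ^ 'n \<Rightarrow> real"
  assumes fg: "\<And>u. (\<And>i. bump_like (u i)) \<Longrightarrow>
      (\<integral>x. f x * prod_fun (u(k := deriv (u k))) x \<partial>lborel_cube) = - (\<integral>x. g x * prod_fun u x \<partial>lborel_cube)"
    and meas: "f \<in> borel_measurable lborel_cube" "g \<in> borel_measurable lborel_cube"
    and f': "bounded_borel f'" "AE x in unif_cube. f x = f' x"
    and g': "bounded_borel g'" "AE x in unif_cube. g x = g' x"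
  shows "weak_partial f' k g'"
  unfolding weak_partial_def
proof (intro allI impI)
  fix u :: "'n \<Rightarrow> real \<Rightarrow> real" assume "\<forall>i. bump_like (u i)"
  then have u: "bump_like (u i)" for i by simp
  have v: "bump_like ((u(k := deriv (u k))) i)" for i using u by (simp add: bump_like_deriv)
  note [measurable] = bounded_borel_measurable[OF f'(1)] bounded_borel_measurable[OF g'(1)]
    bounded_borel_measurable[OF prod_fun_bounded_borel[of u, OF u]]
    bounded_borel_measurable[OF prod_fun_bounded_borel[of "u(k := deriv (u k))", OF v]]
  have cong: "(\<integral>x. p' x * w x \<partial>unif_cube) = (\<integral>x. p x * w x \<partial>lborel_cube) / 2 ^ CARD('n)"
    if p: "p \<in> borel_measurable lborel_cube" and p': "p' \<in> borel_measurable borel" and w: "w \<in> borel_measurable borel"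
      and eq: "AE x in unif_cube. p x = p' x" for p p' w :: "real ^ 'n \<Rightarrow> real"
  proof -
    note [measurable] = p p' w
    have m: "p' \<in> borel_measurable lborel_cube" "w \<in> borel_measurable lborel_cube"
      unfolding measurable_on_cube by measurable
    have "(\<integral>x. p' x * w x \<partial>unif_cube) = (\<integral>x. p' x * w x \<partial>lborel_cube) / 2 ^ CARD('n)"
      by (rule integral_unif_cube) measurable
    also have "(\<integral>x. p' x * w x \<partial>lborel_cube) = (\<integral>x. p x * w x \<partial>lborel_cube)"
    proof (rule integral_cong_AE)
      show "AE x in lborel_cube. p' x * w x = p x * w x"
        using eq unfolding AE_lborel_cube_iff by (rule eventually_mono) simp
    qed (use m p in \<open>auto intro: borel_measurable_times\<close>)
    finally show ?thesis .
  qed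
  show "(\<integral>x. f' x * prod_fun (u(k := deriv (u k))) x \<partial>unif_cube) = - (\<integral>x. g' x * prod_fun u x \<partial>unif_cube)"
    using fg[of u, OF u]
    by (simp add: cong[OF meas(1) bounded_borel_measurable[OF f'(1)] _ f'(2)]
        cong[OF meas(2) bounded_borel_measurable[OF g'(1)] _ g'(2)])
qed

lemma sobolev_lipschitz:
  fixes f :: "real ^ 'n \<Rightarrow> real"
  assumes f: "sobolev_inf m f" "m \<ge> 1"
  shows "\<exists>F L g. L-lipschitz_on cube F \<and> (AE x in unif_cube. f x = F x) \<and>
    (\<forall>k. line_deriv F k (g k) \<and> (AE x in unif_cube. weak_deriv [k] f x = g k x))"
proof -
  have mf: "f \<in> borel_measurable lborel_cube" using f by (simp add: sobolev_inf_def)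
  have wd: "has_weak_deriv f [k] (weak_deriv [k] f)" for k using f by (intro sobolev_weak_deriv) auto
  then have mw: "weak_deriv [k] f \<in> borel_measurable lborel_cube" for k
    by (auto simp: has_weak_deriv_def locally_integrable_def)
  obtain f' where f': "bounded_borel f'" "AE x in unif_cube. f x = f' x"
    using bounded_borel_representative[OF mf sobolev_bounded[OF f(1)]] by (elim exE conjE)
  have "\<forall>k. \<exists>g. bounded_borel g \<and> (AE x in unif_cube. weak_deriv [k] f x = g x)"
    using f by (intro allI bounded_borel_representative mw sobolev_weak_deriv) auto
  from choice[OF this] obtain g where
    g: "\<forall>k. bounded_borel (g k) \<and> (AE x in unif_cube. weak_deriv [k] f x = g k x)" by (rule exE)
  have "weak_partial f' k (g k)" for k
  proof (rule weak_partial_of_integrals[OF _ mf mw f' conjunct1[OF spec[OF g]] conjunct2[OF spec[OF g]]])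
    fix u :: "'n \<Rightarrow> real \<Rightarrow> real" assume u: "\<And>i. bump_like (u i)"
    have "iter_partial [k] (prod_fun u) = prod_fun (u(k := deriv (u k)))"
      using partial_deriv_prod_fun[of u k, OF bump_like_smooth[OF u]] by (simp add: iter_partial_def)
    then show "(\<integral>x. f x * prod_fun (u(k := deriv (u k))) x \<partial>lborel_cube) = - (\<integral>x. weak_deriv [k] f x * prod_fun u x \<partial>lborel_cube)"
      using has_weak_derivD[OF wd test_function_prod_fun[of u, OF u], of k] by simp
  qed
  from lipschitz_representative[OF f'(1) conjunct1[OF spec[OF g]] this]
  obtain F L where F: "L-lipschitz_on cube F" "AE x in unif_cube. f' x = F x" "\<forall>k. line_deriv F k (g k)"
    by (elim exE conjE)
  from f'(2) F(2) have "AE x in unif_cube. f x = F x" by eventually_elim simp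
  with F g show ?thesis by (intro exI[of _ F] exI[of _ L] exI[of _ g]) simp
qed

text \<open>In the list \<open>[j, k]\<close> the derivative in direction \<open>k\<close> is
  applied first, and it turns a product test function into another one. So the second-order identity
  for \<open>f\<close> says that \<open>weak_deriv [j, k] f\<close> is the weak derivative in
  direction \<open>k\<close> of \<open>weak_deriv [j] f\<close>, which therefore has a Lipschitz
  representative.\<close>

lemma sobolev2_deriv_lipschitz:
  fixes f :: "real ^ 'n \<Rightarrow> real"
  assumes f: "sobolev_inf 2 f"
  shows "\<exists>G L. L-lipschitz_on cube G \<and> (AE x in unif_cube. weak_deriv [j] f x = G x)"
proof -
  define w where "w = weak_deriv [j] f"
  have wd: "has_weak_deriv f [j] w" unfolding w_def using f by (intro sobolev_weak_deriv) auto
  then have mw: "w \<in> borel_measurable lborel_cube" by (auto simp: has_weak_deriv_def locally_integrable_def)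
  have wd2: "has_weak_deriv f [j, k] (weak_deriv [j, k] f)" for k using f by (intro sobolev_weak_deriv) auto
  then have mw2: "weak_deriv [j, k] f \<in> borel_measurable lborel_cube" for k
    by (auto simp: has_weak_deriv_def locally_integrable_def)
  have "\<exists>B. AE x in unif_cube. \<bar>w x\<bar> \<le> B" unfolding w_def using f by (intro sobolev_weak_deriv) auto
  from bounded_borel_representative[OF mw this] obtain w' where
    w': "bounded_borel w'" "AE x in unif_cube. w x = w' x" by (elim exE conjE)
  have "\<forall>k. \<exists>g. bounded_borel g \<and> (AE x in unif_cube. weak_deriv [j, k] f x = g x)"
    using f by (intro allI bounded_borel_representative mw2 sobolev_weak_deriv) auto
  from choice[OF this] obtain g where
    g: "\<forall>k. bounded_borel (g k) \<and> (AE x in unif_cube. weak_deriv [j, k] f x = g k x)" by (rule exE)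
  have "weak_partial w' k (g k)" for k
  proof (rule weak_partial_of_integrals[OF _ mw mw2 w' conjunct1[OF spec[OF g]] conjunct2[OF spec[OF g]]])
    fix u :: "'n \<Rightarrow> real \<Rightarrow> real" assume u: "\<And>i. bump_like (u i)"
    let ?v = "u(k := deriv (u k))"
    have v: "bump_like (?v i)" for i using u by (simp add: bump_like_deriv)
    have pk: "partial_deriv k (prod_fun u) = prod_fun ?v"
      using partial_deriv_prod_fun[of u k, OF bump_like_smooth[OF u]] .
    have "iter_partial [j, k] (prod_fun u) = iter_partial [j] (prod_fun ?v)"
      by (simp add: iter_partial_def pk)
    moreover have "(\<integral>x. f x * iter_partial [j, k] (prod_fun u) x \<partial>lborel_cube) = (\<integral>x. weak_deriv [j, k] f x * prod_fun u x \<partial>lborel_cube)"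
      using has_weak_derivD[OF wd2 test_function_prod_fun[of u, OF u], of k] by simp
    moreover have "(\<integral>x. f x * iter_partial [j] (prod_fun ?v) x \<partial>lborel_cube) = - (\<integral>x. w x * prod_fun ?v x \<partial>lborel_cube)"
      using has_weak_derivD[OF wd test_function_prod_fun[of ?v, OF v]] by simp
    ultimately show "(\<integral>x. w x * prod_fun ?v x \<partial>lborel_cube) = - (\<integral>x. weak_deriv [j, k] f x * prod_fun u x \<partial>lborel_cube)"
      by simp
  qed
  from lipschitz_representative[OF w'(1) conjunct1[OF spec[OF g]] this]
  obtain G L where G: "L-lipschitz_on cube G" "AE x in unif_cube. w' x = G x" by (elim exE conjE)
  from w'(2) G(2) have "AE x in unif_cube. w x = G x" by eventually_elim simp
  with G(1) show ?thesis unfolding w_def by (intro exI[of _ G] exI[of _ L]) simp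
qed

section \<open>Pointwise bounds extracted from the norms\<close>

lemma esssup_nonneg:
  fixes f :: "real ^ 'n \<Rightarrow> ereal"
  assumes "\<And>x. 0 \<le> f x"
  shows "0 \<le> esssup lborel_cube f"
proof -
  have "AE x in unif_cube. f x \<le> esssup lborel_cube f"
    using esssup_AE[of f lborel_cube] by (simp only: AE_lborel_cube_iff)
  from unif_cube_dense[OF this, of 0 1] obtain x where "f x \<le> esssup lborel_cube f"
    by (auto simp: mem_box_cart)
  with assms[of x] show ?thesis by (rule order_trans)
qed

lemma sobolev_norm_1:
  fixes f :: "real ^ 'n \<Rightarrow> real"
  shows "0 \<le> sobolev_norm 1 f"
    and "AE x in unif_cube. ereal \<bar>weak_deriv [] f x\<bar> \<le> sobolev_norm 1 f"
    and "AE x in unif_cube. ereal \<bar>weak_deriv [k] f x\<bar> \<le> sobolev_norm 1 f"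
proof -
  define s where "s j x = ereal (sqrt (\<Sum>\<alpha> | length \<alpha> = j. (weak_deriv \<alpha> f x)\<^sup>2))" for j x
  have s0: "0 \<le> s j x" for j x unfolding s_def by (simp add: sum_nonneg)
  have n: "sobolev_norm 1 f = esssup lborel_cube (s 0) + esssup lborel_cube (s 1)"
    by (simp add: sobolev_norm_def s_def[abs_def])
  have e0: "0 \<le> esssup lborel_cube (s j)" for j using s0 by (rule esssup_nonneg)
  show "0 \<le> sobolev_norm 1 f" unfolding n using e0 by simp
  have le: "AE x in unif_cube. s j x \<le> esssup lborel_cube (s j)" for j
    using esssup_AE[of "s j" lborel_cube] by (simp only: AE_lborel_cube_iff)
  have bound: "esssup lborel_cube (s 0) \<le> sobolev_norm 1 f" "esssup lborel_cube (s 1) \<le> sobolev_norm 1 f"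
    unfolding n using add_left_mono[OF e0[of 1], of "esssup lborel_cube (s 0)"]
      add_right_mono[OF e0[of 0], of "esssup lborel_cube (s 1)"] by simp_all
  have le': "AE x in unif_cube. s j x \<le> sobolev_norm 1 f" if "esssup lborel_cube (s j) \<le> sobolev_norm 1 f" for j
    using le[of j]
  proof (rule eventually_mono)
    fix x assume "s j x \<le> esssup lborel_cube (s j)"
    then show "s j x \<le> sobolev_norm 1 f" using that by (rule order_trans)
  qed
  have "s 0 x = ereal \<bar>weak_deriv [] f x\<bar>" for x by (simp add: s_def)
  then show "AE x in unif_cube. ereal \<bar>weak_deriv [] f x\<bar> \<le> sobolev_norm 1 f" using le'[OF bound(1)] by simp
  have "ereal \<bar>weak_deriv [k] f x\<bar> \<le> s 1 x" for x
  proof -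
    have set: "{\<alpha> :: 'n list. length \<alpha> = 1} = range (\<lambda>k. [k])"
      by (auto simp: length_Suc_conv)
    have "(weak_deriv [k] f x)\<^sup>2 \<le> (\<Sum>\<alpha> | length \<alpha> = 1. (weak_deriv \<alpha> f x)\<^sup>2)"
      unfolding set by (rule member_le_sum) auto
    then show ?thesis unfolding s_def by (simp add: real_le_rsqrt)
  qed
  note sle = this
  show "AE x in unif_cube. ereal \<bar>weak_deriv [k] f x\<bar> \<le> sobolev_norm 1 f"
    using le'[OF bound(2)]
  proof (rule eventually_mono)
    fix x assume "s 1 x \<le> sobolev_norm 1 f"
    with sle[of x] show "ereal \<bar>weak_deriv [k] f x\<bar> \<le> sobolev_norm 1 f" by (rule order_trans)
  qed
qed

lemma sobolev_norm_map_1: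
  fixes D :: "real ^ 'n \<Rightarrow> real ^ 'n"
  shows "0 \<le> sobolev_norm_map 1 D" "sobolev_norm 1 (\<lambda>x. D x $ i) \<le> sobolev_norm_map 1 D"
proof -
  show "0 \<le> sobolev_norm_map 1 D" unfolding sobolev_norm_map_def by (intro sum_nonneg sobolev_norm_1)
  have "(\<Sum>i\<in>{i}. sobolev_norm 1 (\<lambda>x. D x $ i)) \<le> (\<Sum>i\<in>UNIV. sobolev_norm 1 (\<lambda>x. D x $ i))"
    by (rule sum_mono2) (auto intro: sobolev_norm_1 simp del: One_nat_def)
  then show "sobolev_norm 1 (\<lambda>x. D x $ i) \<le> sobolev_norm_map 1 D" by (simp add: sobolev_norm_map_def)
qed

text \<open>\<open>weak_deriv\<close> of the difference is chosen independently of the two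
  derivatives, so uniqueness has to identify it with their difference before the norm can be
  used.\<close>

lemma sobolev_distance:
  fixes T T' :: "real ^ 'n \<Rightarrow> real ^ 'n"
  assumes T: "sobolev_inf_map m T" "m \<ge> 1" and T': "sobolev_inf_map 1 T'"
  defines "\<delta> \<equiv> sobolev_norm_map 1 (\<lambda>x. T x - T' x)"
  shows "AE x in unif_cube. ereal \<bar>T x $ i - T' x $ i\<bar> \<le> \<delta>"
    and "AE x in unif_cube. ereal \<bar>weak_deriv [k] (\<lambda>x. T x $ i) x - weak_deriv [k] (\<lambda>x. T' x $ i) x\<bar> \<le> \<delta>"
proof -
  let ?f = "\<lambda>x. T x $ i" and ?f' = "\<lambda>x. T' x $ i" and ?d = "\<lambda>x. (T x - T' x) $ i"
  have s: "sobolev_inf m ?f" "sobolev_inf 1 ?f'" using T T' by (auto simp: sobolev_inf_map_def)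
  have le: "sobolev_norm 1 ?d \<le> \<delta>" unfolding \<delta>_def by (rule sobolev_norm_map_1)
  have d: "?d = (\<lambda>x. ?f x - ?f' x)" by simp
  have "locally_integrable ?d"
    unfolding d by (intro locally_integrable_diff sobolev_locally_integrable[OF s(1)] sobolev_locally_integrable[OF s(2)])
  from weak_deriv_Nil_AE[OF this] sobolev_norm_1(2)[of ?d]
  show "AE x in unif_cube. ereal \<bar>T x $ i - T' x $ i\<bar> \<le> \<delta>"
  proof eventually_elim
    case (elim x)
    then have "ereal \<bar>T x $ i - T' x $ i\<bar> \<le> sobolev_norm 1 ?d" by simp
    then show ?case using le by (rule order_trans)
  qed
  have hd: "has_weak_deriv ?d [k] (\<lambda>x. weak_deriv [k] ?f x - weak_deriv [k] ?f' x)"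
    unfolding d
    by (rule has_weak_deriv_diff[OF sobolev_weak_deriv(1)[OF s(1)] sobolev_weak_deriv(1)[OF s(2)]]) (use T(2) in simp_all)
  then have "has_weak_deriv ?d [k] (weak_deriv [k] ?d)" by (rule has_weak_deriv_weak_deriv)
  from weak_deriv_unique[OF this hd] sobolev_norm_1(3)[of k ?d]
  show "AE x in unif_cube. ereal \<bar>weak_deriv [k] ?f x - weak_deriv [k] ?f' x\<bar> \<le> \<delta>"
  proof eventually_elim
    case (elim x)
    from elim(2) have "ereal \<bar>weak_deriv [k] ?f x - weak_deriv [k] ?f' x\<bar> \<le> sobolev_norm 1 ?d"
      by (simp only: elim(1))
    then show ?case using le by (rule order_trans)
  qed
qed

lemma diag_min_AE:
  fixes S :: "real ^ 'n \<Rightarrow> real ^ 'n"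
  assumes "ereal \<tau> \<le> diag_min S"
  shows "AE x in unif_cube. \<tau> \<le> weak_deriv [j] (\<lambda>x. S x $ j) x"
proof -
  let ?w = "weak_deriv [j] (\<lambda>x. S x $ j)"
  have "diag_min S \<le> essinf_cube ?w" unfolding diag_min_def by (rule Min_le) auto
  with assms have "ereal \<tau> \<le> - esssup lborel_cube (\<lambda>x. - ereal (?w x))" unfolding essinf_cube_def by (rule order_trans)
  then have le: "esssup lborel_cube (\<lambda>x. - ereal (?w x)) \<le> - ereal \<tau>"
    using ereal_minus_le_minus[of "- esssup lborel_cube (\<lambda>x. - ereal (?w x))" "ereal \<tau>"]
    by (simp only: ereal_uminus_uminus)
  have "AE x in unif_cube. - ereal (?w x) \<le> esssup lborel_cube (\<lambda>x. - ereal (?w x))"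
    using esssup_AE[of "\<lambda>x. - ereal (?w x)" lborel_cube] by (simp only: AE_lborel_cube_iff)
  then show ?thesis
  proof (rule eventually_mono)
    fix x assume "- ereal (?w x) \<le> esssup lborel_cube (\<lambda>x. - ereal (?w x))"
    then have "- ereal (?w x) \<le> - ereal \<tau>" using le by (rule order_trans)
    then show "\<tau> \<le> ?w x" by simp
  qed
qed

section \<open>Densities of the pushforwards\<close>

locale tri_pair = U: tri_map U J + V: tri_map V K
  for U V :: "(real, 'n::{finite,linorder}) vec \<Rightarrow> (real, 'n) vec"
    and J K :: "'n \<Rightarrow> (real, 'n) vec \<Rightarrow> real" +
  assumes UV: "\<And>x. x \<in> cube \<Longrightarrow> U (V x) = x" and VU: "\<And>x. x \<in> cube \<Longrightarrow> V (U x) = x"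
begin

text \<open>The locale is symmetric, so that each fact about \<open>U\<close> yields its counterpart
  for \<open>V\<close>.\<close>

lemma flip: "tri_pair V U K J"
  by unfold_locales (fact VU UV)+

lemma cov:
  assumes "h \<in> borel_measurable borel"
  shows "(\<integral>\<^sup>+x. h (U x) * prod_ind J UNIV x \<partial>unif_cube) = (\<integral>\<^sup>+x. h x \<partial>unif_cube)"
  by (rule U.cov_eq[OF assms])
    (rule triangular_inverse_ends[OF U.U_cube V.U_cube UV VU U.U_tri V.U_tri U.U_mono]; assumption)+

lemma cov_V:
  assumes "h \<in> borel_measurable borel"
  shows "(\<integral>\<^sup>+x. h (V x) * prod_ind K UNIV x \<partial>unif_cube) = (\<integral>\<^sup>+x. h x \<partial>unif_cube)"
  using tri_pair.cov[OF flip assms] .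

text \<open>Replaces the chain rule: changing variables along \<open>U\<close> and then along
  \<open>V\<close> reproduces the measure of every Borel set, so the product of the Jacobians is a
  density of \<open>unif_cube\<close> with respect to itself.\<close>

lemma jacobian_inverse: "AE x in unif_cube. prod_ind K UNIV (U x) * prod_ind J UNIV x = 1"
proof -
  have "density unif_cube (\<lambda>x. prod_ind K UNIV (U x) * prod_ind J UNIV x) = density unif_cube (\<lambda>x. 1)"
  proof (rule measure_eqI)
    fix A assume "A \<in> sets (density unif_cube (\<lambda>x. prod_ind K UNIV (U x) * prod_ind J UNIV x))"
    then have [measurable]: "A \<in> sets borel" by simp
    have "emeasure (density unif_cube (\<lambda>x. prod_ind K UNIV (U x) * prod_ind J UNIV x)) A
        = (\<integral>\<^sup>+x. (prod_ind K UNIV (U x) * prod_ind J UNIV x) * indicator A x \<partial>unif_cube)"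
      by (subst emeasure_density) auto
    also have "\<dots> = (\<integral>\<^sup>+x. (indicator A (V (U x)) * prod_ind K UNIV (U x)) * prod_ind J UNIV x \<partial>unif_cube)"
    proof (rule nn_integral_cong_AE)
      show "AE x in unif_cube. (prod_ind K UNIV (U x) * prod_ind J UNIV x) * indicator A x
          = (indicator A (V (U x)) * prod_ind K UNIV (U x)) * prod_ind J UNIV x"
        using AE_in_cube by eventually_elim (simp add: VU mult_ac)
    qed
    also have "\<dots> = (\<integral>\<^sup>+y. indicator A (V y) * prod_ind K UNIV y \<partial>unif_cube)"
      by (rule cov) measurable
    also have "\<dots> = (\<integral>\<^sup>+x. indicator A x \<partial>unif_cube)"
      by (rule cov_V) measurable
    also have "\<dots> = emeasure (density unif_cube (\<lambda>x. 1)) A"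
      by (subst emeasure_density) auto
    finally show "emeasure (density unif_cube (\<lambda>x. prod_ind K UNIV (U x) * prod_ind J UNIV x)) A
        = emeasure (density unif_cube (\<lambda>x. 1)) A" .
  qed simp
  then show ?thesis
    by (intro sigma_finite_measure.density_unique[OF unif_cube.sigma_finite_measure_axioms]) auto
qed

lemma jacobian_inverse_V: "AE x in unif_cube. prod_ind J UNIV (V x) * prod_ind K UNIV x = 1"
  using tri_pair.jacobian_inverse[OF flip] .

text \<open>The change of variables shows that the Jacobian vanishes almost everywhere on the
  preimage of a null set, while by \<open>jacobian_inverse\<close> it vanishes almost
  nowhere.\<close>

lemma nonsingular:
  assumes "AE y in unif_cube. P y"
  shows "AE x in unif_cube. P (U x)"
proof -
  obtain N where N: "{y \<in> space unif_cube. \<not> P y} \<subseteq> N" "N \<in> null_sets unif_cube"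
    using assms unfolding eventually_ae_filter by blast
  have [measurable]: "N \<in> sets borel" using N(2) by auto
  have "(\<integral>\<^sup>+x. indicator N (U x) * prod_ind J UNIV x \<partial>unif_cube) = (\<integral>\<^sup>+x. indicator N x \<partial>unif_cube)"
    by (rule cov) measurable
  also have "\<dots> = 0" using null_setsD1[OF N(2)] by simp
  finally have "AE x in unif_cube. indicator N (U x) * prod_ind J UNIV x = 0"
    by (subst (asm) nn_integral_0_iff_AE) auto
  with jacobian_inverse show ?thesis
  proof eventually_elim
    case (elim x)
    then have "prod_ind J UNIV x \<noteq> 0" by auto
    then have "U x \<notin> N" using elim(2) by (auto simp: indicator_def split: if_splits)
    then show ?case using N(1) by auto
  qed
qed

lemma nonsingular_V: "AE y in unif_cube. P y \<Longrightarrow> AE x in unif_cube. P (V x)"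
  using tri_pair.nonsingular[OF flip] .

text \<open>The comparison of densities is carried out at the points \<open>U x\<close>, where the
  Jacobians of the two directions cancel; this brings the result back to almost every point.\<close>

lemma AE_from_image:
  assumes "AE x in unif_cube. P (U x)"
  shows "AE y in unif_cube. P y"
  using nonsingular_V[OF assms] AE_in_cube by eventually_elim (simp add: UV)

lemma prod_ind_eq_prod: "AE x in unif_cube. prod_ind J UNIV x = ennreal (\<Prod>j\<in>UNIV. J j x) \<and> (\<forall>j. 0 \<le> J j x)"
proof -
  have "AE x in unif_cube. \<forall>j\<in>UNIV. 0 \<le> J j x" using U.J_nonneg by (subst AE_finite_all) auto
  then show ?thesis by (rule eventually_mono) (simp add: prod_ind_def prod_ennreal)
qed

text \<open>\<open>T\<close> and \<open>U\<close> have the same preimages up to null sets; the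
  change of variables along the inverse \<open>V\<close> then moves the integral to the image
  side.\<close>

lemma push_density:
  assumes TU: "AE x in unif_cube. T x = U x"
    and T: "T \<in> measurable mu (restrict_space borel cube)"
    and f [measurable]: "f \<in> borel_measurable borel"
  shows "push T (density mu f) = density mu (\<lambda>y. f (V y) * prod_ind K UNIV y)"
proof (rule measure_eqI)
  have sm: "sets mu = sets (restrict_space borel (cube :: (real, 'n) vec set))"
    unfolding mu_eq by (rule sets_restrict_space_cong) simp
  show "sets (push T (density mu f)) = sets (density mu (\<lambda>y. f (V y) * prod_ind K UNIV y))"
    using sm by simp
  fix A assume "A \<in> sets (push T (density mu f))"
  then have A: "A \<in> sets (restrict_space borel (cube :: (real, 'n) vec set))" by simp
  then have A' [measurable]: "A \<in> sets borel" and sub: "A \<subseteq> cube" by (auto simp: sets_restrict_space_iff)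
  have res: "g \<in> borel_measurable mu" if "g \<in> borel_measurable borel" for g :: "(real, 'n) vec \<Rightarrow> ennreal"
    unfolding mu_eq by (rule measurable_restrict_space1) (use that in simp)
  have nn: "(\<integral>\<^sup>+x. g x \<partial>mu) = (\<integral>\<^sup>+x. g x * indicator cube x \<partial>unif_cube)" for g :: "(real, 'n) vec \<Rightarrow> ennreal"
    unfolding mu_eq by (rule nn_integral_restrict_space) simp
  have sp: "space mu = (cube :: (real, 'n) vec set)" by (simp add: mu_eq space_restrict_space)
  have TA: "T -` A \<inter> space mu \<in> sets mu" using T A by (rule measurable_sets)
  have T': "T \<in> measurable (density mu f) (restrict_space borel cube)" using T by simp
  have "emeasure (push T (density mu f)) A = emeasure (density mu f) (T -` A \<inter> space mu)"
    by (subst emeasure_distr[OF T' A]) simp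
  also have "\<dots> = (\<integral>\<^sup>+x. f x * indicator (T -` A \<inter> space mu) x \<partial>mu)"
    by (rule emeasure_density[OF res[OF f] TA])
  also have "\<dots> = (\<integral>\<^sup>+x. f x * indicator A (U x) \<partial>unif_cube)"
    unfolding nn
  proof (rule nn_integral_cong_AE)
    show "AE x in unif_cube. f x * indicator (T -` A \<inter> space mu) x * indicator cube x = f x * indicator A (U x)"
      using TU AE_in_cube by eventually_elim (auto simp: indicator_def sp)
  qed
  also have "\<dots> = (\<integral>\<^sup>+y. (f (V y) * indicator A (U (V y))) * prod_ind K UNIV y \<partial>unif_cube)"
    by (rule cov_V[symmetric]) measurable
  also have "\<dots> = (\<integral>\<^sup>+y. ((f (V y) * prod_ind K UNIV y) * indicator A y) * indicator cube y \<partial>unif_cube)"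
  proof (rule nn_integral_cong_AE)
    show "AE y in unif_cube. (f (V y) * indicator A (U (V y))) * prod_ind K UNIV y
        = ((f (V y) * prod_ind K UNIV y) * indicator A y) * indicator cube y"
      using AE_in_cube by eventually_elim (simp add: UV mult_ac)
  qed
  also have "\<dots> = (\<integral>\<^sup>+y. (f (V y) * prod_ind K UNIV y) * indicator A y \<partial>mu)"
    by (simp only: nn)
  also have "\<dots> = emeasure (density mu (\<lambda>y. f (V y) * prod_ind K UNIV y)) A"
    by (rule emeasure_density[symmetric, OF res]) (use A sm in auto)
  finally show "emeasure (push T (density mu f)) A = emeasure (density mu (\<lambda>y. f (V y) * prod_ind K UNIV y)) A" .
qed

end

section \<open>Lipschitz pairs attached to Sobolev maps\<close>

lemma line_deriv_cong:
  fixes F G :: "real ^ 'n \<Rightarrow> real"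
  assumes F: "line_deriv F k g" and eq: "\<And>x. x \<in> cube \<Longrightarrow> F x = G x"
  shows "line_deriv G k g"
  unfolding line_deriv_def
proof
  show "bounded_borel g" using F by (simp add: line_deriv_def)
  from conjunct2[OF F[unfolded line_deriv_def]] AE_in_cube
  show "AE x in unif_cube. \<forall>a\<in>{-1..1}. \<forall>b\<in>{-1..1}. a \<le> b \<longrightarrow>
      G (vec_upd x k b) - G (vec_upd x k a)
        = 2 * (\<integral>s. (if a < s \<and> s \<le> b then g (vec_upd x k s) else 0) \<partial>unif_interval)"
  proof eventually_elim
    case (elim x)
    then show ?case using eq[OF vec_upd_in_cube[OF elim(2)]] by simp
  qed
qed

lemma sobolev_map_representative:
  fixes T :: "real ^ 'n \<Rightarrow> real ^ 'n"
  assumes T: "sobolev_inf_map m T" "m \<ge> 1"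
  shows "\<exists>U L J. U \<in> borel_measurable borel \<and> L-lipschitz_on cube U \<and> (AE x in unif_cube. T x = U x) \<and>
    (\<forall>j. line_deriv (\<lambda>x. U x $ j) j (J j) \<and> (AE x in unif_cube. weak_deriv [j] (\<lambda>x. T x $ j) x = J j x))"
proof -
  have s: "sobolev_inf m (\<lambda>x. T x $ i)" for i using T(1) by (simp add: sobolev_inf_map_def)
  have "\<forall>i. \<exists>F L g. L-lipschitz_on cube F \<and> (AE x in unif_cube. T x $ i = F x) \<and>
      (\<forall>k. line_deriv F k (g k) \<and> (AE x in unif_cube. weak_deriv [k] (\<lambda>x. T x $ i) x = g k x))"
    using sobolev_lipschitz[OF s T(2)] by (rule allI)
  from choice[OF this] obtain F where "\<forall>i. \<exists>L g. L-lipschitz_on cube (F i) \<and> (AE x in unif_cube. T x $ i = F i x) \<and>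
      (\<forall>k. line_deriv (F i) k (g k) \<and> (AE x in unif_cube. weak_deriv [k] (\<lambda>x. T x $ i) x = g k x))" by (rule exE)
  from choice[OF this] obtain L where "\<forall>i. \<exists>g. (L i)-lipschitz_on cube (F i) \<and> (AE x in unif_cube. T x $ i = F i x) \<and>
      (\<forall>k. line_deriv (F i) k (g k) \<and> (AE x in unif_cube. weak_deriv [k] (\<lambda>x. T x $ i) x = g k x))" by (rule exE)
  from choice[OF this] obtain g where g: "\<forall>i. (L i)-lipschitz_on cube (F i) \<and> (AE x in unif_cube. T x $ i = F i x) \<and>
      (\<forall>k. line_deriv (F i) k (g i k) \<and> (AE x in unif_cube. weak_deriv [k] (\<lambda>x. T x $ i) x = g i k x))" by (rule exE)
  then have F: "(L i)-lipschitz_on cube (F i)" "AE x in unif_cube. T x $ i = F i x"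
    "line_deriv (F i) k (g i k)" "AE x in unif_cube. weak_deriv [k] (\<lambda>x. T x $ i) x = g i k x" for i k
    by blast+
  \<comment> \<open>The value 0 outside the cube makes the map Borel on the whole space.\<close>
  define U where "U x = (if x \<in> cube then (\<chi> i. F i x) else 0)" for x
  have U: "U x $ i = F i x" if "x \<in> cube" for x i using that by (simp add: U_def)
  have lip: "(\<Sum>i\<in>UNIV. L i)-lipschitz_on cube U"
  proof (rule lipschitz_on_vec)
    fix i
    show "(L i)-lipschitz_on cube (\<lambda>x. U x $ i)"
      by (rule lipschitz_on_transform[OF F(1)]) (simp add: U)
  qed
  have "U \<in> borel_measurable borel"
    unfolding U_def[abs_def]
  proof (rule borel_measurable_continuous_on_if)
    show "continuous_on cube (\<lambda>x. \<chi> i. F i x)"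
      by (intro continuous_on_vec_lambda lipschitz_on_continuous_on[OF F(1)])
  qed (auto intro: continuous_on_const)
  moreover have "AE x in unif_cube. T x = U x"
  proof -
    have "AE x in unif_cube. \<forall>i\<in>UNIV. T x $ i = F i x" using F(2) by (subst AE_finite_all) auto
    with AE_in_cube show ?thesis by eventually_elim (simp add: vec_eq_iff U)
  qed
  moreover have "line_deriv (\<lambda>x. U x $ j) j (g j j)" for j
    by (rule line_deriv_cong[OF F(3)]) (simp add: U)
  ultimately show ?thesis using lip F(4)
    by (intro exI[of _ U] exI[of _ "\<Sum>i\<in>UNIV. L i"] exI[of _ "\<lambda>j. g j j"]) simp
qed

text \<open>Here the abstract theory meets the assumptions on a Sobolev map and its inverse; it is
  applied to both maps of the theorem, with \<open>m = 2\<close> and \<open>m = 1\<close>.\<close>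

lemma tri_pair_exists:
  fixes T S :: "(real, 'n::{finite,linorder}) vec \<Rightarrow> (real, 'n) vec"
  assumes bij: "bij_betw T cube cube" and mono: "coord_monotone T" and tri: "triangular T"
    and S: "S = inv_into cube T" and sob: "sobolev_inf_map m T" "sobolev_inf_map m S" "m \<ge> 1"
  shows "\<exists>U V J K L. tri_pair U V J K \<and> L-lipschitz_on cube V \<and> (AE x in unif_cube. T x = U x) \<and>
    (\<forall>j. AE x in unif_cube. weak_deriv [j] (\<lambda>x. T x $ j) x = J j x) \<and>
    (\<forall>j. AE x in unif_cube. weak_deriv [j] (\<lambda>x. S x $ j) x = K j x)"
proof -
  obtain U L1 J where U: "U \<in> borel_measurable borel" "L1-lipschitz_on cube U" "AE x in unif_cube. T x = U x"
    and J: "\<And>j. line_deriv (\<lambda>x. U x $ j) j (J j)" "\<And>j. AE x in unif_cube. weak_deriv [j] (\<lambda>x. T x $ j) x = J j x"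
    using sobolev_map_representative[OF sob(1,3)] by (elim exE conjE) auto
  obtain V L2 K where V: "V \<in> borel_measurable borel" "L2-lipschitz_on cube V" "AE x in unif_cube. S x = V x"
    and K: "\<And>j. line_deriv (\<lambda>x. V x $ j) j (K j)" "\<And>j. AE x in unif_cube. weak_deriv [j] (\<lambda>x. S x $ j) x = K j x"
    using sobolev_map_representative[OF sob(2,3)] by (elim exE conjE) auto
  \<comment> \<open>\<open>triangular_inverse\<close> works with one constant for both maps.\<close>
  have lip: "(max L1 L2)-lipschitz_on cube U" "(max L1 L2)-lipschitz_on cube V"
    using U(2) V(2) by (auto intro: lipschitz_on_mono)
  interpret triangular_inverse T S U V J "max L1 L2"
    by unfold_locales (fact bij S mono tri U(1) V(1) lip U(3) V(3) J(1))+
  have "tri_pair U V J K"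
    by unfold_locales (fact V(1) Sh_cube Sh_cont Sh_tri Sh_mono K(1) Th_Sh_eq Sh_Th_eq)+
  then show ?thesis using V(2) U(3) J(2) K(2) by blast
qed

section \<open>The stability estimate\<close>

lemma prob_space_mu: "prob_space (mu :: (real ^ 'n) measure)"
proof (rule prob_spaceI)
  have "emeasure unif_cube (cube :: (real ^ 'n) set) = 1"
    using AE_in_cube by (intro unif_cube.emeasure_eq_1_AE) auto
  then show "emeasure mu (space (mu :: (real ^ 'n) measure)) = 1"
    by (simp add: mu_eq space_restrict_space emeasure_restrict_space)
qed

lemma AE_mu_iff: "(AE x in mu. P x) \<longleftrightarrow> (AE x in unif_cube. P x)" for P :: "real ^ 'n \<Rightarrow> bool"
proof -
  have "(AE x in mu. P x) \<longleftrightarrow> (AE x in unif_cube. x \<in> cube \<longrightarrow> P x)"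
    unfolding mu_eq by (rule AE_restrict_space_iff) simp
  also have "\<dots> \<longleftrightarrow> (AE x in unif_cube. P x)"
  proof
    assume "AE x in unif_cube. x \<in> cube \<longrightarrow> P x"
    with AE_in_cube show "AE x in unif_cube. P x" by eventually_elim simp
  next
    assume "AE x in unif_cube. P x"
    then show "AE x in unif_cube. x \<in> cube \<longrightarrow> P x" by (rule eventually_mono) simp
  qed
  finally show ?thesis .
qed

text \<open>A relative bound on the densities gives all three estimates with the same constant: by
  integration for the total variation, by its consequence for square roots for the Hellinger
  distance, and by ln r \<le> r - 1 for the divergence, where the ratio r of the densities is at
  most 1 + \<epsilon>.\<close>

lemma density_distances:
  fixes F G :: "real ^ 'n \<Rightarrow> real"
  assumes F [measurable]: "F \<in> borel_measurable mu" and G [measurable]: "G \<in> borel_measurable mu"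
    and prob: "prob_space (density mu (\<lambda>y. ennreal (F y)))" "prob_space (density mu (\<lambda>y. ennreal (G y)))"
    and ae: "AE y in mu. 0 < F y \<and> 0 < G y \<and> \<bar>F y - G y\<bar> \<le> \<epsilon> * G y" and \<epsilon>: "0 \<le> \<epsilon>"
  defines "\<nu>1 \<equiv> density mu (\<lambda>y. ennreal (F y))" and "\<nu>2 \<equiv> density mu (\<lambda>y. ennreal (G y))"
  shows "hellinger \<nu>1 \<nu>2 \<le> ereal \<epsilon>" and "total_var \<nu>1 \<nu>2 \<le> \<epsilon>" and "kl_div \<nu>1 \<nu>2 \<le> ereal \<epsilon>"
proof -
  interpret mu: prob_space "mu :: (real ^ 'n) measure" by (rule prob_space_mu)
  interpret \<nu>1: prob_space \<nu>1 unfolding \<nu>1_def by (rule prob(1))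
  interpret \<nu>2: prob_space \<nu>2 unfolding \<nu>2_def by (rule prob(2))
  have nn: "AE y in mu. 0 \<le> F y" "AE y in mu. 0 \<le> G y"
    using ae by (rule eventually_mono; simp)+
  have int: "integrable mu p" "integral\<^sup>L mu p = 1"
    if p: "prob_space (density mu (\<lambda>y. ennreal (p y)))" "p \<in> borel_measurable mu" "AE y in mu. 0 \<le> p y" for p :: "real ^ 'n \<Rightarrow> real"
  proof -
    note [measurable] = p(2)
    have "emeasure (density mu (\<lambda>y. ennreal (p y))) (space mu) = 1"
      using prob_space.emeasure_space_1[OF p(1)] by simp
    then have n: "(\<integral>\<^sup>+y. ennreal (p y) \<partial>mu) = ennreal 1"
      by (subst (asm) emeasure_density) (auto simp: nn_integral_indicator cong: nn_integral_cong)
    show "integrable mu p" by (rule integrableI_nn_integral_finite[OF p(2,3) n])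
    show "integral\<^sup>L mu p = 1" using integral_eq_nn_integral[OF p(2,3)] n by simp
  qed
  note F_int = int[OF prob(1) F nn(1)] and G_int = int[OF prob(2) G nn(2)]
  have RN1: "AE y in mu. RN_deriv mu \<nu>1 y = ennreal (F y)"
  proof -
    have "AE y in mu. ennreal (F y) = RN_deriv mu \<nu>1 y"
      by (rule mu.RN_deriv_unique) (simp_all add: \<nu>1_def)
    then show ?thesis by (rule eventually_mono) (rule sym)
  qed
  have RN2: "AE y in mu. RN_deriv mu \<nu>2 y = ennreal (G y)"
  proof -
    have "AE y in mu. ennreal (G y) = RN_deriv mu \<nu>2 y"
      by (rule mu.RN_deriv_unique) (simp_all add: \<nu>2_def)
    then show ?thesis by (rule eventually_mono) (rule sym)
  qed
  have ac: "absolutely_continuous mu \<nu>1" "absolutely_continuous mu \<nu>2"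
    unfolding \<nu>1_def \<nu>2_def by (auto intro!: absolutely_continuousI_density)
  \<comment> \<open>The difference is factored through the square roots, and the sum of the roots is
    bounded below by \<open>sqrt b\<close>.\<close>
  have sqrt_bound: "(sqrt a - sqrt b)\<^sup>2 \<le> \<epsilon>\<^sup>2 * b" if "0 < a" "0 < b" "\<bar>a - b\<bar> \<le> \<epsilon> * b" for a b
  proof -
    have "a - b = (sqrt a - sqrt b) * (sqrt a + sqrt b)"
      using that by (simp add: algebra_simps flip: power2_eq_square)
    then have "\<bar>a - b\<bar> = \<bar>sqrt a - sqrt b\<bar> * (sqrt a + sqrt b)"
      using that by (simp add: abs_mult)
    moreover have "\<bar>sqrt a - sqrt b\<bar> * sqrt b \<le> \<bar>sqrt a - sqrt b\<bar> * (sqrt a + sqrt b)"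
      using that by (intro mult_left_mono) auto
    moreover have "\<epsilon> * b = (\<epsilon> * sqrt b) * sqrt b" using that by simp
    ultimately have "\<bar>sqrt a - sqrt b\<bar> * sqrt b \<le> (\<epsilon> * sqrt b) * sqrt b" using that(3) by linarith
    then have "\<bar>sqrt a - sqrt b\<bar> \<le> \<epsilon> * sqrt b" using that by simp
    then have "\<bar>sqrt a - sqrt b\<bar>\<^sup>2 \<le> (\<epsilon> * sqrt b)\<^sup>2" by (intro power_mono) auto
    then show ?thesis using that by (simp add: power_mult_distrib)
  qed
  have "(\<integral>x. (sqrt (enn2real (RN_deriv mu \<nu>1 x)) - sqrt (enn2real (RN_deriv mu \<nu>2 x)))\<^sup>2 \<partial>mu) \<le> (\<integral>x. \<epsilon>\<^sup>2 * G x \<partial>mu)"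
  proof (rule integral_mono_AE')
    show "integrable mu (\<lambda>x. \<epsilon>\<^sup>2 * G x)" using G_int by simp
    show "AE x in mu. 0 \<le> \<epsilon>\<^sup>2 * G x" using nn(2) by (rule eventually_mono) simp
    show "AE x in mu. (sqrt (enn2real (RN_deriv mu \<nu>1 x)) - sqrt (enn2real (RN_deriv mu \<nu>2 x)))\<^sup>2 \<le> \<epsilon>\<^sup>2 * G x"
      using RN1 RN2 ae
    proof eventually_elim
      case (elim x)
      then show ?case using sqrt_bound[of "F x" "G x"] by simp
    qed
  qed
  also have "\<dots> = \<epsilon>\<^sup>2" using G_int by simp
  finally have h: "(\<integral>x. (sqrt (enn2real (RN_deriv mu \<nu>1 x)) - sqrt (enn2real (RN_deriv mu \<nu>2 x)))\<^sup>2 \<partial>mu) \<le> \<epsilon>\<^sup>2" .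
  have "sqrt (1 / 2 * (\<integral>x. (sqrt (enn2real (RN_deriv mu \<nu>1 x)) - sqrt (enn2real (RN_deriv mu \<nu>2 x)))\<^sup>2 \<partial>mu)) \<le> \<epsilon>"
  proof (rule real_le_lsqrt)
    show "1 / 2 * (\<integral>x. (sqrt (enn2real (RN_deriv mu \<nu>1 x)) - sqrt (enn2real (RN_deriv mu \<nu>2 x)))\<^sup>2 \<partial>mu) \<le> \<epsilon>\<^sup>2"
      using h zero_le_power2[of \<epsilon>] by linarith
  qed (use \<epsilon> in auto)
  then show "hellinger \<nu>1 \<nu>2 \<le> ereal \<epsilon>" using ac by (simp add: hellinger_def)
  have meas: "measure (density mu (\<lambda>y. ennreal (p y))) A = (\<integral>x. p x * indicator A x \<partial>mu)"
    if p: "p \<in> borel_measurable mu" "AE y in mu. 0 \<le> p y" and A: "A \<in> sets mu" for p :: "real ^ 'n \<Rightarrow> real" and A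
  proof -
    note [measurable] = p(1) A
    have "(\<integral>x. p x * indicator A x \<partial>mu) = enn2real (\<integral>\<^sup>+x. ennreal (p x * indicator A x) \<partial>mu)"
    proof (rule integral_eq_nn_integral)
      show "AE x in mu. 0 \<le> p x * indicator A x" using p(2) by (rule eventually_mono) simp
    qed measurable
    also have "(\<integral>\<^sup>+x. ennreal (p x * indicator A x) \<partial>mu) = (\<integral>\<^sup>+x. ennreal (p x) * indicator A x \<partial>mu)"
      by (intro nn_integral_cong) (simp add: indicator_def)
    also have "\<dots> = emeasure (density mu (\<lambda>y. ennreal (p y))) A"
      by (subst emeasure_density) auto
    finally show ?thesis by (simp add: measure_def)
  qed
  show "total_var \<nu>1 \<nu>2 \<le> \<epsilon>"
    unfolding total_var_def
  proof (rule cSUP_least)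
    show "sets \<nu>1 \<noteq> {}" using sets.top[of \<nu>1] by blast
    fix A assume "A \<in> sets \<nu>1"
    then have A [measurable]: "A \<in> sets mu" by (simp add: \<nu>1_def)
    have int': "integrable mu (\<lambda>x. F x * indicator A x)" "integrable mu (\<lambda>x. G x * indicator A x)"
      using F_int(1) G_int(1) by (auto intro!: integrable_real_mult_indicator)
    have "measure \<nu>1 A - measure \<nu>2 A = (\<integral>x. F x * indicator A x - G x * indicator A x \<partial>mu)"
      unfolding \<nu>1_def \<nu>2_def using int' by (simp add: meas[OF F nn(1) A] meas[OF G nn(2) A])
    also have "\<bar>\<dots>\<bar> \<le> (\<integral>x. \<bar>F x * indicator A x - G x * indicator A x\<bar> \<partial>mu)"
      by (rule integral_abs_bound)
    also have "\<dots> \<le> (\<integral>x. \<epsilon> * G x \<partial>mu)"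
    proof (rule integral_mono_AE')
      show "integrable mu (\<lambda>x. \<epsilon> * G x)" using G_int by simp
      show "AE x in mu. 0 \<le> \<epsilon> * G x" using nn(2) by (rule eventually_mono) (simp add: \<epsilon>)
      show "AE x in mu. \<bar>F x * indicator A x - G x * indicator A x\<bar> \<le> \<epsilon> * G x"
        using ae by (rule eventually_mono) (auto simp: indicator_def \<epsilon>)
    qed
    also have "\<dots> = \<epsilon>" using G_int by simp
    finally show "\<bar>measure \<nu>1 A - measure \<nu>2 A\<bar> \<le> \<epsilon>" .
  qed
  define R where "R y = F y / G y" for y
  have R [measurable]: "R \<in> borel_measurable mu" unfolding R_def[abs_def] by measurable
  have \<nu>12: "density \<nu>2 (\<lambda>y. ennreal (R y)) = \<nu>1"
  proof -
    have "density \<nu>2 (\<lambda>y. ennreal (R y)) = density mu (\<lambda>y. ennreal (G y) * ennreal (R y))"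
      unfolding \<nu>2_def by (rule density_density_eq) auto
    also have "\<dots> = \<nu>1"
      unfolding \<nu>1_def
    proof (rule density_cong)
      show "AE y in mu. ennreal (G y) * ennreal (R y) = ennreal (F y)"
        using ae by (rule eventually_mono) (simp add: R_def ennreal_mult[symmetric])
    qed auto
    finally show ?thesis .
  qed
  have R\<nu>: "(\<lambda>y. ennreal (R y)) \<in> borel_measurable \<nu>2" by (simp add: \<nu>2_def)
  have "AE y in \<nu>2. ennreal (R y) = RN_deriv \<nu>2 \<nu>1 y"
    by (rule sigma_finite_measure.RN_deriv_unique[OF \<nu>2.sigma_finite_measure_axioms R\<nu> \<nu>12])
  then have RN: "AE y in mu. 0 < G y \<longrightarrow> ennreal (R y) = RN_deriv \<nu>2 \<nu>1 y"
    unfolding \<nu>2_def by (subst (asm) AE_density) auto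
  define D where "D = entropy_density (exp 1) \<nu>2 \<nu>1"
  have D_meas: "D \<in> borel_measurable mu"
    using measurable_entropy_density[of "exp 1" \<nu>2 \<nu>1] by (simp add: D_def \<nu>2_def)
  have FD: "AE y in mu. F y * D y = F y * ln (R y)"
    using RN ae
  proof eventually_elim
    case (elim y)
    then have "RN_deriv \<nu>2 \<nu>1 y = ennreal (R y)" "0 \<le> R y" by (auto simp: R_def)
    then show ?case by (simp add: D_def entropy_density_def log_def)
  qed
  \<comment> \<open>The upper bound yields the estimate. The lower bound, from ln(1/r) \<le> 1/r -
    1, secures integrability of the logarithm, without which \<open>kl_div\<close> is
    infinite.\<close>
  have bounds: "AE y in mu. F y * ln (R y) \<le> \<epsilon> * F y \<and> - G y \<le> F y * ln (R y)"
    using ae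
  proof (rule eventually_mono, elim conjE, intro conjI)
    fix y assume y: "0 < F y" "0 < G y" "\<bar>F y - G y\<bar> \<le> \<epsilon> * G y"
    then have R: "0 < R y" by (simp add: R_def)
    have "F y \<le> (1 + \<epsilon>) * G y" using y(3) by (simp add: algebra_simps abs_le_iff)
    then have "R y \<le> 1 + \<epsilon>" using y(2) by (simp add: R_def pos_divide_le_eq)
    then have "ln (R y) \<le> \<epsilon>" using ln_le_minus_one[OF R] by linarith
    then show "F y * ln (R y) \<le> \<epsilon> * F y" using y(1) by (simp add: mult.commute)
    have "ln (inverse (R y)) \<le> inverse (R y) - 1" using R by (intro ln_le_minus_one) simp
    moreover have "inverse (R y) = G y / F y" by (simp add: R_def)
    ultimately have "1 - G y / F y \<le> ln (R y)" using ln_inverse[of "R y"] by simp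
    then have "F y * (1 - G y / F y) \<le> F y * ln (R y)" using y(1) by (intro mult_left_mono) auto
    moreover have "F y * (1 - G y / F y) = F y - G y" using y(1) by (simp add: field_simps)
    ultimately show "- G y \<le> F y * ln (R y)" using y(1) by linarith
  qed
  have FD_int: "integrable mu (\<lambda>y. F y *\<^sub>R D y)"
  proof (rule Bochner_Integration.integrable_bound)
    show "integrable mu (\<lambda>y. \<epsilon> * F y + G y)" using F_int G_int by simp
    show "AE y in mu. norm (F y *\<^sub>R D y) \<le> norm (\<epsilon> * F y + G y)"
      using bounds FD ae
    proof eventually_elim
      case (elim y)
      then have "0 \<le> \<epsilon> * F y" using \<epsilon> by simp
      moreover have "F y *\<^sub>R D y = F y * ln (R y)" using elim(2) by simp
      ultimately show ?case using elim(1,3) unfolding real_norm_def by linarith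
    qed
  qed (use D_meas in measurable)
  have intD: "integrable \<nu>1 D"
    unfolding \<nu>1_def using FD_int by (subst integrable_density[OF D_meas F nn(1)])
  have "integral\<^sup>L \<nu>1 D = (\<integral>y. F y *\<^sub>R D y \<partial>mu)"
    unfolding \<nu>1_def by (rule integral_density[OF D_meas F nn(1)])
  also have "\<dots> \<le> (\<integral>y. \<epsilon> * F y \<partial>mu)"
  proof (rule integral_mono_AE')
    show "integrable mu (\<lambda>y. \<epsilon> * F y)" using F_int by simp
    show "AE y in mu. 0 \<le> \<epsilon> * F y" using nn(1) by (rule eventually_mono) (simp add: \<epsilon>)
    show "AE y in mu. F y *\<^sub>R D y \<le> \<epsilon> * F y"
      using bounds FD by eventually_elim auto
  qed
  also have "\<dots> = \<epsilon>" using F_int by simp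
  finally have "integral\<^sup>L \<nu>1 D \<le> \<epsilon>" .
  moreover have "absolutely_continuous \<nu>2 \<nu>1"
    using absolutely_continuousI_density[OF R\<nu>] by (simp only: \<nu>12)
  ultimately show "kl_div \<nu>1 \<nu>2 \<le> ereal \<epsilon>"
    using intD by (simp add: kl_div_def KL_divergence_def D_def)
qed

section \<open>Products of Lipschitz functions and of bounded numbers\<close>

lemma lipschitz_bounded:
  fixes f :: "real ^ 'n \<Rightarrow> real"
  assumes "L-lipschitz_on cube f"
  shows "\<exists>B>0. \<forall>x\<in>cube. \<bar>f x\<bar> \<le> B"
proof -
  have "bounded (f ` cube)"
    by (intro compact_imp_bounded compact_continuous_image lipschitz_on_continuous_on[OF assms]) auto
  then obtain B where "B > 0" "\<forall>y\<in>f ` cube. norm y \<le> B" unfolding bounded_pos by blast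
  then show ?thesis by (intro exI[of _ B]) auto
qed

lemma lipschitz_mult:
  fixes f g :: "real ^ 'n \<Rightarrow> real"
  assumes f: "L-lipschitz_on cube f" and g: "M-lipschitz_on cube g"
  shows "\<exists>N. N-lipschitz_on cube (\<lambda>x. f x * g x)"
proof -
  obtain A where A: "A > 0" "\<forall>x\<in>cube. \<bar>f x\<bar> \<le> A" using lipschitz_bounded[OF f] by blast
  obtain B where B: "B > 0" "\<forall>x\<in>cube. \<bar>g x\<bar> \<le> B" using lipschitz_bounded[OF g] by blast
  have nn: "0 \<le> L" "0 \<le> M" using f g by (auto intro: lipschitz_on_nonneg)
  have "(A * M + L * B)-lipschitz_on cube (\<lambda>x. f x * g x)"
  proof (rule lipschitz_onI)
    show "0 \<le> A * M + L * B" using A B nn by simp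
    fix x y :: "real ^ 'n" assume xy: "x \<in> cube" "y \<in> cube"
    have "f x * g x - f y * g y = f x * (g x - g y) + (f x - f y) * g y" by (simp add: algebra_simps)
    then have "\<bar>f x * g x - f y * g y\<bar> \<le> \<bar>f x\<bar> * \<bar>g x - g y\<bar> + \<bar>f x - f y\<bar> * \<bar>g y\<bar>"
      using abs_triangle_ineq[of "f x * (g x - g y)" "(f x - f y) * g y"] by (simp add: abs_mult)
    also have "\<dots> \<le> A * (M * dist x y) + (L * dist x y) * B"
      using A B xy lipschitz_onD[OF f xy] lipschitz_onD[OF g xy] nn
      by (intro add_mono mult_mono) (auto simp: dist_real_def)
    finally show "dist (f x * g x) (f y * g y) \<le> (A * M + L * B) * dist x y"
      by (simp add: dist_real_def algebra_simps)
  qed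
  then show ?thesis by blast
qed

lemma lipschitz_prod:
  fixes f :: "'i \<Rightarrow> real ^ 'n \<Rightarrow> real"
  assumes "finite I" "\<And>i. i \<in> I \<Longrightarrow> \<exists>L. L-lipschitz_on cube (f i)"
  shows "\<exists>L. L-lipschitz_on cube (\<lambda>x. \<Prod>i\<in>I. f i x)"
  using assms
proof (induction I rule: finite_induct)
  case empty
  show ?case by (rule exI[of _ 0]) (simp add: lipschitz_on_constant)
next
  case (insert i I)
  obtain L where L: "L-lipschitz_on cube (f i)" using insert.prems[of i] by auto
  obtain M where M: "M-lipschitz_on cube (\<lambda>x. \<Prod>i\<in>I. f i x)" using insert.IH insert.prems by auto
  show ?case using lipschitz_mult[OF L M] insert.hyps by simp
qed

text \<open>Dividing all factors by \<open>Q\<close> brings them into the unit ball, where the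
  difference of two products is at most the sum of the differences; the gain of 1/Q in each
  difference is given away.\<close>

lemma prod_diff_bound:
  fixes a b :: "'i::finite \<Rightarrow> real"
  assumes Q: "Q \<ge> 1" and a: "\<And>j. \<bar>a j\<bar> \<le> Q" and b: "\<And>j. \<bar>b j\<bar> \<le> Q" and d: "\<And>j. \<bar>a j - b j\<bar> \<le> d"
  shows "\<bar>(\<Prod>j\<in>UNIV. a j) - (\<Prod>j\<in>UNIV. b j)\<bar> \<le> Q ^ CARD('i) * (real CARD('i) * d)"
proof -
  have "\<bar>(\<Prod>j\<in>UNIV. a j / Q) - (\<Prod>j\<in>UNIV. b j / Q)\<bar> \<le> (\<Sum>j\<in>UNIV. \<bar>a j / Q - b j / Q\<bar>)"
    using norm_prod_diff[of UNIV "\<lambda>j. a j / Q" "\<lambda>j. b j / Q"] a b Q by simp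
  also have "\<dots> \<le> (\<Sum>j\<in>(UNIV :: 'i set). d)"
  proof (rule sum_mono)
    fix j
    have "\<bar>a j / Q - b j / Q\<bar> = \<bar>a j - b j\<bar> / Q" using Q by (simp add: diff_divide_distrib[symmetric])
    also have "\<dots> \<le> \<bar>a j - b j\<bar> / 1" using Q by (intro divide_left_mono) auto
    finally show "\<bar>a j / Q - b j / Q\<bar> \<le> d" using d[of j] by simp
  qed
  finally have *: "\<bar>(\<Prod>j\<in>UNIV. a j / Q) - (\<Prod>j\<in>UNIV. b j / Q)\<bar> \<le> real CARD('i) * d" by simp
  have "(\<Prod>j\<in>UNIV. a j) - (\<Prod>j\<in>UNIV. b j) = Q ^ CARD('i) * ((\<Prod>j\<in>UNIV. a j / Q) - (\<Prod>j\<in>UNIV. b j / Q))"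
    using Q by (simp add: prod_dividef algebra_simps)
  then have "\<bar>(\<Prod>j\<in>UNIV. a j) - (\<Prod>j\<in>UNIV. b j)\<bar> = Q ^ CARD('i) * \<bar>(\<Prod>j\<in>UNIV. a j / Q) - (\<Prod>j\<in>UNIV. b j / Q)\<bar>"
    using Q by (simp add: abs_mult)
  then show ?thesis using * Q by (simp add: mult_left_mono)
qed

lemma (in tri_pair) jacobian_inverse_real:
  "AE x in unif_cube. (\<Prod>j\<in>UNIV. K j (U x)) * (\<Prod>j\<in>UNIV. J j x) = 1 \<and> (\<forall>j. 0 \<le> J j x) \<and> (\<forall>j. 0 \<le> K j (U x))"
  using jacobian_inverse prod_ind_eq_prod nonsingular[OF tri_pair.prod_ind_eq_prod[OF flip]]
proof eventually_elim
  case (elim x)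
  then have "ennreal ((\<Prod>j\<in>UNIV. K j (U x)) * (\<Prod>j\<in>UNIV. J j x)) = ennreal 1"
    by (simp add: ennreal_mult prod_nonneg)
  then have "(\<Prod>j\<in>UNIV. K j (U x)) * (\<Prod>j\<in>UNIV. J j x) = 1"
    using elim by (subst (asm) ennreal_inj) (auto intro!: mult_nonneg_nonneg prod_nonneg)
  then show ?case using elim by simp
qed

text \<open>To be read with \<open>p\<close> and \<open>q\<close> the Jacobians of \<open>T\<close>
  and \<open>T'\<close> at \<open>x\<close>, \<open>a\<close> and \<open>b\<close> the Lipschitz
  density at \<open>T x\<close> and \<open>T' x\<close>, \<open>g\<close> the other density at
  \<open>T' x\<close>, and \<open>f\<close> the density of \<open>\<rho>\<close> at
  \<open>x\<close>. The first term of \<open>C\<close> belongs to \<open>d \<le> 1\<close>, the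
  other two to \<open>d > 1\<close>.\<close>

lemma scalar_estimate:
  fixes a b p q f g c B d P1 P2 P3 C :: real
  assumes eq: "g * q = f" "a * p = f" and q: "0 < q" "q \<le> P3" and f: "0 < c" "c \<le> f" and d: "0 \<le> d"
    and B: "0 \<le> B" "\<bar>b\<bar> \<le> B" and P: "0 \<le> P1" "0 \<le> P2" "0 \<le> P3"
    and small: "d \<le> 1 \<Longrightarrow> \<bar>b - a\<bar> * \<bar>p\<bar> \<le> P1 * d" "d \<le> 1 \<Longrightarrow> \<bar>q - p\<bar> \<le> P2 * d"
    and C: "C = (P1 + B * P2) / c + B * P3 / c + 1"
  shows "\<bar>b - g\<bar> \<le> C * d * g"
proof -
  \<comment> \<open>The lower bound \<open>c\<close> of \<open>f\<close> turns absolute errors into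
    relative ones.\<close>
  have le: "t \<le> t / c * f" if "0 \<le> t" for t
  proof -
    have "t / c * c \<le> t / c * f" using that f by (intro mult_left_mono) auto
    then show ?thesis using f by simp
  qed
  have C1: "(P1 + B * P2) / c \<le> C" "B * P3 / c + 1 \<le> C" using C P B f by auto
  have "\<bar>b * q - f\<bar> \<le> C * d * f"
  proof (cases "d \<le> 1")
    case True
    \<comment> \<open>One factor is exchanged at a time, starting from
      \<open>f = a * p\<close>.\<close>
    have "b * q - f = b * (q - p) + (b - a) * p" using eq by (simp add: algebra_simps)
    then have "\<bar>b * q - f\<bar> \<le> \<bar>b\<bar> * \<bar>q - p\<bar> + \<bar>b - a\<bar> * \<bar>p\<bar>"
      using abs_triangle_ineq[of "b * (q - p)" "(b - a) * p"] by (simp add: abs_mult)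
    also have "\<dots> \<le> B * (P2 * d) + P1 * d"
      using B by (intro add_mono[OF mult_mono small(1)[OF True]] small(2)[OF True]) auto
    also have "\<dots> = (P1 + B * P2) * d" by (simp add: algebra_simps)
    also have "\<dots> \<le> (P1 + B * P2) * d / c * f" using P B d by (intro le) simp
    also have "\<dots> = (P1 + B * P2) / c * (d * f)" by simp
    also have "\<dots> \<le> C * (d * f)" using C1(1) d f by (intro mult_right_mono) auto
    finally show ?thesis by (simp add: mult.assoc)
  next
    case False
    have "\<bar>b * q - f\<bar> \<le> \<bar>b\<bar> * q + f" using q f abs_triangle_ineq4[of "b * q" f] by (simp add: abs_mult)
    also have "\<dots> \<le> B * P3 + f" using B q P by (intro add_mono mult_mono) auto
    also have "\<dots> \<le> B * P3 / c * f + f" using le[of "B * P3"] B P by simp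
    also have "\<dots> = (B * P3 / c + 1) * f" by (simp add: algebra_simps)
    also have "\<dots> \<le> C * f" using C1(2) f by (intro mult_right_mono) auto
    also have "\<dots> \<le> C * (d * f)"
    proof (rule mult_left_mono)
      show "f \<le> d * f" using False f mult_right_mono[of 1 d f] by simp
      have "0 \<le> B * P3 / c + 1" using B P f by simp
      then show "0 \<le> C" using C1(2) by linarith
    qed
    finally show ?thesis by (simp add: mult.assoc)
  qed
  then have "\<bar>b - g\<bar> * q \<le> (C * d * g) * q"
  proof -
    have "\<bar>b - g\<bar> * q = \<bar>(b - g) * q\<bar>" using q by (simp add: abs_mult)
    also have "(b - g) * q = b * q - f" using eq(1) by (simp add: left_diff_distrib)
    finally have "\<bar>b - g\<bar> * q = \<bar>b * q - f\<bar>" .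
    moreover have "(C * d * g) * q = C * d * f" unfolding eq(1)[symmetric] by (simp only: mult.assoc)
    ultimately show ?thesis using \<open>\<bar>b * q - f\<bar> \<le> C * d * f\<close> by (simp only:)
  qed
  then show ?thesis using q by simp
qed

text \<open>Origin of the terms of \<open>C\<close>: the images of a point under \<open>U\<close>
  and \<open>U'\<close> differ by at most \<open>CARD('n) * d\<close> in the l1-norm, which
  \<open>H\<close> multiplies by \<open>L\<close>, and the Jacobian of \<open>U\<close> is at most
  \<open>M ^ CARD('n)\<close>; for \<open>d \<le> 1\<close> the diagonal derivatives of
  \<open>U'\<close> are bounded by \<open>M + 1\<close>; the Jacobian of \<open>U'\<close> is the
  reciprocal of a product of factors that are at least \<open>\<tau>\<close>.\<close>

lemma pushforward_density_estimate:
  fixes f :: "(real, 'n::{finite,linorder}) vec \<Rightarrow> real"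
  assumes pair: "tri_pair U V J K" and pair': "tri_pair U' V' J' K'"
    and f: "0 < c" "\<And>x. x \<in> cube \<Longrightarrow> c \<le> f x"
    and H: "L-lipschitz_on cube H" "AE y in unif_cube. f (V y) * (\<Prod>j\<in>UNIV. K j y) = H y"
    and B: "0 \<le> B" "\<And>y. y \<in> cube \<Longrightarrow> \<bar>H y\<bar> \<le> B"
    and M: "1 \<le> M" "\<And>j x. \<bar>J j x\<bar> \<le> M"
    and d: "0 \<le> d" "\<And>i. AE x in unif_cube. \<bar>U x $ i - U' x $ i\<bar> \<le> d" "\<And>j. AE x in unif_cube. \<bar>J j x - J' j x\<bar> \<le> d"
    and \<tau>: "0 < \<tau>" "\<And>j. AE y in unif_cube. \<tau> \<le> K' j y"
    and C: "C = (L * real CARD('n) * M ^ CARD('n) + B * ((M + 1) ^ CARD('n) * real CARD('n))) / c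
      + B * (1 / \<tau>) ^ CARD('n) / c + 1"
  shows "AE y in unif_cube. \<bar>f (V y) * (\<Prod>j\<in>UNIV. K j y) - f (V' y) * (\<Prod>j\<in>UNIV. K' j y)\<bar>
    \<le> C * d * (f (V' y) * (\<Prod>j\<in>UNIV. K' j y))"
proof (rule tri_pair.AE_from_image[OF pair'])
  interpret P: tri_pair U V J K by (rule pair)
  interpret Q: tri_pair U' V' J' K' by (rule pair')
  have L: "0 \<le> L" using H(1) by (rule lipschitz_on_nonneg)
  have "AE x in unif_cube. \<forall>i\<in>UNIV. \<bar>U x $ i - U' x $ i\<bar> \<le> d" using d(2) by (subst AE_finite_all) auto
  moreover have "AE x in unif_cube. \<forall>i\<in>UNIV. \<bar>J i x - J' i x\<bar> \<le> d" using d(3) by (subst AE_finite_all) auto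
  moreover have "AE y in unif_cube. \<forall>i\<in>UNIV. \<tau> \<le> K' i y" using \<tau>(2) by (subst AE_finite_all) auto
  then have "AE x in unif_cube. \<forall>i\<in>UNIV. \<tau> \<le> K' i (U' x)" by (rule Q.nonsingular)
  moreover note P.jacobian_inverse_real Q.jacobian_inverse_real P.nonsingular[OF H(2)] Q.nonsingular[OF H(2)] AE_in_cube
  ultimately show "AE x in unif_cube. \<bar>f (V (U' x)) * (\<Prod>j\<in>UNIV. K j (U' x)) - f (V' (U' x)) * (\<Prod>j\<in>UNIV. K' j (U' x))\<bar>
    \<le> C * d * (f (V' (U' x)) * (\<Prod>j\<in>UNIV. K' j (U' x)))"
  proof eventually_elim
    case (elim x)
    note dU = elim(1) and dJ = elim(2) and K' = elim(3) and jP = elim(4) and jQ = elim(5) and HU = elim(6) and HU' = elim(7) and x = elim(8)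
    let ?p = "\<Prod>j\<in>UNIV. J j x" and ?q = "\<Prod>j\<in>UNIV. J' j x" and ?k = "\<Prod>j\<in>UNIV. K' j (U' x)"
    have kq: "?k * ?q = 1" using jQ by simp
    have k: "\<tau> ^ CARD('n) \<le> ?k" using prod_mono[of UNIV "\<lambda>_. \<tau>" "\<lambda>j. K' j (U' x)"] K' \<tau>(1) by simp
    have q0: "0 \<le> ?q" using jQ by (intro prod_nonneg) auto
    have "?q \<noteq> 0" using kq by (metis mult_zero_right zero_neq_one)
    then have q: "0 < ?q" using q0 by linarith
    have "\<tau> ^ CARD('n) * ?q \<le> 1" using mult_right_mono[OF k q0] kq by simp
    then have qle: "?q \<le> (1 / \<tau>) ^ CARD('n)" using \<tau>(1) by (simp add: power_one_over field_simps)
    have "\<bar>H (U' x) - f (V' (U' x)) * ?k\<bar> \<le> C * d * (f (V' (U' x)) * ?k)"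
    proof (rule scalar_estimate[OF _ _ q qle f(1) f(2)[OF x] d(1) B(1) B(2)[OF Q.U.U_cube[OF x]] _ _ _ _ _ C])
      show "f (V' (U' x)) * ?k * ?q = f x" using kq Q.VU[OF x] by (simp add: mult.assoc)
      have "H (U x) * ?p = f (V (U x)) * ((\<Prod>j\<in>UNIV. K j (U x)) * ?p)" using HU by (simp add: mult.assoc[symmetric])
      then show "H (U x) * ?p = f x" using jP P.VU[OF x] by simp
      show "0 \<le> L * real CARD('n) * M ^ CARD('n)" "0 \<le> (M + 1) ^ CARD('n) * real CARD('n)" "0 \<le> (1 / \<tau>) ^ CARD('n)"
        using L M \<tau> by auto
    next
      have "dist (U' x) (U x) \<le> (\<Sum>i\<in>UNIV. \<bar>(U' x - U x) $ i\<bar>)"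
        unfolding dist_norm by (rule norm_le_l1_cart)
      also have "\<dots> \<le> (\<Sum>i\<in>(UNIV :: 'n set). d)"
        using dU by (intro sum_mono) (simp add: abs_minus_commute)
      finally have "dist (U' x) (U x) \<le> real CARD('n) * d" by simp
      then have "L * dist (U' x) (U x) \<le> L * (real CARD('n) * d)" using L by (rule mult_left_mono)
      moreover have "dist (H (U' x)) (H (U x)) \<le> L * dist (U' x) (U x)"
        by (rule lipschitz_onD[OF H(1) Q.U.U_cube[OF x] P.U.U_cube[OF x]])
      ultimately have 1: "\<bar>H (U' x) - H (U x)\<bar> \<le> L * (real CARD('n) * d)" by (simp add: dist_real_def)
      have "\<bar>?p\<bar> \<le> (\<Prod>j\<in>(UNIV :: 'n set). M)"
        unfolding abs_prod using M(2) by (intro prod_mono) simp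
      then have "\<bar>?p\<bar> \<le> M ^ CARD('n)" by simp
      with 1 have "\<bar>H (U' x) - H (U x)\<bar> * \<bar>?p\<bar> \<le> L * (real CARD('n) * d) * M ^ CARD('n)"
        using L d(1) by (intro mult_mono) auto
      then show "\<bar>H (U' x) - H (U x)\<bar> * \<bar>?p\<bar> \<le> L * real CARD('n) * M ^ CARD('n) * d" by (simp add: mult_ac)
    next
      assume d1: "d \<le> 1"
      have "\<bar>?q - ?p\<bar> \<le> (M + 1) ^ CARD('n) * (real CARD('n) * d)"
      proof (rule prod_diff_bound)
        show "\<bar>J j x\<bar> \<le> M + 1" for j using M(2)[of j x] by linarith
        have dj: "\<bar>J j x - J' j x\<bar> \<le> d" for j using dJ by blast
        show "\<bar>J' j x\<bar> \<le> M + 1" for j using M(2)[of j x] dj[of j] d1 by linarith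
        show "\<bar>J' j x - J j x\<bar> \<le> d" for j using dj[of j] by (simp add: abs_minus_commute)
      qed (use M in simp)
      then show "\<bar>?q - ?p\<bar> \<le> (M + 1) ^ CARD('n) * real CARD('n) * d" by (simp add: mult.assoc)
    qed
    then show ?case by (simp only: HU')
  qed
qed

lemma sobolev_map_measurable:
  fixes T :: "real ^ 'n \<Rightarrow> real ^ 'n"
  assumes sob: "sobolev_inf_map m T" and cube: "\<And>x. x \<in> cube \<Longrightarrow> T x \<in> cube"
  shows "T \<in> measurable mu (restrict_space borel cube)"
proof (rule measurable_restrict_space2)
  show "T \<in> space mu \<rightarrow> cube" using cube by (simp add: mu_eq space_restrict_space)
  show "T \<in> borel_measurable mu"
  proof (rule borel_measurable_vec)
    fix i
    have "(\<lambda>x. T x $ i) \<in> borel_measurable lborel_cube"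
      using sob by (simp add: sobolev_inf_map_def sobolev_inf_def)
    then have "(\<lambda>x. indicator cube x * T x $ i) \<in> borel_measurable borel" by (simp only: measurable_on_cube)
    then have "(\<lambda>x. indicator cube x * T x $ i) \<in> borel_measurable unif_cube" by simp
    then show "(\<lambda>x. T x $ i) \<in> borel_measurable mu"
      unfolding mu_eq by (subst borel_measurable_restrict_space_iff) simp_all
  qed
qed

lemma (in tri_pair) push_density_real:
  assumes TU: "AE x in unif_cube. T x = U x" and T: "T \<in> measurable mu (restrict_space borel cube)"
    and f: "f \<in> borel_measurable borel" "\<forall>x\<in>cube. 0 < f x"
  defines "F \<equiv> \<lambda>y. f (V y) * (\<Prod>j\<in>UNIV. K j y)"
  shows "push T (density mu (\<lambda>x. ennreal (f x))) = density mu (\<lambda>y. ennreal (F y))"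
    and "F \<in> borel_measurable mu" and "AE y in mu. 0 < F y"
proof -
  note [measurable] = f(1)
  have res: "g \<in> borel_measurable mu" if "g \<in> borel_measurable borel"
    for g :: "(real, 'n) vec \<Rightarrow> 'b::topological_space"
    unfolding mu_eq by (rule measurable_restrict_space1) (use that in simp)
  have [measurable]: "F \<in> borel_measurable borel" unfolding F_def by measurable
  then show Fm: "F \<in> borel_measurable mu" by (rule res)
  have K: "AE y in unif_cube. prod_ind K UNIV y = ennreal (\<Prod>j\<in>UNIV. K j y) \<and> (\<forall>j. 0 \<le> K j y)"
    by (rule tri_pair.prod_ind_eq_prod[OF flip])
  have "push T (density mu (\<lambda>x. ennreal (f x))) = density mu (\<lambda>y. ennreal (f (V y)) * prod_ind K UNIV y)"
    by (rule push_density[OF TU T]) measurable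
  also have "\<dots> = density mu (\<lambda>y. ennreal (F y))"
  proof (rule density_cong)
    show "(\<lambda>y. ennreal (f (V y)) * prod_ind K UNIV y) \<in> borel_measurable mu"
      by (rule res) measurable
    show "(\<lambda>y. ennreal (F y)) \<in> borel_measurable mu" by (rule res) measurable
    have "AE y in unif_cube. ennreal (f (V y)) * prod_ind K UNIV y = ennreal (F y)"
      using K AE_in_cube
    proof eventually_elim
      case (elim y)
      have "0 < f (V y)" by (rule bspec[OF f(2) V.U_cube[OF elim(2)]])
      then show ?case using elim(1) by (simp add: F_def ennreal_mult prod_nonneg)
    qed
    then show "AE y in mu. ennreal (f (V y)) * prod_ind K UNIV y = ennreal (F y)" by (simp only: AE_mu_iff)
  qed
  finally show "push T (density mu (\<lambda>x. ennreal (f x))) = density mu (\<lambda>y. ennreal (F y))" .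
  have "AE y in unif_cube. 0 < F y"
    using K jacobian_inverse_V AE_in_cube
  proof eventually_elim
    case (elim y)
    have "0 < f (V y)" by (rule bspec[OF f(2) V.U_cube[OF elim(3)]])
    \<comment> \<open>The Jacobian of \<open>V\<close> cannot vanish where its product with the
      Jacobian of \<open>U\<close> is 1.\<close>
    moreover have "(\<Prod>j\<in>UNIV. K j y) \<noteq> 0"
    proof
      assume zero: "(\<Prod>j\<in>UNIV. K j y) = 0"
      have "prod_ind K UNIV y = 0" using elim(1) unfolding zero by simp
      then show False using elim(2) by simp
    qed
    moreover have "0 \<le> (\<Prod>j\<in>UNIV. K j y)" using elim(1) by (intro prod_nonneg) auto
    ultimately show ?case unfolding F_def by (intro mult_pos_pos) linarith+
  qed
  then show "AE y in mu. 0 < F y" by (simp only: AE_mu_iff)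
qed

theorem theorem6p3:
  fixes T S :: "real ^ 'n::{finite,linorder} \<Rightarrow> real ^ 'n::{finite,linorder}"
    and \<rho> :: "(real ^ 'n::{finite,linorder}) measure"
    and f\<^sub>\<rho> :: "real ^ 'n::{finite,linorder} \<Rightarrow> real"
    and \<tau>\<^sub>0 :: real
  assumes "bij_betw T cube cube" and "coord_monotone T" and "triangular T"
    and "S = inv_into cube T"
    and "sobolev_inf_map 2 T" and "sobolev_inf_map 2 S"
    and "prob_space \<rho>" and "\<rho> = density mu (\<lambda>x. ennreal (f\<^sub>\<rho> x))"
    and "\<And>x. x \<in> cube \<Longrightarrow> f\<^sub>\<rho> x > 0" and "\<exists>L. L-lipschitz_on cube f\<^sub>\<rho>"
    and "\<tau>\<^sub>0 > 0"
  shows "\<exists>C::real. \<forall>T' S'.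
    bij_betw T' cube cube \<and> coord_monotone T' \<and> triangular T' \<and>
    S' = inv_into cube T' \<and>
    sobolev_inf_map 1 T' \<and> sobolev_inf_map 1 S' \<and>
    jacobian_sup_norm S' < ereal (1 / \<tau>\<^sub>0) \<and> diag_min S' \<ge> ereal \<tau>\<^sub>0 \<longrightarrow>
      (let \<delta> = sobolev_norm_map 1 (\<lambda>x. T x - T' x) in
        hellinger (push T \<rho>) (push T' \<rho>) \<le> ereal C * \<delta> \<and>
        ereal (total_var (push T \<rho>) (push T' \<rho>)) \<le> ereal C * \<delta> \<and>
        kl_div (push T \<rho>) (push T' \<rho>) \<le> ereal C * (\<delta> + \<delta>\<^sup>2))"
proof -
  obtain Lf where Lf: "Lf-lipschitz_on cube f\<^sub>\<rho>" using assms(10) by (elim exE)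
  have f_cont: "continuous_on cube f\<^sub>\<rho>" using Lf by (rule lipschitz_on_continuous_on)
  \<comment> \<open>\<open>f\<^sub>\<rho>\<close> is prescribed on the cube only; the extension by 0
    is Borel on the whole space.\<close>
  define f where "f x = (if x \<in> cube then f\<^sub>\<rho> x else 0)" for x
  have f_eq: "f x = f\<^sub>\<rho> x" if "x \<in> cube" for x using that by (simp add: f_def)
  have f_meas: "f \<in> borel_measurable borel"
    unfolding f_def[abs_def] by (rule borel_measurable_continuous_on_if) (auto intro: f_cont continuous_on_const)
  have "(0 :: (real, 'n) vec) \<in> cube" by (simp add: mem_cube_iff)
  then have "(cube :: (real, 'n) vec set) \<noteq> {}" by (metis empty_iff)
  \<comment> \<open>A positive continuous function on the compact cube is bounded away from 0 by its
    minimum.\<close>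
  then obtain x0 :: "(real, 'n) vec" where x0: "x0 \<in> cube" "\<forall>y\<in>cube. f\<^sub>\<rho> x0 \<le> f\<^sub>\<rho> y"
    by (rule bexE[OF continuous_attains_inf[OF compact_cbox _ f_cont]])
  define c where "c = f\<^sub>\<rho> x0"
  have c: "0 < c" "\<And>x. x \<in> cube \<Longrightarrow> c \<le> f x" using x0 assms(9) by (auto simp: c_def f_eq)
  then have f_pos: "\<forall>x\<in>cube. 0 < f x" by (meson less_le_trans)
  have \<rho>: "\<rho> = density mu (\<lambda>x. ennreal (f x))"
  proof -
    have eq: "f\<^sub>\<rho> x = f x" if "x \<in> space mu" for x using that by (simp add: mu_eq space_restrict_space f_eq)
    have fm: "f \<in> borel_measurable mu"
      unfolding mu_eq by (rule measurable_restrict_space1) (use f_meas in simp)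
    then have "f\<^sub>\<rho> \<in> borel_measurable mu" using measurable_cong[of mu f\<^sub>\<rho> f borel] eq by blast
    then show ?thesis unfolding assms(8) using fm eq by (intro density_cong) auto
  qed
  have "(2 :: nat) \<ge> 1" by simp
  from tri_pair_exists[OF assms(1-6) this] obtain U V J K L where
    pair: "tri_pair U V J K" and V_lip: "L-lipschitz_on cube V" and TU: "AE x in unif_cube. T x = U x"
    and J: "\<forall>j. AE x in unif_cube. weak_deriv [j] (\<lambda>x. T x $ j) x = J j x"
    and K: "\<forall>j. AE x in unif_cube. weak_deriv [j] (\<lambda>x. S x $ j) x = K j x"
    by (elim exE conjE)
  interpret P: tri_pair U V J K by (rule pair)
  have T_meas: "T \<in> measurable mu (restrict_space borel cube)"
    using assms(1) by (intro sobolev_map_measurable[OF assms(5)]) (auto simp: bij_betw_def)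
  define F where "F = (\<lambda>y. f (V y) * (\<Prod>j\<in>UNIV. K j y))"
  have push: "push T \<rho> = density mu (\<lambda>y. ennreal (F y))" "F \<in> borel_measurable mu" "AE y in mu. 0 < F y"
    unfolding F_def \<rho> using P.push_density_real[OF TU T_meas f_meas f_pos] by blast+
  have \<rho>_meas: "T' \<in> measurable \<rho> (restrict_space borel cube)" if "T' \<in> measurable mu (restrict_space borel cube)" for T'
    using that by (simp add: \<rho>)
  txt \<open>The second derivatives of \<open>S\<close> enter only here: the density of \<open>push T \<rho>\<close> is Lipschitz.\<close>
  obtain H M where H: "M-lipschitz_on cube H" "AE y in unif_cube. F y = H y"
  proof -
    have "\<forall>j. \<exists>G. (\<exists>L. L-lipschitz_on cube G) \<and> (AE x in unif_cube. weak_deriv [j] (\<lambda>x. S x $ j) x = G x)"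
      using assms(6) sobolev2_deriv_lipschitz by (fastforce simp: sobolev_inf_map_def)
    from choice[OF this] obtain G where
      G: "\<forall>j. (\<exists>L. L-lipschitz_on cube (G j)) \<and> (AE x in unif_cube. weak_deriv [j] (\<lambda>x. S x $ j) x = G j x)"
      by (rule exE)
    have "AE y in unif_cube. \<forall>j\<in>UNIV. K j y = G j y"
    proof (subst AE_finite_all)
      show "\<forall>j\<in>UNIV. AE y in unif_cube. K j y = G j y"
      proof
        fix j
        from spec[OF K, of j] conjunct2[OF spec[OF G, of j]] show "AE y in unif_cube. K j y = G j y"
          by eventually_elim simp
      qed
    qed simp
    with AE_in_cube have eq: "AE y in unif_cube. F y = f\<^sub>\<rho> (V y) * (\<Prod>j\<in>UNIV. G j y)"
      by eventually_elim (simp add: F_def f_eq P.V.U_cube)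
    obtain LG where LG: "LG-lipschitz_on cube (\<lambda>y. \<Prod>j\<in>UNIV. G j y)"
      using lipschitz_prod[of UNIV G] G by auto
    have "V ` cube \<subseteq> cube" using P.V.U_cube by blast
    then have "Lf-lipschitz_on (V ` cube) f\<^sub>\<rho>" by (rule lipschitz_on_subset[OF Lf])
    from lipschitz_on_compose2[OF V_lip this] have "(Lf * L)-lipschitz_on cube (\<lambda>y. f\<^sub>\<rho> (V y))" .
    from lipschitz_mult[OF this LG] obtain M where "M-lipschitz_on cube (\<lambda>y. f\<^sub>\<rho> (V y) * (\<Prod>j\<in>UNIV. G j y))"
      by (elim exE)
    then show thesis using eq by (rule that)
  qed
  obtain B where B: "B > 0" "\<forall>y\<in>cube. \<bar>H y\<bar> \<le> B" using lipschitz_bounded[OF H(1)] by (elim exE conjE)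
  have "\<forall>j. \<exists>b. \<forall>x. \<bar>J j x\<bar> \<le> b" using P.U.J_bounded_borel by (simp add: bounded_borel_def)
  from choice[OF this] obtain b where b: "\<forall>j x. \<bar>J j x\<bar> \<le> b j" by (rule exE)
  \<comment> \<open>The summand 1 provides \<open>1 \<le> Q\<close>, which the comparison of
    products asks for.\<close>
  define Q where "Q = 1 + (\<Sum>j\<in>UNIV. \<bar>b j\<bar>)"
  have Q1: "1 \<le> Q" unfolding Q_def by (simp add: sum_nonneg)
  have Q: "\<bar>J j x\<bar> \<le> Q" for j x
  proof -
    have "\<bar>J j x\<bar> \<le> b j" using b by blast
    moreover have "\<bar>b j\<bar> \<le> (\<Sum>j\<in>UNIV. \<bar>b j\<bar>)" by (rule member_le_sum) auto
    ultimately show ?thesis unfolding Q_def by linarith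
  qed
  \<comment> \<open>Built from \<open>T\<close>, \<open>\<rho>\<close>, the dimension and
    \<open>\<tau>\<^sub>0\<close> alone; the second map is introduced only afterwards.\<close>
  define C where "C = (M * real CARD('n) * Q ^ CARD('n) + B * ((Q + 1) ^ CARD('n) * real CARD('n))) / c
      + B * (1 / \<tau>\<^sub>0) ^ CARD('n) / c + 1"
  have M0: "0 \<le> M" using H(1) by (rule lipschitz_on_nonneg)
  have C0: "0 < C"
  proof -
    have "0 \<le> (M * real CARD('n) * Q ^ CARD('n) + B * ((Q + 1) ^ CARD('n) * real CARD('n))) / c"
      "0 \<le> B * (1 / \<tau>\<^sub>0) ^ CARD('n) / c"
      using M0 Q1 B(1) c(1) assms(11) by (auto intro!: divide_nonneg_pos add_nonneg_nonneg mult_nonneg_nonneg)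
    then show ?thesis unfolding C_def by linarith
  qed
  show ?thesis
  proof (intro exI[of _ C] allI impI, elim conjE)
    fix T' S' :: "(real, 'n) vec \<Rightarrow> (real, 'n) vec"
    assume T': "bij_betw T' cube cube" "coord_monotone T'" "triangular T'" "S' = inv_into cube T'"
      "sobolev_inf_map 1 T'" "sobolev_inf_map 1 S'" and diag: "ereal \<tau>\<^sub>0 \<le> diag_min S'"
    define \<delta> where "\<delta> = sobolev_norm_map 1 (\<lambda>x. T x - T' x)"
    have \<delta>0: "0 \<le> \<delta>" unfolding \<delta>_def by (rule sobolev_norm_map_1)
    have "hellinger (push T \<rho>) (push T' \<rho>) \<le> ereal C * \<delta> \<and>
        ereal (total_var (push T \<rho>) (push T' \<rho>)) \<le> ereal C * \<delta> \<and>
        kl_div (push T \<rho>) (push T' \<rho>) \<le> ereal C * (\<delta> + \<delta>\<^sup>2)"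
    proof (cases \<delta>)
      \<comment> \<open>An infinite distance makes the right-hand sides infinite, as
        \<open>C\<close> is positive.\<close>
      case PInf
      then show ?thesis using C0 by (simp add: power2_eq_square)
    next
      case MInf
      then show ?thesis using \<delta>0 by simp
    next
      case (real d)
      have d0: "0 \<le> d" using \<delta>0 real by simp
      from tri_pair_exists[OF T' order_refl] obtain U' V' J' K' where
        pair': "tri_pair U' V' J' K'" and TU': "AE x in unif_cube. T' x = U' x"
        and J': "\<forall>j. AE x in unif_cube. weak_deriv [j] (\<lambda>x. T' x $ j) x = J' j x"
        and K': "\<forall>j. AE x in unif_cube. weak_deriv [j] (\<lambda>x. S' x $ j) x = K' j x"
        by (elim exE conjE)
      have T'_meas: "T' \<in> measurable mu (restrict_space borel cube)"
        using T'(1) by (intro sobolev_map_measurable[OF T'(5)]) (auto simp: bij_betw_def)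
      define F' where "F' = (\<lambda>y. f (V' y) * (\<Prod>j\<in>UNIV. K' j y))"
      have push': "push T' \<rho> = density mu (\<lambda>y. ennreal (F' y))" "F' \<in> borel_measurable mu" "AE y in mu. 0 < F' y"
        unfolding F'_def \<rho> using tri_pair.push_density_real[OF pair' TU' T'_meas f_meas f_pos] by blast+
      note dist = sobolev_distance[OF assms(5) \<open>1 \<le> 2\<close> T'(5), folded \<delta>_def, unfolded real ereal_less_eq(3)]
      have dU: "AE x in unif_cube. \<bar>U x $ i - U' x $ i\<bar> \<le> d" for i
        using dist(1)[of i] TU TU' by eventually_elim simp
      have dJ: "AE x in unif_cube. \<bar>J j x - J' j x\<bar> \<le> d" for j
        using dist(2)[of j j] spec[OF J, of j] spec[OF J', of j] by eventually_elim simp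
      have \<tau>: "AE y in unif_cube. \<tau>\<^sub>0 \<le> K' j y" for j
        using diag_min_AE[OF diag, of j] spec[OF K', of j] by eventually_elim simp
      have "AE y in unif_cube. \<bar>F y - F' y\<bar> \<le> C * d * F' y"
        unfolding F_def F'_def
        by (rule pushforward_density_estimate[OF pair pair' c H(1) H(2)[unfolded F_def] _ _ Q1 Q d0 dU dJ assms(11) \<tau> C_def])
          (use B in auto)
      then have est: "AE y in mu. \<bar>F y - F' y\<bar> \<le> C * d * F' y" by (simp only: AE_mu_iff)
      have "AE y in mu. 0 < F y \<and> 0 < F' y \<and> \<bar>F y - F' y\<bar> \<le> C * d * F' y"
        using push(3) push'(3) est by eventually_elim simp
      moreover have "prob_space (density mu (\<lambda>y. ennreal (F y)))"
        using prob_space.prob_space_distr[OF assms(7) \<rho>_meas[OF T_meas]] by (simp only: push(1))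
      moreover have "prob_space (density mu (\<lambda>y. ennreal (F' y)))"
        using prob_space.prob_space_distr[OF assms(7) \<rho>_meas[OF T'_meas]] by (simp only: push'(1))
      moreover have "0 \<le> C * d" using C0 d0 by simp
      ultimately have bounds: "hellinger (push T \<rho>) (push T' \<rho>) \<le> ereal (C * d)"
        "total_var (push T \<rho>) (push T' \<rho>) \<le> C * d" "kl_div (push T \<rho>) (push T' \<rho>) \<le> ereal (C * d)"
        unfolding push(1) push'(1) using density_distances[OF push(2) push'(2)] by blast+
      have "C * d \<le> C * (d + d\<^sup>2)" using C0 by (intro mult_left_mono) auto
      then have "ereal (C * d) \<le> ereal C * (\<delta> + \<delta>\<^sup>2)" by (simp add: real)
      with bounds(3) have "kl_div (push T \<rho>) (push T' \<rho>) \<le> ereal C * (\<delta> + \<delta>\<^sup>2)" by (rule order_trans)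
      then show ?thesis using bounds(1,2) by (simp add: real)
    qed
    then show "let \<delta> = sobolev_norm_map 1 (\<lambda>x. T x - T' x) in
        hellinger (push T \<rho>) (push T' \<rho>) \<le> ereal C * \<delta> \<and>
        ereal (total_var (push T \<rho>) (push T' \<rho>)) \<le> ereal C * \<delta> \<and>
        kl_div (push T \<rho>) (push T' \<rho>) \<le> ereal C * (\<delta> + \<delta>\<^sup>2)"
      by (simp only: Let_def \<delta>_def)
  qed
qed

end
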